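(* Let $k$ be a field with $\mathrm{char}(k)=0$ and let $A$ be a connected $\mathbb{N}$-graded unital associative $k$-algebra. Then $$H_{dR}^0(A)\cong HH^{hi}_0(A)\cong k,$$ $$H_{dR}^p(A)\cong HH^{hi}_p(A)\cong 0\quad\text{if } p>0.$$
   Context: $A=\bigoplus_{m\ge0}A_m$ is graded by a weight, $|a|=m$ for $a\in A_m$; connected means $A_0=k$. $HH_\bullet(A)=HH_\bullet(A,A)$ is Hochschild homology, computed by the Hochschild complex $A\otimes A^{\otimes\bullet}$ or by the normalized complex $A\otimes\bar A^{\otimes\bullet}$, $\bar A=A/k\cong\bigoplus_{m>0}A_m$. The weight (Euler) derivation $D:A\to A$ is $D(a)=|a|a$ for homogeneous $a$. The Rinehart-Goodwillie operator $e_D=D\frown-$ on $A\otimes A^{\otimes\bullet}$ is $e_D(a\otimes a_1\ldots a_p)=(-1)^{p-1}|a_p|\,a_pa\otimes a_1\ldots a_{p-1}$ ($a_p$ homogeneous), and $e_D=0$ for $p=0$. It induces $H(e_D):HH_p(A)\to HH_{p-1}(A)$, which satisfies $H(e_D)^2=0$ when $\mathrm{char}(k)\ne2$. The higher Hochschild homology $HH^{hi}_\bullet(A)$ is the homology of $(HH_\bullet(A),H(e_D))$. The normalized Connes differential on $A\otimes\bar A^{\otimes\bullet}$ is $B(a\otimes a_1\ldots a_p)=\sum_{0\le i\le p}(-1)^{pi}\,1\otimes(a_{p-i+1}\ldots a_p\,\bar a\,a_1\ldots a_{p-i})$, where $\bar a$ is the class of $a$ in $\bar A$. It induces $H(B):HH_p(A)\to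 HH_{p+1}(A)$ with $H(B)^2=0$. The de Rham cohomology $H_{dR}^\bullet(A)$ is the homology of the complex $(HH_\bullet(A),H(B))$, with $H^p_{dR}(A)$ the homology at $HH_p(A)$. *)

theory Defs
  imports Complex_Main "HOL-Algebra.AbelCoset" "HOL-Algebra.Module" "HOL-Library.Poly_Mapping"
begin

section \<open>Vector spaces with carriers: quotients, isomorphisms, homology\<close>

text \<open>
  Vector spaces over the field \<open>'k\<close> are \<open>module\<close> records whose scalars are all elements of \<open>'k\<close>.
  The multiplicative fields \<open>mult\<close> and \<open>one\<close> of such a record play no role.
\<close>

definition quotient_module :: "('k, 'v) module \<Rightarrow> 'v set \<Rightarrow> ('k, 'v set) module" where
  "quotient_module M N =
     \<lparr>carrier = a_rcosets\<^bsub>M\<^esub> N, mult = undefined, one = undefined, zero = N,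
      add = (\<lambda>X Y. X <+>\<^bsub>M\<^esub> Y), smult = (\<lambda>c X. \<Union>x\<in>X. N +>\<^bsub>M\<^esub> (c \<odot>\<^bsub>M\<^esub> x))\<rparr>"

text \<open>
  The map induced by \<open>f\<close> with values in the quotient of \<open>M'\<close> by \<open>N'\<close>.  If \<open>f\<close> is linear and maps \<open>N\<close>
  into \<open>N'\<close>, all cosets in the union coincide when \<open>X\<close> is a coset of \<open>N\<close>.
\<close>

definition quotient_map ::
  "('k, 'w) module \<Rightarrow> 'w set \<Rightarrow> ('v \<Rightarrow> 'w) \<Rightarrow> 'v set \<Rightarrow> 'w set" where
  "quotient_map M' N' f X = (\<Union>x\<in>X. N' +>\<^bsub>M'\<^esub> f x)"

definition linear_iso :: "('k, 'v) module \<Rightarrow> ('k, 'w) module \<Rightarrow> bool" (infix \<open>\<cong>\<^sub>k\<close> 50) where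
  "M \<cong>\<^sub>k N \<longleftrightarrow>
     (\<exists>f. bij_betw f (carrier M) (carrier N) \<and>
          (\<forall>x\<in>carrier M. \<forall>y\<in>carrier M. f (x \<oplus>\<^bsub>M\<^esub> y) = f x \<oplus>\<^bsub>N\<^esub> f y) \<and>
          (\<forall>c. \<forall>x\<in>carrier M. f (c \<odot>\<^bsub>M\<^esub> x) = c \<odot>\<^bsub>N\<^esub> f x))"

definition ground_field :: "('k::field, 'k) module" where
  "ground_field = \<lparr>carrier = UNIV, mult = (*), one = 1, zero = 0, add = (+), smult = (*)\<rparr>"

definition zero_module :: "('k, unit) module" where
  "zero_module = \<lparr>carrier = UNIV, mult = undefined, one = undefined, zero = (),
                  add = (\<lambda>_ _. ()), smult = (\<lambda>_ _. ())\<rparr>"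

text \<open>
  Complexes concentrated in degrees \<open>p \<ge> 0\<close>.  In the homological case \<open>d p\<close> maps \<open>C p\<close> to
  \<open>C (p - 1)\<close> and the differential on \<open>C 0\<close> is zero; in the cohomological case \<open>d p\<close> maps \<open>C p\<close> to
  \<open>C (p + 1)\<close> and nothing arrives in \<open>C 0\<close>.
\<close>

definition cycles :: "(nat \<Rightarrow> ('k, 'v) module) \<Rightarrow> (nat \<Rightarrow> 'v \<Rightarrow> 'v) \<Rightarrow> nat \<Rightarrow> 'v set" where
  "cycles C d p = (if p = 0 then carrier (C 0) else a_kernel (C p) (C (p - 1)) (d p))"

definition boundaries :: "(nat \<Rightarrow> ('k, 'v) module) \<Rightarrow> (nat \<Rightarrow> 'v \<Rightarrow> 'v) \<Rightarrow> nat \<Rightarrow> 'v set" where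
  "boundaries C d p = d (Suc p) ` carrier (C (Suc p))"

definition homology ::
  "(nat \<Rightarrow> ('k, 'v) module) \<Rightarrow> (nat \<Rightarrow> 'v \<Rightarrow> 'v) \<Rightarrow> nat \<Rightarrow> ('k, 'v set) module" where
  "homology C d p = quotient_module ((C p)\<lparr>carrier := cycles C d p\<rparr>) (boundaries C d p)"

definition cocycles :: "(nat \<Rightarrow> ('k, 'v) module) \<Rightarrow> (nat \<Rightarrow> 'v \<Rightarrow> 'v) \<Rightarrow> nat \<Rightarrow> 'v set" where
  "cocycles C d p = a_kernel (C p) (C (Suc p)) (d p)"

definition coboundaries :: "(nat \<Rightarrow> ('k, 'v) module) \<Rightarrow> (nat \<Rightarrow> 'v \<Rightarrow> 'v) \<Rightarrow> nat \<Rightarrow> 'v set" where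
  "coboundaries C d p = (if p = 0 then {\<zero>\<^bsub>C 0\<^esub>} else d (p - 1) ` carrier (C (p - 1)))"

definition cohomology ::
  "(nat \<Rightarrow> ('k, 'v) module) \<Rightarrow> (nat \<Rightarrow> 'v \<Rightarrow> 'v) \<Rightarrow> nat \<Rightarrow> ('k, 'v set) module" where
  "cohomology C d p = quotient_module ((C p)\<lparr>carrier := cocycles C d p\<rparr>) (coboundaries C d p)"


section \<open>Connected graded algebras and the weight derivation\<close>

locale graded_algebra = vector_space scale
  for scale :: "'k::field \<Rightarrow> 'a::ring_1 \<Rightarrow> 'a" (infixr \<open>*s\<close> 75) +
  fixes \<A> :: "nat \<Rightarrow> 'a set"
  assumes scale_mult_left: "(c *s x) * y = c *s (x * y)"
    and scale_mult_right: "x * (c *s y) = c *s (x * y)"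
    and subspace_component: "subspace (\<A> m)"
    and direct_sum:
      "\<exists>!a. (\<forall>m. a m \<in> \<A> m) \<and> finite {m. a m \<noteq> 0} \<and> x = (\<Sum>m | a m \<noteq> 0. a m)"
    and one_component: "1 \<in> \<A> 0"
    and mult_component: "x \<in> \<A> m \<Longrightarrow> y \<in> \<A> n \<Longrightarrow> x * y \<in> \<A> (m + n)"

locale connected_graded_algebra = graded_algebra +
  assumes connected: "\<A> 0 = {c *s 1 | c. True}"

definition hom_components :: "(nat \<Rightarrow> 'a::comm_monoid_add set) \<Rightarrow> 'a \<Rightarrow> nat \<Rightarrow> 'a" where
  "hom_components \<A> x =
     (THE a. (\<forall>m. a m \<in> \<A> m) \<and> finite {m. a m \<noteq> 0} \<and> x = (\<Sum>m | a m \<noteq> 0. a m))"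

definition weight_derivation ::
  "('k::field \<Rightarrow> 'a::ring_1 \<Rightarrow> 'a) \<Rightarrow> (nat \<Rightarrow> 'a set) \<Rightarrow> 'a \<Rightarrow> 'a" where
  "weight_derivation scale \<A> x =
     (\<Sum>m | hom_components \<A> x m \<noteq> 0. scale (of_nat m) (hom_components \<A> x m))"

lemma (in graded_algebra) weight_derivation_homogeneous:
  assumes "x \<in> \<A> m"
  shows "weight_derivation scale \<A> x = of_nat m *s x"
proof -
  define a where "a = (\<lambda>n. if n = m then x else 0)"
  have supp: "{n. a n \<noteq> 0} = (if x = 0 then {} else {m})"
    by (auto simp: a_def)
  have "(\<forall>n. a n \<in> \<A> n) \<and> finite {n. a n \<noteq> 0} \<and> x = (\<Sum>n | a n \<noteq> 0. a n)"
    unfolding supp using assms subspace_0[OF subspace_component] by (auto simp: a_def)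
  then have "hom_components \<A> x = a"
    unfolding hom_components_def using the1_equality[OF direct_sum] by blast
  then show ?thesis
    unfolding weight_derivation_def using supp by (auto simp: a_def)
qed


section \<open>The Hochschild complex\<close>

text \<open>
  \<open>A \<otimes> A\<^sup>\<otimes>\<^sup>p\<close> is presented in the usual way: the free vector space on lists \<open>[a, a\<^sub>1, \<dots>, a\<^sub>p]\<close> of length
  \<open>p + 1\<close>, divided by the multilinearity relations.
\<close>

type_synonym ('k, 'a) words = "'a list \<Rightarrow>\<^sub>0 'k"

definition words_scale :: "'k::field \<Rightarrow> ('k, 'a) words \<Rightarrow> ('k, 'a) words" where
  "words_scale c x = Poly_Mapping.map ((*) c) x"

lemma lookup_words_scale: "Poly_Mapping.lookup (words_scale c x) l = c * Poly_Mapping.lookup x l"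
  by (simp add: words_scale_def map.rep_eq when_def)

global_interpretation words: vector_space words_scale
  by unfold_locales
    (auto intro!: poly_mapping_eqI simp: lookup_words_scale lookup_add algebra_simps)

definition words_extend ::
  "('a list \<Rightarrow> ('k::field, 'a) words) \<Rightarrow> ('k, 'a) words \<Rightarrow> ('k, 'a) words" where
  "words_extend f x = (\<Sum>l\<in>Poly_Mapping.keys x. words_scale (Poly_Mapping.lookup x l) (f l))"

definition words_module :: "nat \<Rightarrow> ('k::field, ('k, 'a) words) module" where
  "words_module p =
     \<lparr>carrier = {x. \<forall>l\<in>Poly_Mapping.keys x. length l = Suc p}, mult = undefined, one = undefined,
      zero = 0, add = (+), smult = words_scale\<rparr>"

inductive_set multilinear_relators ::
  "('k::field \<Rightarrow> 'a::ring_1 \<Rightarrow> 'a) \<Rightarrow> nat \<Rightarrow> ('k, 'a) words set"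
  for scale :: "'k::field \<Rightarrow> 'a::ring_1 \<Rightarrow> 'a" and p :: nat where
  add_relator: "length us + length vs = p \<Longrightarrow>
    Poly_Mapping.single (us @ (x + y) # vs) 1
      - (Poly_Mapping.single (us @ x # vs) 1 + Poly_Mapping.single (us @ y # vs) 1)
    \<in> multilinear_relators scale p"
| scale_relator: "length us + length vs = p \<Longrightarrow>
    Poly_Mapping.single (us @ scale c x # vs) 1
      - words_scale c (Poly_Mapping.single (us @ x # vs) 1)
    \<in> multilinear_relators scale p"

text \<open>
  The degenerate tensors \<open>a \<otimes> a\<^sub>1 \<dots> a\<^sub>p\<close> with some \<open>a\<^sub>i = 1\<close>, \<open>i > 0\<close>: dividing by their span turns
  \<open>A \<otimes> A\<^sup>\<otimes>\<^sup>p\<close> into \<open>A \<otimes> (A/k)\<^sup>\<otimes>\<^sup>p\<close>.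
\<close>

definition degenerate_words :: "nat \<Rightarrow> ('k::field, 'a::ring_1) words set" where
  "degenerate_words p =
     {Poly_Mapping.single (a # us @ 1 # vs) 1 | a us vs. Suc (length us + length vs) = p}"

definition hoch_relations ::
  "('k::field \<Rightarrow> 'a::ring_1 \<Rightarrow> 'a) \<Rightarrow> nat \<Rightarrow> ('k, 'a) words set" where
  "hoch_relations scale p = words.span (multilinear_relators scale p)"

definition normalized_relations ::
  "('k::field \<Rightarrow> 'a::ring_1 \<Rightarrow> 'a) \<Rightarrow> nat \<Rightarrow> ('k, 'a) words set" where
  "normalized_relations scale p =
     words.span (multilinear_relators scale p \<union> degenerate_words p)"

definition hoch_chains ::
  "('k::field \<Rightarrow> 'a::ring_1 \<Rightarrow> 'a) \<Rightarrow> nat \<Rightarrow> ('k, ('k, 'a) words set) module" where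
  "hoch_chains scale p = quotient_module (words_module p) (hoch_relations scale p)"

definition normalized_chains ::
  "('k::field \<Rightarrow> 'a::ring_1 \<Rightarrow> 'a) \<Rightarrow> nat \<Rightarrow> ('k, ('k, 'a) words set) module" where
  "normalized_chains scale p = quotient_module (words_module p) (normalized_relations scale p)"

text \<open>
  In the following three definitions \<open>l = [a, a\<^sub>1, \<dots>, a\<^sub>p]\<close> with \<open>p = length l - 1\<close>; the first one is
  \<open>b(a \<otimes> a\<^sub>1\<dots>a\<^sub>p) = a a\<^sub>1 \<otimes> a\<^sub>2\<dots>a\<^sub>p + (\<Sum>0<i<p. (-1)\<^sup>i a \<otimes> a\<^sub>1\<dots>(a\<^sub>i a\<^sub>i\<^sub>+\<^sub>1)\<dots>a\<^sub>p) + (-1)\<^sup>p a\<^sub>p a \<otimes> a\<^sub>1\<dots>a\<^sub>p\<^sub>-\<^sub>1\<close>.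
\<close>

definition b_word :: "'a::ring_1 list \<Rightarrow> ('k::field, 'a) words" where
  "b_word l =
     (let p = length l - 1 in
      if p = 0 then 0
      else (\<Sum>i<p. Poly_Mapping.single (take i l @ (l ! i * l ! Suc i) # drop (i + 2) l) ((-1) ^ i))
           + Poly_Mapping.single ((l ! p * l ! 0) # tl (butlast l)) ((-1) ^ p))"

text \<open>On homogeneous \<open>a\<^sub>p\<close> the factor \<open>D a\<^sub>p\<close> is \<open>|a\<^sub>p| a\<^sub>p\<close>.\<close>

definition eD_word :: "('a::ring_1 \<Rightarrow> 'a) \<Rightarrow> 'a list \<Rightarrow> ('k::field, 'a) words" where
  "eD_word D l =
     (let p = length l - 1 in
      if p = 0 then 0
      else Poly_Mapping.single ((D (l ! p) * l ! 0) # tl (butlast l)) ((-1) ^ (p - 1)))"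

definition B_word :: "'a::ring_1 list \<Rightarrow> ('k::field, 'a) words" where
  "B_word l =
     (let p = length l - 1 in
      \<Sum>i\<le>p. Poly_Mapping.single (1 # drop (p + 1 - i) l @ take (p + 1 - i) l) ((-1) ^ (p * i)))"

definition hoch_b ::
  "('k::field \<Rightarrow> 'a::ring_1 \<Rightarrow> 'a) \<Rightarrow> nat \<Rightarrow> ('k, 'a) words set \<Rightarrow> ('k, 'a) words set" where
  "hoch_b scale p =
     quotient_map (words_module (p - 1)) (hoch_relations scale (p - 1)) (words_extend b_word)"

definition normalized_b ::
  "('k::field \<Rightarrow> 'a::ring_1 \<Rightarrow> 'a) \<Rightarrow> nat \<Rightarrow> ('k, 'a) words set \<Rightarrow> ('k, 'a) words set" where
  "normalized_b scale p =
     quotient_map (words_module (p - 1)) (normalized_relations scale (p - 1)) (words_extend b_word)"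

definition eD_chain ::
  "('k::field \<Rightarrow> 'a::ring_1 \<Rightarrow> 'a) \<Rightarrow> (nat \<Rightarrow> 'a set) \<Rightarrow> nat
     \<Rightarrow> ('k, 'a) words set \<Rightarrow> ('k, 'a) words set" where
  "eD_chain scale \<A> p =
     quotient_map (words_module (p - 1)) (hoch_relations scale (p - 1))
       (words_extend (eD_word (weight_derivation scale \<A>)))"

definition connes_B_chain ::
  "('k::field \<Rightarrow> 'a::ring_1 \<Rightarrow> 'a) \<Rightarrow> nat \<Rightarrow> ('k, 'a) words set \<Rightarrow> ('k, 'a) words set" where
  "connes_B_chain scale p =
     quotient_map (words_module (Suc p)) (normalized_relations scale (Suc p)) (words_extend B_word)"


section \<open>Hochschild homology, higher Hochschild homology and de Rham cohomology\<close>

definition HH ::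
  "('k::field \<Rightarrow> 'a::ring_1 \<Rightarrow> 'a) \<Rightarrow> nat \<Rightarrow> ('k, ('k, 'a) words set set) module" where
  "HH scale = homology (hoch_chains scale) (hoch_b scale)"

definition HH_normalized ::
  "('k::field \<Rightarrow> 'a::ring_1 \<Rightarrow> 'a) \<Rightarrow> nat \<Rightarrow> ('k, ('k, 'a) words set set) module" where
  "HH_normalized scale = homology (normalized_chains scale) (normalized_b scale)"

definition H_eD ::
  "('k::field \<Rightarrow> 'a::ring_1 \<Rightarrow> 'a) \<Rightarrow> (nat \<Rightarrow> 'a set) \<Rightarrow> nat
     \<Rightarrow> ('k, 'a) words set set \<Rightarrow> ('k, 'a) words set set" where
  "H_eD scale \<A> p =
     quotient_map (hoch_chains scale (p - 1))
       (boundaries (hoch_chains scale) (hoch_b scale) (p - 1)) (eD_chain scale \<A> p)"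

definition H_B ::
  "('k::field \<Rightarrow> 'a::ring_1 \<Rightarrow> 'a) \<Rightarrow> nat
     \<Rightarrow> ('k, 'a) words set set \<Rightarrow> ('k, 'a) words set set" where
  "H_B scale p =
     quotient_map (normalized_chains scale (Suc p))
       (boundaries (normalized_chains scale) (normalized_b scale) (Suc p)) (connes_B_chain scale p)"

definition HH_hi ::
  "('k::field \<Rightarrow> 'a::ring_1 \<Rightarrow> 'a) \<Rightarrow> (nat \<Rightarrow> 'a set) \<Rightarrow> nat
     \<Rightarrow> ('k, ('k, 'a) words set set set) module" where
  "HH_hi scale \<A> = homology (HH scale) (H_eD scale \<A>)"

text \<open>
  The operator \<open>B\<close> lives on the normalized complex, so Hochschild homology is here computed by that
  complex.
\<close>

definition H_dR ::
  "('k::field \<Rightarrow> 'a::ring_1 \<Rightarrow> 'a) \<Rightarrow> nat \<Rightarrow> ('k, ('k, 'a) words set set set) module" where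
  "H_dR scale = cohomology (HH_normalized scale) (H_B scale)"

end

theory Submission
  imports Defs
begin

text \<open>
  Let \<open>L\<close> multiply words of weight \<open>m\<close> by \<open>m\<close>.  Rinehart's homotopy \<open>E\<close> satisfies
  \<open>e\<^sub>D B + B e\<^sub>D + b E + E b = L\<close>, so that \<open>H(e\<^sub>D) H(B) + H(B) H(e\<^sub>D)\<close> is multiplication by the weight on
  Hochschild homology.  Hence each of \<open>H(e\<^sub>D)\<close> and \<open>H(B)\<close> is a contracting homotopy of the complex defined
  by the other one in positive weight, as \<open>k\<close> has characteristic \<open>0\<close>.  In weight \<open>0\<close> connectedness
  leaves the Hochschild homology of \<open>k\<close>, spanned by the words \<open>1 \<otimes> 1\<dots>1\<close>: these are degenerate in the normalized
  complex, and \<open>b\<close> pairs them off in the unnormalized one, except in degree \<open>0\<close>.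

  All complexes are iterated subquotients of the space of words.  They are handled by recording
  subspaces \<open>K \<subseteq> S\<close> of words and a map from \<open>S\<close> that identifies the module with \<open>S/K\<close>.
\<close>

section \<open>Subquotients\<close>

text \<open>\<open>e_D\<close> acts on the unnormalized complex and \<open>B\<close> on the
  normalized one, so the two claims concern different quotients of the words. With
  \<open>s N\<close> in the role of \<open>B\<close>, the Cartan formula already holds on
  unnormalized words modulo the multilinearity relations alone. The weight argument is therefore
  carried out once, for an abstract family \<open>Q\<close> of relations, and used with and without
  the degenerate words. That images lie in kernels has different reasons on the two sides.
  \<open>B\<close> squares to zero modulo degenerate words, hence on chains. \<open>e_D\<close>
  squares to zero only in homology: contraction with the second-order operator \<open>D^2\<close>
  makes twice its square null homotopic, and 2 is invertible. Killing positive weights leaves at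
  most the multiples of \<open>1 \<otimes> 1...1\<close>. That this class survives in degree 0 needs
  an invariant, the product of the augmentations of all entries. The same invariant shows that words
  of ones are not relations, which settles the even positive degrees of the unnormalized
  complex.\<close>

lemma linear_iso_trans:
  assumes "M \<cong>\<^sub>k N" "N \<cong>\<^sub>k P"
  shows "M \<cong>\<^sub>k P"
proof -
  obtain f where f: "bij_betw f (carrier M) (carrier N)"
      "\<forall>x\<in>carrier M. \<forall>y\<in>carrier M. f (x \<oplus>\<^bsub>M\<^esub> y) = f x \<oplus>\<^bsub>N\<^esub> f y"
      "\<forall>c. \<forall>x\<in>carrier M. f (c \<odot>\<^bsub>M\<^esub> x) = c \<odot>\<^bsub>N\<^esub> f x"
    using assms unfolding linear_iso_def by blast
  obtain g where g: "bij_betw g (carrier N) (carrier P)"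
      "\<forall>x\<in>carrier N. \<forall>y\<in>carrier N. g (x \<oplus>\<^bsub>N\<^esub> y) = g x \<oplus>\<^bsub>P\<^esub> g y"
      "\<forall>c. \<forall>x\<in>carrier N. g (c \<odot>\<^bsub>N\<^esub> x) = c \<odot>\<^bsub>P\<^esub> g x"
    using assms unfolding linear_iso_def by blast
  have "\<forall>x\<in>carrier M. f x \<in> carrier N" using f(1) by (auto dest: bij_betwE)
  then show ?thesis
    unfolding linear_iso_def using f g by (intro exI[of _ "g \<circ> f"]) (auto intro: bij_betw_trans)
qed

locale subquotients = vector_space scale
  for scale :: "'k::field \<Rightarrow> 'v::ab_group_add \<Rightarrow> 'v" (infixr \<open>*s\<close> 75)
begin

text \<open>All levels of iterated quotients are described by subspaces of one fixed space, so the
  type of representatives never changes although the type of classes does. \<open>\<pi>\<close> is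
  total but constrained on \<open>S\<close> only; the last clause says that its kernel is
  \<open>K\<close> without subtracting in \<open>M\<close>.\<close>

definition presents :: "('k, 'm) module \<Rightarrow> 'v set \<Rightarrow> 'v set \<Rightarrow> ('v \<Rightarrow> 'm) \<Rightarrow> bool" where
  "presents M S K \<pi> \<longleftrightarrow>
     subspace S \<and> subspace K \<and> K \<subseteq> S \<and> carrier M = \<pi> ` S \<and> \<zero>\<^bsub>M\<^esub> = \<pi> 0 \<and>
     (\<forall>x\<in>S. \<forall>y\<in>S. \<pi> (x + y) = \<pi> x \<oplus>\<^bsub>M\<^esub> \<pi> y) \<and>
     (\<forall>c. \<forall>x\<in>S. \<pi> (c *s x) = c \<odot>\<^bsub>M\<^esub> \<pi> x) \<and>
     (\<forall>x\<in>S. \<forall>y\<in>S. \<pi> x = \<pi> y \<longleftrightarrow> x - y \<in> K)"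

lemma presentsD:
  assumes "presents M S K \<pi>"
  shows "subspace S" "subspace K" "K \<subseteq> S" "carrier M = \<pi> ` S" "\<zero>\<^bsub>M\<^esub> = \<pi> 0"
    "x \<in> S \<Longrightarrow> y \<in> S \<Longrightarrow> \<pi> (x + y) = \<pi> x \<oplus>\<^bsub>M\<^esub> \<pi> y"
    "x \<in> S \<Longrightarrow> \<pi> (c *s x) = c \<odot>\<^bsub>M\<^esub> \<pi> x"
    "x \<in> S \<Longrightarrow> y \<in> S \<Longrightarrow> \<pi> x = \<pi> y \<longleftrightarrow> x - y \<in> K"
  using assms unfolding presents_def by blast+

lemma coset_eq:
  assumes M: "presents M S K \<pi>" and L: "subspace L" "K \<subseteq> L" "L \<subseteq> S" and x: "x \<in> S"
  shows "(\<pi> ` L) +>\<^bsub>M\<^esub> \<pi> x = {\<pi> y |y. y \<in> S \<and> y - x \<in> L}" (is "?l = ?r")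
proof
  show "?l \<subseteq> ?r"
  proof
    fix z assume "z \<in> ?l"
    then obtain n where n: "n \<in> L" "z = \<pi> n \<oplus>\<^bsub>M\<^esub> \<pi> x" by (auto simp: a_r_coset_def')
    then have "z = \<pi> (n + x)" using presentsD(6)[OF M] L x by auto
    moreover have "n + x \<in> S" using n L x subspace_add[OF presentsD(1)[OF M]] by blast
    ultimately show "z \<in> ?r" using n by force
  qed
  show "?r \<subseteq> ?l"
  proof
    fix z assume "z \<in> ?r"
    then obtain y where y: "y \<in> S" "y - x \<in> L" "z = \<pi> y" by auto
    have "\<pi> y = \<pi> ((y - x) + x)" by simp
    also have "\<dots> = \<pi> (y - x) \<oplus>\<^bsub>M\<^esub> \<pi> x" using presentsD(6)[OF M] L x y by blast
    finally show "z \<in> ?l" using y by (auto simp: a_r_coset_def')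
  qed
qed

lemma coset_eq_iff:
  assumes M: "presents M S K \<pi>" and L: "subspace L" "K \<subseteq> L" "L \<subseteq> S"
    and x: "x \<in> S" and y: "y \<in> S"
  shows "(\<pi> ` L) +>\<^bsub>M\<^esub> \<pi> x = (\<pi> ` L) +>\<^bsub>M\<^esub> \<pi> y \<longleftrightarrow> x - y \<in> L"
proof -
  note eq = coset_eq[OF M L]
  show ?thesis
  proof
    assume "(\<pi> ` L) +>\<^bsub>M\<^esub> \<pi> x = (\<pi> ` L) +>\<^bsub>M\<^esub> \<pi> y"
    moreover have "\<pi> x \<in> {\<pi> y |y. y \<in> S \<and> y - x \<in> L}" using x subspace_0[OF L(1)] by force
    ultimately obtain z where z: "\<pi> x = \<pi> z" "z \<in> S" "z - y \<in> L"
      unfolding eq[OF x] eq[OF y] by auto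
    then have "x - z \<in> L" using presentsD(8)[OF M x z(2)] L by blast
    then have "(x - z) + (z - y) \<in> L" using z(3) subspace_add[OF L(1)] by blast
    then show "x - y \<in> L" by simp
  next
    assume xy: "x - y \<in> L"
    have "z - x \<in> L \<longleftrightarrow> z - y \<in> L" for z
    proof
      assume "z - x \<in> L"
      from subspace_add[OF L(1) this xy] show "z - y \<in> L" by simp
    next
      assume "z - y \<in> L"
      from subspace_diff[OF L(1) this xy] show "z - x \<in> L" by simp
    qed
    then show "(\<pi> ` L) +>\<^bsub>M\<^esub> \<pi> x = (\<pi> ` L) +>\<^bsub>M\<^esub> \<pi> y" unfolding eq[OF x] eq[OF y] by simp
  qed
qed

text \<open>The third isomorphism theorem: if \<open>M\<close> is \<open>S/K\<close>, then the
  quotient of \<open>T/K\<close> by \<open>L/K\<close> is \<open>T/L\<close>. Every passage from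
  chains to homology, and from homology to homology of homology, is an instance.\<close>

lemma presents_quotient:
  assumes M: "presents M S K \<pi>" and L: "subspace L" "K \<subseteq> L" "L \<subseteq> T"
    and T: "subspace T" "T \<subseteq> S"
  shows "presents (quotient_module (M\<lparr>carrier := \<pi> ` T\<rparr>) (\<pi> ` L)) T L (\<lambda>x. (\<pi> ` L) +>\<^bsub>M\<^esub> \<pi> x)"
    (is "presents ?Q T L ?\<rho>")
proof -
  have LS: "L \<subseteq> S" using L T by blast
  note eq = coset_eq[OF M L(1,2) LS] and iff = coset_eq_iff[OF M L(1,2) LS]
  note add = subspace_add[OF presentsD(1)[OF M]] and scl = subspace_scale[OF presentsD(1)[OF M]]
  have coset [simp]: "A +>\<^bsub>M\<lparr>carrier := \<pi> ` T\<rparr>\<^esub> z = A +>\<^bsub>M\<^esub> z" for A z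
    by (simp add: a_r_coset_def')
  have "carrier ?Q = ?\<rho> ` T"
    by (auto simp: quotient_module_def A_RCOSETS_def')
  moreover have "\<zero>\<^bsub>?Q\<^esub> = ?\<rho> 0"
    using LS subspace_0[OF presentsD(1)[OF M]] by (auto simp: quotient_module_def eq)
  moreover have "?\<rho> (x + y) = ?\<rho> x \<oplus>\<^bsub>?Q\<^esub> ?\<rho> y" if x: "x \<in> T" and y: "y \<in> T" for x y
  proof -
    have xS: "x \<in> S" and yS: "y \<in> S" using x y T by auto
    have "?\<rho> x \<oplus>\<^bsub>?Q\<^esub> ?\<rho> y = {\<pi> u \<oplus>\<^bsub>M\<^esub> \<pi> v |u v. u \<in> S \<and> u - x \<in> L \<and> v \<in> S \<and> v - y \<in> L}"
      by (auto simp: quotient_module_def set_add_def' eq[OF xS] eq[OF yS])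
    also have "\<dots> = {\<pi> (u + v) |u v. u \<in> S \<and> u - x \<in> L \<and> v \<in> S \<and> v - y \<in> L}"
      by (metis (no_types, lifting) presentsD(6)[OF M])
    also have "\<dots> = {\<pi> w |w. w \<in> S \<and> w - (x + y) \<in> L}" (is "?A = ?B")
    proof
      show "?A \<subseteq> ?B"
      proof
        fix z assume "z \<in> ?A"
        then obtain u v where uv: "z = \<pi> (u + v)" "u \<in> S" "u - x \<in> L" "v \<in> S" "v - y \<in> L" by auto
        have "u + v - (x + y) = (u - x) + (v - y)" by simp
        then have "u + v - (x + y) \<in> L" using subspace_add[OF L(1) uv(3,5)] by metis
        then show "z \<in> ?B" using uv add by blast
      qed
      show "?B \<subseteq> ?A"
      proof
        \<comment> \<open>A representative \<open>w\<close> of the sum is split as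
          \<open>(w - y) + y\<close>, so that the whole deviation from \<open>x + y\<close> goes
          into the first summand.\<close>
        fix z assume "z \<in> ?B"
        then obtain w where w: "z = \<pi> w" "w \<in> S" "w - (x + y) \<in> L" by auto
        have "w = (w - y) + y" "w - y \<in> S" "(w - y) - x \<in> L" "y - y \<in> L"
          using w yS subspace_diff[OF presentsD(1)[OF M]] subspace_0[OF L(1)]
          by (auto simp: algebra_simps)
        then show "z \<in> ?A" using w(1) yS by (intro CollectI exI[of _ "w - y"] exI[of _ y]) simp
      qed
    qed
    also have "\<dots> = ?\<rho> (x + y)" using eq[OF add[OF xS yS]] by simp
    finally show ?thesis by simp
  qed
  moreover have "?\<rho> (c *s x) = c \<odot>\<^bsub>?Q\<^esub> ?\<rho> x" if x: "x \<in> T" for c x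
  proof -
    have xS: "x \<in> S" using x T by auto
    have "c \<odot>\<^bsub>?Q\<^esub> ?\<rho> x = (\<Union>z\<in>?\<rho> x. (\<pi> ` L) +>\<^bsub>M\<^esub> (c \<odot>\<^bsub>M\<^esub> z))"
      by (simp add: quotient_module_def)
    \<comment> \<open>Scalar multiplication is a union over all representatives; each of them
      contributes the same coset, and there is at least one.\<close>
    also have "\<dots> = (\<Union>z\<in>?\<rho> x. ?\<rho> (c *s x))"
    proof (rule SUP_cong[OF refl])
      fix z assume "z \<in> ?\<rho> x"
      then obtain y where y: "z = \<pi> y" "y \<in> S" "y - x \<in> L" by (auto simp: eq[OF xS])
      have "c *s y - c *s x \<in> L" using subspace_scale[OF L(1) y(3)] by (simp add: scale_right_diff_distrib)
      then show "(\<pi> ` L) +>\<^bsub>M\<^esub> (c \<odot>\<^bsub>M\<^esub> z) = ?\<rho> (c *s x)"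
        using iff[OF scl[OF y(2)] scl[OF xS]] y presentsD(7)[OF M] by auto
    qed
    also have "\<dots> = ?\<rho> (c *s x)"
      using xS subspace_0[OF L(1)] by (auto simp: eq[OF xS])
    finally show ?thesis by simp
  qed
  moreover have "?\<rho> x = ?\<rho> y \<longleftrightarrow> x - y \<in> L" if "x \<in> T" "y \<in> T" for x y
    using that T iff by blast
  ultimately show ?thesis
    unfolding presents_def using L(1,3) T(1) by (intro conjI ballI allI)
qed

text \<open>The union in \<open>quotient_map\<close> collapses to one coset because \<open>g\<close>
  maps \<open>L\<close> into \<open>L'\<close>. It is enough to know \<open>f\<close> on classes of
  elements of \<open>T\<close>: by \<open>L \<subseteq> T\<close> the coset of an element of
  \<open>T\<close> is represented inside \<open>T\<close>.\<close>

lemma quotient_map_eq: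
  assumes M: "presents M S K \<pi>" and L: "subspace L" "K \<subseteq> L" "L \<subseteq> T" "subspace T" "T \<subseteq> S"
    and M': "presents M' S' K' \<pi>'" and L': "subspace L'" "K' \<subseteq> L'" "L' \<subseteq> S'"
    and f: "\<And>x. x \<in> T \<Longrightarrow> f (\<pi> x) = \<pi>' (g x)"
    and g: "\<And>x. x \<in> T \<Longrightarrow> g x \<in> S'" "\<And>x. x \<in> L \<Longrightarrow> g x \<in> L'" "\<And>x y. g (x - y) = g x - g y"
    and x: "x \<in> T"
  shows "quotient_map M' (\<pi>' ` L') f ((\<pi> ` L) +>\<^bsub>M\<^esub> \<pi> x) = (\<pi>' ` L') +>\<^bsub>M'\<^esub> \<pi>' (g x)"
proof -
  have LS: "L \<subseteq> S" and xS: "x \<in> S" using L x by auto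
  note eq = coset_eq[OF M L(1,2) LS xS] and iff = coset_eq_iff[OF M' L']
  have "(\<pi>' ` L') +>\<^bsub>M'\<^esub> f z = (\<pi>' ` L') +>\<^bsub>M'\<^esub> \<pi>' (g x)" if z: "z \<in> (\<pi> ` L) +>\<^bsub>M\<^esub> \<pi> x" for z
  proof -
    obtain y where y: "z = \<pi> y" "y \<in> S" "y - x \<in> L" using z unfolding eq by auto
    have "(y - x) + x \<in> T" using y(3) L(3) x subspace_add[OF L(4)] by blast
    then have yT: "y \<in> T" by simp
    show ?thesis using iff[OF g(1)[OF yT] g(1)[OF x]] f[OF yT] g(2)[OF y(3)] g(3) y(1) by simp
  qed
  moreover have "\<pi> x \<in> (\<pi> ` L) +>\<^bsub>M\<^esub> \<pi> x" using eq xS subspace_0[OF L(1)] by force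
  ultimately show ?thesis unfolding quotient_map_def by blast
qed

text \<open>The pair \<open>S\<close>, \<open>K\<close> determines the module up to isomorphism.
  Homology modules can thus be compared with \<open>ground_field\<close> or
  \<open>zero_module\<close> by exhibiting the same pair for both.\<close>

lemma presents_linear_iso:
  assumes M: "presents M S K \<pi>" and N: "presents N S K \<rho>"
  shows "M \<cong>\<^sub>k N"
proof -
  define f where "f z = \<rho> (SOME x. x \<in> S \<and> \<pi> x = z)" for z
  have f: "f (\<pi> x) = \<rho> x" if x: "x \<in> S" for x
  proof -
    have "\<exists>y. y \<in> S \<and> \<pi> y = \<pi> x" using x by auto
    from someI_ex[OF this] show ?thesis
      unfolding f_def using presentsD(8)[OF M _ x] presentsD(8)[OF N _ x] by blast
  qed
  note add = subspace_add[OF presentsD(1)[OF M]] and scl = subspace_scale[OF presentsD(1)[OF M]]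
  have "inj_on f (carrier M)"
    unfolding presentsD(4)[OF M] using f presentsD(8)[OF M] presentsD(8)[OF N]
    by (auto simp: inj_on_def)
  moreover have "f ` carrier M = carrier N"
    unfolding presentsD(4)[OF M] presentsD(4)[OF N] image_image using f by auto
  moreover have "f (\<pi> x \<oplus>\<^bsub>M\<^esub> \<pi> y) = \<rho> x \<oplus>\<^bsub>N\<^esub> \<rho> y" if "x \<in> S" "y \<in> S" for x y
    using presentsD(6)[OF M that] presentsD(6)[OF N that] f add that by metis
  moreover have "f (c \<odot>\<^bsub>M\<^esub> \<pi> x) = c \<odot>\<^bsub>N\<^esub> \<rho> x" if "x \<in> S" for x c
    using presentsD(7)[OF M that] presentsD(7)[OF N that] f scl that by metis
  ultimately show ?thesis
    unfolding linear_iso_def bij_betw_def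
    by (intro exI[of _ f]) (auto simp: presentsD(4)[OF M] f)
qed

section \<open>Homology and cohomology of complexes of subquotients\<close>

lemma subspace_cycles:
  assumes "Vector_Spaces.linear scale scale g" "subspace S" "subspace K"
  shows "subspace {x \<in> S. g x \<in> K}"
proof -
  interpret g: Vector_Spaces.linear scale scale g by fact
  show ?thesis
    using assms(2,3) unfolding subspace_def by (auto simp: g.add g.scale g.zero)
qed

lemma subspace_boundaries:
  assumes "Vector_Spaces.linear scale scale g" "subspace S" "subspace K"
  shows "subspace {g y + k |y k. y \<in> S \<and> k \<in> K}"
proof -
  interpret g: Vector_Spaces.linear scale scale g by fact
  have "subspace {x + y |x y. x \<in> g ` S \<and> y \<in> K}"
    by (intro subspace_sums g.subspace_image assms)
  moreover have "{x + y |x y. x \<in> g ` S \<and> y \<in> K} = {g y + k |y k. y \<in> S \<and> k \<in> K}" by auto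
  ultimately show ?thesis by simp
qed

text \<open>The operator \<open>g\<close> on representatives need not square to zero; the conditions
  are imposed modulo \<open>K\<close>. In degree 0 truncated subtraction turns the cycle condition
  into \<open>g x \<in> K 0\<close>, which \<open>g0\<close> makes automatic.\<close>

lemma presents_homology:
  assumes C: "\<And>p. presents (C p) (S p) (K p) (\<pi> p)"
    and g: "Vector_Spaces.linear scale scale g"
    and d: "\<And>p x. x \<in> S (Suc p) \<Longrightarrow> d (Suc p) (\<pi> (Suc p) x) = \<pi> p (g x)"
    and gS: "\<And>p x. x \<in> S (Suc p) \<Longrightarrow> g x \<in> S p"
    and g0: "\<And>x. x \<in> S 0 \<Longrightarrow> g x \<in> K 0"
    and gK: "\<And>p x. x \<in> K (Suc p) \<Longrightarrow> g x \<in> K p"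
    and gg: "\<And>p x. x \<in> S (Suc (Suc p)) \<Longrightarrow> g (g x) \<in> K p"
  shows "boundaries C d p = \<pi> p ` {g y + k |y k. y \<in> S (Suc p) \<and> k \<in> K p}"
    and "presents (homology C d p) {x \<in> S p. g x \<in> K (p - 1)}
           {g y + k |y k. y \<in> S (Suc p) \<and> k \<in> K p} (\<lambda>x. boundaries C d p +>\<^bsub>C p\<^esub> \<pi> p x)"
proof -
  interpret g: Vector_Spaces.linear scale scale g by fact
  note SK = presentsD(1-3)[OF C]
  define L where "L = {g y + k |y k. y \<in> S (Suc p) \<and> k \<in> K p}"
  have iff: "\<pi> p x = \<pi> p y \<longleftrightarrow> x - y \<in> K p" if "x \<in> S p" "y \<in> S p" for p x y
    using presentsD(8)[OF C that] .
  have sub: "subspace L" "subspace {x \<in> S p. g x \<in> K (p - 1)}"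
    unfolding L_def by (intro subspace_boundaries subspace_cycles SK g)+
  have KL: "K p \<subseteq> L"
    unfolding L_def using subspace_0[OF SK(1)] g.zero by force
  have LT: "L \<subseteq> {x \<in> S p. g x \<in> K (p - 1)}"
  proof
    fix x assume "x \<in> L"
    then obtain y k where x: "x = g y + k" "y \<in> S (Suc p)" "k \<in> K p" by (auto simp: L_def)
    have xS: "x \<in> S p" using x gS SK subspace_add[OF SK(1)] by blast
    have "g x \<in> K (p - 1)"
    proof (cases p)
      case 0
      then show ?thesis using g0 xS by simp
    next
      case (Suc q)
      then show ?thesis using x gg gK subspace_add[OF SK(2)] by (auto simp: g.add)
    qed
    with xS show "x \<in> {x \<in> S p. g x \<in> K (p - 1)}" by simp
  qed
  have "boundaries C d p = (\<lambda>y. \<pi> p (g y)) ` S (Suc p)"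
    unfolding boundaries_def presentsD(4)[OF C, of "Suc p"] image_image
    by (rule image_cong[OF refl d])
  also have "\<dots> = \<pi> p ` L"
  proof (rule subset_antisym; rule subsetI)
    fix z assume "z \<in> (\<lambda>y. \<pi> p (g y)) ` S (Suc p)"
    then show "z \<in> \<pi> p ` L" unfolding L_def using subspace_0[OF SK(2)] by force
  next
    fix z assume "z \<in> \<pi> p ` L"
    then obtain y k where z: "z = \<pi> p (g y + k)" "y \<in> S (Suc p)" "k \<in> K p" by (auto simp: L_def)
    have "\<pi> p (g y + k) = \<pi> p (g y)"
      using iff[of "g y + k" p "g y"] gS[OF z(2)] SK(3)[of p] subspace_add[OF SK(1)[of p]] z(3)
      by (auto simp: subset_iff)
    then show "z \<in> (\<lambda>y. \<pi> p (g y)) ` S (Suc p)" using z by auto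
  qed
  finally have bd: "boundaries C d p = \<pi> p ` L" .
  then show "boundaries C d p = \<pi> p ` {g y + k |y k. y \<in> S (Suc p) \<and> k \<in> K p}"
    unfolding L_def .
  have cyc: "cycles C d p = \<pi> p ` {x \<in> S p. g x \<in> K (p - 1)}"
  proof (cases p)
    case 0
    then show ?thesis using g0 presentsD(4)[OF C, of 0] by (auto simp: cycles_def)
  next
    case (Suc q)
    have "d (Suc q) (\<pi> (Suc q) x) = \<zero>\<^bsub>C q\<^esub> \<longleftrightarrow> g x \<in> K q" if x: "x \<in> S (Suc q)" for x
      using iff[OF gS[OF x] subspace_0[OF SK(1)[of q]]] by (simp add: d[OF x] presentsD(5)[OF C])
    then show ?thesis
      unfolding Suc cycles_def a_kernel_def' presentsD(4)[OF C, of "Suc q"] by auto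
  qed
  have quot: "presents (quotient_module ((C p)\<lparr>carrier := \<pi> p ` {x \<in> S p. g x \<in> K (p - 1)}\<rparr>)
      (\<pi> p ` L)) {x \<in> S p. g x \<in> K (p - 1)} L (\<lambda>x. (\<pi> p ` L) +>\<^bsub>C p\<^esub> \<pi> p x)"
    by (rule presents_quotient[OF C sub(1) KL LT sub(2)]) blast
  show "presents (homology C d p) {x \<in> S p. g x \<in> K (p - 1)}
      {g y + k |y k. y \<in> S (Suc p) \<and> k \<in> K p} (\<lambda>x. boundaries C d p +>\<^bsub>C p\<^esub> \<pi> p x)"
    by (unfold homology_def, unfold cyc, fold L_def, unfold bd, fact quot)
qed

text \<open>Nothing arrives in degree 0. Taking \<open>{0}\<close> as the source there reduces the
  denominator to \<open>K 0\<close> and lets this degree share the general formula.\<close>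

lemma presents_cohomology:
  assumes C: "\<And>p. presents (C p) (S p) (K p) (\<pi> p)"
    and g: "Vector_Spaces.linear scale scale g"
    and d: "\<And>p x. x \<in> S p \<Longrightarrow> d p (\<pi> p x) = \<pi> (Suc p) (g x)"
    and gS: "\<And>p x. x \<in> S p \<Longrightarrow> g x \<in> S (Suc p)"
    and gK: "\<And>p x. x \<in> K p \<Longrightarrow> g x \<in> K (Suc p)"
    and gg: "\<And>p x. x \<in> S p \<Longrightarrow> g (g x) \<in> K (Suc (Suc p))"
  shows "presents (cohomology C d p) {x \<in> S p. g x \<in> K (Suc p)}
           {g y + k |y k. y \<in> (if p = 0 then {0} else S (p - 1)) \<and> k \<in> K p}
           (\<lambda>x. coboundaries C d p +>\<^bsub>C p\<^esub> \<pi> p x)"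
proof -
  interpret g: Vector_Spaces.linear scale scale g by fact
  note SK = presentsD(1-3)[OF C]
  define S' where "S' = (if p = 0 then {0} else S (p - 1))"
  define L where "L = {g y + k |y k. y \<in> S' \<and> k \<in> K p}"
  have iff: "\<pi> p x = \<pi> p y \<longleftrightarrow> x - y \<in> K p" if "x \<in> S p" "y \<in> S p" for p x y
    using presentsD(8)[OF C that] .
  have S': "subspace S'" "\<And>x. x \<in> S' \<Longrightarrow> g x \<in> S p" "\<And>x. x \<in> S' \<Longrightarrow> g (g x) \<in> K (Suc p)"
  proof -
    show "subspace S'" using SK(1) by (simp add: S'_def subspace_single_0)
    show "g x \<in> S p" if "x \<in> S'" for x
      using that gS[of x "p - 1"] subspace_0[OF SK(1)] by (cases p) (auto simp: S'_def g.zero)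
    show "g (g x) \<in> K (Suc p)" if "x \<in> S'" for x
      using that gg[of x "p - 1"] subspace_0[OF SK(2)] by (cases p) (auto simp: S'_def g.zero)
  qed
  have sub: "subspace L" "subspace {x \<in> S p. g x \<in> K (Suc p)}"
    unfolding L_def by (intro subspace_boundaries subspace_cycles SK g S')+
  have KL: "K p \<subseteq> L"
    unfolding L_def using subspace_0[OF S'(1)] g.zero by force
  have LT: "L \<subseteq> {x \<in> S p. g x \<in> K (Suc p)}"
  proof
    fix x assume "x \<in> L"
    then obtain y k where x: "x = g y + k" "y \<in> S'" "k \<in> K p" by (auto simp: L_def)
    have "x \<in> S p" using x S' SK subspace_add[OF SK(1)] by blast
    moreover have "g x \<in> K (Suc p)" using x S' gK subspace_add[OF SK(2)] by (auto simp: g.add)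
    ultimately show "x \<in> {x \<in> S p. g x \<in> K (Suc p)}" by simp
  qed
  have "coboundaries C d p = (\<lambda>y. \<pi> p (g y)) ` S'"
  proof (cases p)
    case 0
    then show ?thesis unfolding coboundaries_def S'_def using presentsD(5)[OF C, of 0] g.zero by auto
  next
    case (Suc q)
    have "d q ` carrier (C q) = (\<lambda>y. \<pi> (Suc q) (g y)) ` S q"
      unfolding presentsD(4)[OF C, of q] image_image by (rule image_cong[OF refl d])
    then show ?thesis unfolding Suc coboundaries_def S'_def by simp
  qed
  also have "\<dots> = \<pi> p ` L"
  proof (rule subset_antisym; rule subsetI)
    fix z assume "z \<in> (\<lambda>y. \<pi> p (g y)) ` S'"
    then show "z \<in> \<pi> p ` L" unfolding L_def using subspace_0[OF SK(2)] by force
  next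
    fix z assume "z \<in> \<pi> p ` L"
    then obtain y k where z: "z = \<pi> p (g y + k)" "y \<in> S'" "k \<in> K p" by (auto simp: L_def)
    have "\<pi> p (g y + k) = \<pi> p (g y)"
      using iff[of "g y + k" p "g y"] S'(2)[OF z(2)] SK(3)[of p] subspace_add[OF SK(1)[of p]] z(3)
      by (auto simp: subset_iff)
    then show "z \<in> (\<lambda>y. \<pi> p (g y)) ` S'" using z by auto
  qed
  finally have bd: "coboundaries C d p = \<pi> p ` L" .
  have "d p (\<pi> p x) = \<zero>\<^bsub>C (Suc p)\<^esub> \<longleftrightarrow> g x \<in> K (Suc p)" if x: "x \<in> S p" for x
    using iff[OF gS[OF x] subspace_0[OF SK(1)[of "Suc p"]]] by (simp add: d[OF x] presentsD(5)[OF C])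
  then have cyc: "cocycles C d p = \<pi> p ` {x \<in> S p. g x \<in> K (Suc p)}"
    unfolding cocycles_def a_kernel_def' presentsD(4)[OF C, of p] by auto
  have quot: "presents (quotient_module ((C p)\<lparr>carrier := \<pi> p ` {x \<in> S p. g x \<in> K (Suc p)}\<rparr>)
      (\<pi> p ` L)) {x \<in> S p. g x \<in> K (Suc p)} L (\<lambda>x. (\<pi> p ` L) +>\<^bsub>C p\<^esub> \<pi> p x)"
    by (rule presents_quotient[OF C sub(1) KL LT sub(2)]) blast
  show ?thesis
    by (unfold cohomology_def, unfold cyc, fold S'_def, fold L_def, unfold bd, fact quot)
qed

end

section \<open>The Cartan homotopy formula\<close>

text \<open>
  Here \<open>t\<close> is the cyclic shift of the last factor to the front with its sign \<open>(-1)\<^sup>p\<close>, \<open>d k\<close> the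
  \<open>k\<close>-th face with its sign \<open>(-1)\<^sup>k\<close> (in degree \<open>p\<close> the last face \<open>d p\<close> multiplies \<open>a\<^sub>p\<close> and \<open>a\<^sub>0\<close>),
  \<open>\<delta> j\<close> applies the derivation to the \<open>j\<close>-th factor and \<open>s\<close> inserts \<open>1\<close> in front.  The multilinearity
  relations \<open>R\<close> only enter through the Leibniz rule.
\<close>

locale cyclic_derivation =
  fixes W R :: "nat \<Rightarrow> 'v::ab_group_add set"
    and t s :: "'v \<Rightarrow> 'v" and d \<delta> :: "nat \<Rightarrow> 'v \<Rightarrow> 'v"
  assumes additive_t: "additive t" and additive_s: "additive s"
    and additive_d: "additive (d k)" and additive_\<delta>: "additive (\<delta> j)"
    and W_0: "0 \<in> W p" and W_add: "x \<in> W p \<Longrightarrow> y \<in> W p \<Longrightarrow> x + y \<in> W p"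
    and W_minus: "x \<in> W p \<Longrightarrow> - x \<in> W p"
    and R_0: "0 \<in> R p" and R_add: "x \<in> R p \<Longrightarrow> y \<in> R p \<Longrightarrow> x + y \<in> R p"
    and R_minus: "x \<in> R p \<Longrightarrow> - x \<in> R p"
    and R_W: "R p \<subseteq> W p"
    and t_W: "x \<in> W p \<Longrightarrow> t x \<in> W p" and s_W: "x \<in> W p \<Longrightarrow> s x \<in> W (Suc p)"
    and d_W: "x \<in> W (Suc p) \<Longrightarrow> d k x \<in> W p" and \<delta>_W: "x \<in> W p \<Longrightarrow> \<delta> j x \<in> W p"
    and t_R: "x \<in> R p \<Longrightarrow> t x \<in> R p" and s_R: "x \<in> R p \<Longrightarrow> s x \<in> R (Suc p)"
    and d_0_R: "x \<in> R (Suc p) \<Longrightarrow> d 0 x \<in> R p" and \<delta>_0_R: "x \<in> R p \<Longrightarrow> \<delta> 0 x \<in> R p"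
    and d_Suc_t: "x \<in> W (Suc p) \<Longrightarrow> k \<le> p \<Longrightarrow> d (Suc k) (t x) = t (d k x)"
    and d_0_t: "x \<in> W (Suc p) \<Longrightarrow> d 0 (t x) = d (Suc p) x"
    and t_cycle: "x \<in> W p \<Longrightarrow> (t ^^ Suc p) x = x"
    and \<delta>_Suc_t: "x \<in> W p \<Longrightarrow> j < p \<Longrightarrow> \<delta> (Suc j) (t x) = t (\<delta> j x)"
    and \<delta>_0_t: "x \<in> W p \<Longrightarrow> \<delta> 0 (t x) = t (\<delta> p x)"
    and \<delta>_\<delta>: "x \<in> W p \<Longrightarrow> i \<le> p \<Longrightarrow> j \<le> p \<Longrightarrow> \<delta> i (\<delta> j x) = \<delta> j (\<delta> i x)"
    and d_\<delta>_less: "x \<in> W (Suc p) \<Longrightarrow> j < k \<Longrightarrow> k \<le> p \<Longrightarrow> d k (\<delta> j x) = \<delta> j (d k x)"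
    and d_\<delta>_greater: "x \<in> W (Suc p) \<Longrightarrow> k < j \<Longrightarrow> j \<le> p \<Longrightarrow> d k (\<delta> (Suc j) x) = \<delta> j (d k x)"
    and d_\<delta>_last: "x \<in> W (Suc p) \<Longrightarrow> 0 < j \<Longrightarrow> j \<le> p \<Longrightarrow> d (Suc p) (\<delta> j x) = \<delta> j (d (Suc p) x)"
    and derivation: "x \<in> W (Suc p) \<Longrightarrow> k \<le> p \<Longrightarrow>
      d k (\<delta> k x) + d k (\<delta> (Suc k) x) - \<delta> k (d k x) \<in> R p"
    and d_d: "x \<in> W (Suc (Suc p)) \<Longrightarrow> i \<le> j \<Longrightarrow> j \<le> Suc p \<Longrightarrow> d i (d (Suc j) x) = - d j (d i x)"
    and d_0_s: "x \<in> W p \<Longrightarrow> d 0 (s x) = x"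
    and d_Suc_s: "x \<in> W (Suc p) \<Longrightarrow> k \<le> p \<Longrightarrow> d (Suc k) (s x) = - s (d k x)"
    and d_last_s: "x \<in> W p \<Longrightarrow> d (Suc p) (s x) = - t x"
    and \<delta>_Suc_s: "x \<in> W p \<Longrightarrow> j \<le> p \<Longrightarrow> \<delta> (Suc j) (s x) = s (\<delta> j x)"
begin

text \<open>
  Connes' operator on the unnormalized complex is usually \<open>(1 - t) s N\<close>.  The operator \<open>s N\<close>, which
  agrees with it modulo degenerate words, already anticommutes with \<open>b\<close> and satisfies the Cartan formula.
\<close>

definition face_sum :: "nat \<Rightarrow> 'v \<Rightarrow> 'v" where "face_sum p x = (\<Sum>k<p. d k x)"
definition b :: "nat \<Rightarrow> 'v \<Rightarrow> 'v" where "b p x = (if p = 0 then 0 else \<Sum>k\<le>p. d k x)"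
definition N :: "nat \<Rightarrow> 'v \<Rightarrow> 'v" where "N p x = (\<Sum>i\<le>p. (t ^^ i) x)"
definition B :: "nat \<Rightarrow> 'v \<Rightarrow> 'v" where "B p x = s (N p x)"
text \<open>The sign is minus because \<open>d p\<close> carries \<open>(-1)^p\<close>, whereas
  \<open>e_D\<close> carries \<open>(-1)^(p - 1)\<close>.\<close>

definition e :: "nat \<Rightarrow> 'v \<Rightarrow> 'v" where "e p x = (if p = 0 then 0 else - d p (\<delta> p x))"
definition L_from :: "nat \<Rightarrow> nat \<Rightarrow> 'v \<Rightarrow> 'v" where "L_from p i x = (\<Sum>j\<in>{i..p}. \<delta> j x)"
abbreviation L :: "nat \<Rightarrow> 'v \<Rightarrow> 'v" where "L p \<equiv> L_from p 0"
text \<open>After \<open>r\<close> rotations the last \<open>r\<close> factors stand in front of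
  \<open>a_0\<close>, and the derivation runs over exactly these. With \<open>s\<close> applied,
  this is Rinehart's homotopy up to sign: words \<open>1 \<otimes> ... D a_j ... a_0 ...\<close> in
  which the differentiated factor precedes \<open>a_0\<close>.\<close>

definition F :: "nat \<Rightarrow> 'v \<Rightarrow> 'v" where
  "F p x = (\<Sum>r\<in>{1..p}. (t ^^ r) (L_from p (Suc p - r) x))"
definition E :: "nat \<Rightarrow> 'v \<Rightarrow> 'v" where "E p x = - s (F p x)"

definition eqR :: "nat \<Rightarrow> 'v \<Rightarrow> 'v \<Rightarrow> bool" where "eqR p x y \<longleftrightarrow> x - y \<in> R p"

sublocale t: additive t by (rule additive_t)
sublocale s: additive s by (rule additive_s)
sublocale d: additive "d k" for k by (rule additive_d)
sublocale \<delta>: additive "\<delta> j" for j by (rule additive_\<delta>)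
sublocale tpow: additive "t ^^ r" for r
  by unfold_locales (induction r, simp_all add: t.add)

lemma R_diff: "x \<in> R p \<Longrightarrow> y \<in> R p \<Longrightarrow> x - y \<in> R p"
  using R_add R_minus by (metis uminus_add_conv_diff add.commute)

lemma W_sum: "(\<And>i. i \<in> I \<Longrightarrow> f i \<in> W p) \<Longrightarrow> sum f I \<in> W p"
  by (induction I rule: infinite_finite_induct) (auto intro: W_0 W_add)

lemma R_sum: "(\<And>i. i \<in> I \<Longrightarrow> f i \<in> R p) \<Longrightarrow> sum f I \<in> R p"
  by (induction I rule: infinite_finite_induct) (auto intro: R_0 R_add)

lemma tpow_W: "x \<in> W p \<Longrightarrow> (t ^^ r) x \<in> W p"
  by (induction r) (auto intro: t_W)

lemma tpow_R: "x \<in> R p \<Longrightarrow> (t ^^ r) x \<in> R p"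
  by (induction r) (auto intro: t_R)

lemma L_from_W: "x \<in> W p \<Longrightarrow> L_from p i x \<in> W p"
  unfolding L_from_def by (intro W_sum \<delta>_W)

lemma N_W: "x \<in> W p \<Longrightarrow> N p x \<in> W p"
  unfolding N_def by (intro W_sum tpow_W)

lemma F_W: "x \<in> W p \<Longrightarrow> F p x \<in> W p"
  unfolding F_def by (intro W_sum tpow_W L_from_W)

lemma B_W: "x \<in> W p \<Longrightarrow> B p x \<in> W (Suc p)"
  unfolding B_def by (intro s_W N_W)

lemma E_W: "x \<in> W p \<Longrightarrow> E p x \<in> W (Suc p)"
  unfolding E_def by (intro W_minus s_W F_W)

lemma b_W: "x \<in> W (Suc p) \<Longrightarrow> b (Suc p) x \<in> W p"
  unfolding b_def by (simp del: sum.atMost_Suc) (intro W_sum d_W)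

lemma e_W: "x \<in> W (Suc p) \<Longrightarrow> e (Suc p) x \<in> W p"
  unfolding e_def by (auto intro: W_minus d_W \<delta>_W)

lemma additive_b: "additive (b p)" and additive_N: "additive (N p)"
  and additive_L_from: "additive (L_from p i)" and additive_face_sum: "additive (face_sum p)"
  by unfold_locales (simp_all add: b_def N_def L_from_def face_sum_def sum.distrib d.add tpow.add \<delta>.add)

sublocale b: additive "b p" for p by (rule additive_b)
sublocale N: additive "N p" for p by (rule additive_N)
sublocale L: additive "L_from p i" for p i by (rule additive_L_from)
sublocale face_sum: additive "face_sum p" for p by (rule additive_face_sum)
sublocale B: additive "B p" for p by unfold_locales (simp add: B_def N.add s.add)
sublocale e: additive "e p" for p by unfold_locales (simp add: e_def d.add \<delta>.add)
sublocale F: additive "F p" for p by unfold_locales (simp add: F_def L.add tpow.add sum.distrib)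
sublocale E: additive "E p" for p by unfold_locales (simp add: E_def F.add s.add)

lemma eqR_refl [simp]: "eqR p x x"
  by (simp add: eqR_def R_0)

lemma eqR_sym: "eqR p x y \<Longrightarrow> eqR p y x"
  unfolding eqR_def using R_minus by (metis minus_diff_eq)

lemma eqR_trans [trans]:
  assumes "eqR p x y" "eqR p y z" shows "eqR p x z"
  using R_add[OF assms[unfolded eqR_def]] by (simp add: eqR_def)

lemma eqR_add: 
  assumes "eqR p x y" "eqR p x' y'" shows "eqR p (x + x') (y + y')"
  using R_add[OF assms[unfolded eqR_def]] by (simp add: eqR_def algebra_simps)

lemma eqR_diff: 
  assumes "eqR p x y" "eqR p x' y'" shows "eqR p (x - x') (y - y')"
  using R_diff[OF assms[unfolded eqR_def]] by (simp add: eqR_def algebra_simps)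

lemma eqR_sum: "(\<And>i. i \<in> I \<Longrightarrow> eqR p (f i) (g i)) \<Longrightarrow> eqR p (sum f I) (sum g I)"
  by (induction I rule: infinite_finite_induct) (auto intro: eqR_add)

lemma eqR_t: "eqR p x y \<Longrightarrow> eqR p ((t ^^ r) x) ((t ^^ r) y)"
  unfolding eqR_def using tpow_R by (metis tpow.diff)

lemma eqR_s: "eqR p x y \<Longrightarrow> eqR (Suc p) (s x) (s y)"
  unfolding eqR_def using s_R by (metis s.diff)

section \<open>Faces and derivations against powers of the rotation\<close>

lemma d_tpow_le:
  assumes "x \<in> W (Suc p)" "r \<le> k" "k \<le> Suc p"
  shows "d k ((t ^^ r) x) = (t ^^ r) (d (k - r) x)"
  using assms(2,3)
proof (induction r arbitrary: k)
  case (Suc r)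
  then obtain k' where k: "k = Suc k'" by (cases k) auto
  show ?case using Suc d_Suc_t[OF tpow_W[OF assms(1)], of k' r] unfolding k by simp
qed simp

text \<open>\<open>k\<close> rotations lower the face to \<open>d 0\<close>; the next rotation turns
  it into the last face and is used up in doing so; the remaining \<open>m\<close> rotations lower
  the index again from \<open>Suc p\<close>. Hence one power of \<open>t\<close> is lost.\<close>

lemma d_tpow_gt:
  assumes "x \<in> W (Suc p)" "k + m \<le> Suc p"
  shows "d k ((t ^^ (k + Suc m)) x) = (t ^^ (k + m)) (d (Suc p - m) x)"
proof -
  have "d k ((t ^^ (k + Suc m)) x) = d k ((t ^^ k) (t ((t ^^ m) x)))"
    by (simp only: funpow_add comp_apply funpow.simps)
  also have "\<dots> = (t ^^ k) (d 0 (t ((t ^^ m) x)))"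
    using d_tpow_le[OF t_W[OF tpow_W[OF assms(1)]], of k k] assms(2) by simp
  also have "\<dots> = (t ^^ k) ((t ^^ m) (d (Suc p - m) x))"
    using d_0_t[OF tpow_W[OF assms(1)]] d_tpow_le[OF assms(1), of m "Suc p"] assms(2) by simp
  finally show ?thesis by (simp add: funpow_add)
qed

lemma \<delta>_tpow:
  assumes "x \<in> W p" "r \<le> j" "j \<le> p"
  shows "\<delta> j ((t ^^ r) x) = (t ^^ r) (\<delta> (j - r) x)"
  using assms(2,3)
proof (induction r arbitrary: j)
  case (Suc r)
  then obtain k where k: "j = Suc k" by (cases j) auto
  show ?case using Suc \<delta>_Suc_t[OF tpow_W[OF assms(1)], of k r] unfolding k by simp
qed simp

text \<open>Only the face \<open>d 0\<close> is assumed to respect the relations. Since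
  \<open>t\<close> has finite order on words of fixed length, \<open>x = t^k y\<close> for a
  relation \<open>y\<close>, and \<open>d k t^k = t^k d 0\<close> reduces the general face to that
  one. The derivations in the other slots are treated in the same way below.\<close>

lemma d_R:
  assumes x: "x \<in> R (Suc p)" and k: "k \<le> Suc p"
  shows "d k x \<in> R p"
proof -
  have xW: "x \<in> W (Suc p)" using x R_W by auto
  define y where "y = (t ^^ (Suc (Suc p) - k)) x"
  have y: "y \<in> R (Suc p)" unfolding y_def by (rule tpow_R[OF x])
  have "(t ^^ k) y = (t ^^ Suc (Suc p)) x"
    unfolding y_def using k by (metis comp_apply funpow_add le_SucI le_add_diff_inverse)
  then have "d k x = d k ((t ^^ k) y)" using t_cycle[OF xW] by simp
  also have "\<dots> = (t ^^ k) (d 0 y)" using d_tpow_le[of y p k k] y R_W k by auto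
  finally show ?thesis using tpow_R[OF d_0_R[OF y]] by simp
qed

lemma \<delta>_R:
  assumes x: "x \<in> R p" and k: "k \<le> p"
  shows "\<delta> k x \<in> R p"
proof -
  have xW: "x \<in> W p" using x R_W by auto
  define y where "y = (t ^^ (Suc p - k)) x"
  have y: "y \<in> R p" unfolding y_def by (rule tpow_R[OF x])
  have "(t ^^ k) y = (t ^^ Suc p) x"
    unfolding y_def using k by (metis comp_apply funpow_add le_SucI le_add_diff_inverse)
  then have "\<delta> k x = \<delta> k ((t ^^ k) y)" using t_cycle[OF xW] by simp
  also have "\<dots> = (t ^^ k) (\<delta> 0 y)" using \<delta>_tpow[of y p k k] y R_W k by auto
  finally show ?thesis using tpow_R[OF \<delta>_0_R[OF y]] by simp
qed

lemma L_from_R: "x \<in> R p \<Longrightarrow> L_from p i x \<in> R p"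
  unfolding L_from_def by (intro R_sum \<delta>_R) auto

lemma B_R: "x \<in> R p \<Longrightarrow> B p x \<in> R (Suc p)"
  unfolding B_def N_def by (intro s_R R_sum tpow_R)

lemma E_R: "x \<in> R p \<Longrightarrow> E p x \<in> R (Suc p)"
  unfolding E_def F_def by (intro R_minus s_R R_sum tpow_R L_from_R)

lemma b_R: "x \<in> R (Suc p) \<Longrightarrow> b (Suc p) x \<in> R p"
  unfolding b_def by (simp del: sum.atMost_Suc) (auto intro!: R_sum d_R simp del: sum.atMost_Suc)

lemma e_R: "x \<in> R (Suc p) \<Longrightarrow> e (Suc p) x \<in> R p"
  unfolding e_def by (auto intro!: R_minus d_R \<delta>_R)

text \<open>Terms \<open>d i d (j + 1)\<close> with \<open>i \<le> j\<close> cancel against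
  \<open>d j d i\<close>; the bijection of index pairs is
  \<open>(i, j + 1) \<mapsto> (j, i)\<close>.\<close>

lemma b_b:
  assumes "x \<in> W (Suc (Suc p))"
  shows "b (Suc p) (b (Suc (Suc p)) x) = 0"
proof -
  define n where "n = Suc (Suc p)"
  define A where "A = {(i, j). j \<le> n \<and> i < j}"
  define C where "C = {(i, j). j \<le> i \<and> i \<le> Suc p}"
  have split: "{..Suc p} \<times> {..n} = A \<union> C" "A \<inter> C = {}" "finite A" "finite C"
    by (auto simp: A_def C_def n_def intro: finite_subset[of _ "{..n} \<times> {..n}"])
  have "b (Suc p) (b n x) = (\<Sum>i\<le>Suc p. \<Sum>j\<le>n. d i (d j x))"
    by (simp add: b_def n_def d.sum del: sum.atMost_Suc)
  also have "\<dots> = (\<Sum>(i, j)\<in>{..Suc p} \<times> {..n}. d i (d j x))"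
    by (simp add: sum.cartesian_product)
  also have "\<dots> = (\<Sum>(i, j)\<in>A. d i (d j x)) + (\<Sum>(i, j)\<in>C. d i (d j x))"
    using split by (simp add: sum.union_disjoint)
  also have "(\<Sum>(i, j)\<in>A. d i (d j x)) = (\<Sum>(i, j)\<in>C. - d i (d j x))"
  proof (rule sum.reindex_bij_witness[where i = "\<lambda>(i, j). (j, Suc i)" and j = "\<lambda>(i, j). (j - 1, i)"])
    fix a assume a: "a \<in> A"
    then obtain i j where ij: "a = (i, Suc j)" "i \<le> j" "j \<le> Suc p"
      by (auto simp: A_def n_def) (metis Suc_le_D Suc_leI Suc_le_mono less_eq_Suc_le)
    then show "(case (case a of (i, j) \<Rightarrow> (j - 1, i)) of (i, j) \<Rightarrow> - d i (d j x)) = (case a of (i, j) \<Rightarrow> d i (d j x))"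
      using d_d[OF assms, of i j] by simp
  qed (auto simp: A_def C_def n_def)
  finally show ?thesis by (simp add: n_def sum_negf split_def)
qed

text \<open>The terms are sorted by the power \<open>t^i\<close> left in front once the face has
  been moved inside. For \<open>r \<le> k\<close> all rotations survive and \<open>i = r\<close>;
  for \<open>r > k\<close> one is used up, so \<open>i = r - 1\<close> and the argument is
  \<open>Y (Suc i)\<close>. Letting \<open>Y\<close> depend on \<open>r\<close> covers both
  \<open>N\<close>, where it is constant, and \<open>F\<close>.\<close>

lemma face_sum_tpow:
  assumes Y: "\<And>r. Y r \<in> W (Suc q)"
  shows "(\<Sum>k\<le>q. \<Sum>r\<le>Suc q. d k ((t ^^ r) (Y r))) =
    (\<Sum>i\<le>q. (t ^^ i) ((\<Sum>j<Suc q - i. d j (Y i)) + (\<Sum>j\<in>{Suc q - i..Suc q}. d j (Y (Suc i)))))"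
proof -
  let ?f = "\<lambda>(k, r). d k ((t ^^ r) (Y r))"
  let ?A = "{(k, r). k \<le> q \<and> r \<le> k}" and ?C = "{(k, r). k < r \<and> r \<le> Suc q}"
  let ?A' = "SIGMA i:{..q}. {..<Suc q - i}" and ?C' = "SIGMA i:{..q}. {Suc q - i..Suc q}"
  have split: "{..q} \<times> {..Suc q} = ?A \<union> ?C" "?A \<inter> ?C = {}" "finite ?A" "finite ?C"
    by (auto intro: finite_subset[of _ "{..Suc q} \<times> {..Suc q}"])
  have "(\<Sum>k\<le>q. \<Sum>r\<le>Suc q. d k ((t ^^ r) (Y r))) = sum ?f ({..q} \<times> {..Suc q})"
    by (simp add: sum.cartesian_product del: sum.atMost_Suc)
  also have "\<dots> = sum ?f ?A + sum ?f ?C"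
    using split by (simp add: sum.union_disjoint)
  also have "sum ?f ?A = (\<Sum>(i, j)\<in>?A'. (t ^^ i) (d j (Y i)))"
    by (rule sum.reindex_bij_witness[where i = "\<lambda>(i, j). (i + j, i)" and j = "\<lambda>(k, r). (r, k - r)"])
      (auto simp: d_tpow_le[OF Y])
  also have "\<dots> = (\<Sum>i\<le>q. (t ^^ i) (\<Sum>j<Suc q - i. d j (Y i)))"
    by (simp add: sum.Sigma tpow.sum)
  also have "sum ?f ?C = (\<Sum>(i, j)\<in>?C'. (t ^^ i) (d j (Y (Suc i))))"
  proof (rule sum.reindex_bij_witness[where i = "\<lambda>(i, j). (i + j - Suc q, Suc i)"
        and j = "\<lambda>(k, r). (r - 1, Suc (Suc q) + k - r)"])
    fix a assume "a \<in> ?C"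
    then obtain k m where a: "a = (k, k + Suc m)" "k + m \<le> q"
      by clarsimp (metis add_Suc_right add_le_cancel_left less_imp_Suc_add not_less_eq_eq order_refl)
    have *: "Suc (Suc q) + k - (k + Suc m) = Suc q - m" by simp
    show "(case (case a of (k, r) \<Rightarrow> (r - 1, Suc (Suc q) + k - r)) of
        (i, j) \<Rightarrow> (t ^^ i) (d j (Y (Suc i)))) = ?f a"
      using d_tpow_gt[OF Y, of k m "k + Suc m"] a(2) unfolding a(1) by (simp add: *)
  qed auto
  also have "\<dots> = (\<Sum>i\<le>q. (t ^^ i) (\<Sum>j\<in>{Suc q - i..Suc q}. d j (Y (Suc i))))"
    by (simp add: sum.Sigma tpow.sum del: sum.cl_ivl_Suc)
  finally show ?thesis by (simp add: tpow.add sum.distrib del: sum.cl_ivl_Suc)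
qed

text \<open>The identity \<open>b' N = N b\<close> of cyclic homology, with
  \<open>b' = face_sum\<close>: for constant \<open>Y\<close> the two groups of faces next to each
  power of \<open>t\<close> together make up all faces.\<close>

lemma face_sum_N:
  assumes "x \<in> W (Suc q)"
  shows "face_sum (Suc q) (N (Suc q) x) = N q (b (Suc q) x)"
proof -
  have eq: "{..Suc q} = {..<Suc q - i} \<union> {Suc q - i..Suc q}" for i by auto
  have "(\<Sum>j<Suc q - i. d j x) + (\<Sum>j\<in>{Suc q - i..Suc q}. d j x) = (\<Sum>j\<le>Suc q. d j x)" for i
    unfolding eq[of i] by (rule sum.union_disjoint[symmetric]) auto
  then show ?thesis
    using face_sum_tpow[of "\<lambda>_. x" q] assms
    by (simp add: face_sum_def N_def b_def d.sum lessThan_Suc_atMost del: sum.atMost_Suc sum.cl_ivl_Suc)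
qed

lemma t_N:
  assumes "x \<in> W p"
  shows "t (N p x) = N p x"
proof -
  have "t (N p x) = (\<Sum>i\<le>p. (t ^^ Suc i) x)" by (simp add: N_def t.sum)
  also have "x + \<dots> = (\<Sum>i\<le>Suc p. (t ^^ i) x)"
    by (subst sum.atMost_Suc_shift) simp
  also have "\<dots> = N p x + x" using t_cycle[OF assms] by (simp add: N_def)
  finally show ?thesis by simp
qed

text \<open>\<open>s\<close> is a contracting homotopy for the bar differential
  \<open>b' = face_sum\<close>, and the last face, by which \<open>b\<close> differs from
  \<open>b'\<close>, contributes \<open>- t\<close>.\<close>

lemma b_s:
  assumes "x \<in> W p"
  shows "b (Suc p) (s x) = x - s (face_sum p x) - t x"
proof -
  have "(\<Sum>k<p. d (Suc k) (s x)) = - s (face_sum p x)"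
    using assms d_Suc_s[of x "p - 1"] by (cases p) (simp_all add: face_sum_def s.add s.sum sum_negf s.zero)
  moreover have "b (Suc p) (s x) = d 0 (s x) + ((\<Sum>k<p. d (Suc k) (s x)) + d (Suc p) (s x))"
    by (simp add: b_def sum.lessThan_Suc_shift[of "\<lambda>k. d k (s x)", symmetric] sum.atMost_Suc_shift
        lessThan_Suc_atMost[symmetric] del: sum.atMost_Suc)
  ultimately show ?thesis using d_0_s[OF assms] d_last_s[OF assms] by simp
qed

text \<open>In \<open>b s N = N - s b' N - t N\<close> the outer terms cancel by invariance of the
  norm, and \<open>b' N = N b\<close> rewrites the middle one.\<close>

lemma b_B:
  assumes "x \<in> W (Suc p)"
  shows "b (Suc (Suc p)) (B (Suc p) x) = - B p (b (Suc p) x)"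
  unfolding B_def b_s[OF N_W[OF assms]] face_sum_N[OF assms] t_N[OF assms] by simp

lemma b_B_0:
  assumes "x \<in> W 0"
  shows "b (Suc 0) (B 0 x) = 0"
  unfolding B_def b_s[OF N_W[OF assms]] t_N[OF assms] by (simp add: face_sum_def s.zero)

text \<open>The counterpart of \<open>b' N = N b\<close> for \<open>F\<close>. A face inside the
  differentiated block is governed by the Leibniz rule, and the faces in front of the block commute
  with the derivations. The exception is the last face, which joins the end of the block to
  \<open>a_0\<close>: the derivation of that end factor has no counterpart in \<open>F b\<close>,
  and its rotations add up to \<open>- N e\<close>.\<close>

lemma face_sum_F:
  assumes x: "x \<in> W (Suc q)"
  shows "eqR q (face_sum (Suc q) (F (Suc q) x)) (F q (b (Suc q) x) - N q (e (Suc q) x))"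
proof -
  define Y where "Y r = (if r = 0 then 0 else L_from (Suc q) (Suc (Suc q) - r) x)" for r
  have Y: "Y r \<in> W (Suc q)" for r unfolding Y_def using W_0 L_from_W[OF x] by auto
  define w where "w = d (Suc q) (\<delta> (Suc q) x)"
  have "F (Suc q) x = (\<Sum>r\<le>Suc q. (t ^^ r) (Y r))"
  proof -
    have "{..Suc q} = insert 0 {1..Suc q}" by auto
    then show ?thesis by (simp add: F_def Y_def tpow.zero del: sum.cl_ivl_Suc)
  qed
  then have eq: "face_sum (Suc q) (F (Suc q) x) =
      (\<Sum>i\<le>q. (t ^^ i) ((\<Sum>j<Suc q - i. d j (Y i)) + (\<Sum>j\<in>{Suc q - i..Suc q}. d j (Y (Suc i)))))"
    using face_sum_tpow[OF Y] by (simp add: face_sum_def d.sum lessThan_Suc_atMost del: sum.atMost_Suc)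
  \<comment> \<open>In \<open>Y i\<close> the block begins at \<open>Suc (Suc q) - i\<close>, so
    these faces merge two factors in front of it and shift the derivations down by one index. For
    \<open>i = 0\<close> both sides are empty: \<open>Y 0 = 0\<close>, and no slot lies beyond
    \<open>q\<close>.\<close>
  have low: "(\<Sum>j<Suc q - i. d j (Y i)) = (\<Sum>j<Suc q - i. L_from q (Suc q - i) (d j x))" if "i \<le> q" for i
  proof (cases "i = 0")
    case True
    then show ?thesis by (simp add: Y_def L_from_def d.zero)
  next
    case False
    have "d j (L_from (Suc q) (Suc (Suc q) - i) x) = L_from q (Suc q - i) (d j x)" if j: "j < Suc q - i" for j
    proof -
      have "L_from (Suc q) (Suc (Suc q) - i) x = (\<Sum>l\<in>{Suc q - i..q}. \<delta> (Suc l) x)"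
        unfolding L_from_def using \<open>i \<le> q\<close> sum.shift_bounds_cl_Suc_ivl[of "\<lambda>j. \<delta> j x" "Suc q - i" q]
        by (simp add: Suc_diff_le del: sum.cl_ivl_Suc)
      then have "d j (L_from (Suc q) (Suc (Suc q) - i) x) = (\<Sum>l\<in>{Suc q - i..q}. d j (\<delta> (Suc l) x))"
        by (simp only: d.sum)
      also have "\<dots> = (\<Sum>l\<in>{Suc q - i..q}. \<delta> l (d j x))"
        using j d_\<delta>_greater[OF x, of j] by (intro sum.cong) auto
      finally show ?thesis by (simp only: L_from_def)
    qed
    then show ?thesis using False by (simp add: Y_def)
  qed
  have high: "eqR q (\<Sum>j\<in>{Suc q - i..Suc q}. d j (Y (Suc i)))
      ((\<Sum>j\<in>{Suc q - i..Suc q}. L_from q (Suc q - i) (d j x)) + w)" if i: "i \<le> q" for i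
  proof -
    define a where "a = Suc q - i"
    have a: "0 < a" "a \<le> Suc q" using i by (auto simp: a_def)
    have Ya: "Y (Suc i) = L_from (Suc q) a x" by (simp add: Y_def a_def)
    have 1: "eqR q (d j (L_from (Suc q) a x)) (L_from q a (d j x))" if j: "a \<le> j" "j \<le> q" for j
    proof -
      have I: "{a..Suc q} = {a..<j} \<union> ({j, Suc j} \<union> {Suc (Suc j)..Suc q})" using j by auto
      have "L_from (Suc q) a x = (\<Sum>l\<in>{a..<j}. \<delta> l x) + (\<Sum>l\<in>{j, Suc j} \<union> {Suc (Suc j)..Suc q}. \<delta> l x)"
        unfolding L_from_def I by (rule sum.union_disjoint) auto
      also have "(\<Sum>l\<in>{j, Suc j} \<union> {Suc (Suc j)..Suc q}. \<delta> l x) =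
          \<delta> j x + \<delta> (Suc j) x + (\<Sum>l\<in>{Suc (Suc j)..Suc q}. \<delta> l x)"
        by (subst sum.union_disjoint) auto
      also have "(\<Sum>l\<in>{Suc (Suc j)..Suc q}. \<delta> l x) = (\<Sum>l\<in>{Suc j..q}. \<delta> (Suc l) x)"
        by (rule sum.shift_bounds_cl_Suc_ivl)
      finally have "d j (L_from (Suc q) a x) = (\<Sum>l\<in>{a..<j}. d j (\<delta> l x)) +
          (d j (\<delta> j x) + d j (\<delta> (Suc j) x) + (\<Sum>l\<in>{Suc j..q}. d j (\<delta> (Suc l) x)))"
        by (simp add: d.add d.sum)
      also have "(\<Sum>l\<in>{a..<j}. d j (\<delta> l x)) = (\<Sum>l\<in>{a..<j}. \<delta> l (d j x))"
        using d_\<delta>_less[OF x _ j(2)] by auto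
      also have "(\<Sum>l\<in>{Suc j..q}. d j (\<delta> (Suc l) x)) = (\<Sum>l\<in>{Suc j..q}. \<delta> l (d j x))"
        using d_\<delta>_greater[OF x] by auto
      finally have 2: "d j (L_from (Suc q) a x) = (\<Sum>l\<in>{a..<j}. \<delta> l (d j x)) +
          (d j (\<delta> j x) + d j (\<delta> (Suc j) x) + (\<Sum>l\<in>{Suc j..q}. \<delta> l (d j x)))" .
      have J: "{a..q} = {a..<j} \<union> ({j} \<union> {Suc j..q})" using j by auto
      have "L_from q a (d j x) = (\<Sum>l\<in>{a..<j}. \<delta> l (d j x)) + (\<Sum>l\<in>{j} \<union> {Suc j..q}. \<delta> l (d j x))"
        unfolding L_from_def J by (rule sum.union_disjoint) auto
      also have "(\<Sum>l\<in>{j} \<union> {Suc j..q}. \<delta> l (d j x)) = \<delta> j (d j x) + (\<Sum>l\<in>{Suc j..q}. \<delta> l (d j x))"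
        by simp
      finally show ?thesis
        unfolding 2 using derivation[OF x j(2)] by (simp add: eqR_def algebra_simps)
    qed
    \<comment> \<open>The last face moves factor \<open>Suc q\<close> into slot 0, which lies
      outside the range \<open>a..q\<close> because \<open>a > 0\<close>. Its derivation therefore
      remains as the extra term \<open>w\<close>.\<close>
    have 3: "d (Suc q) (L_from (Suc q) a x) = L_from q a (d (Suc q) x) + w"
    proof -
      have "L_from (Suc q) a x = (\<Sum>l\<in>{a..q}. \<delta> l x) + \<delta> (Suc q) x"
        unfolding L_from_def using a by simp
      moreover have "(\<Sum>l\<in>{a..q}. d (Suc q) (\<delta> l x)) = L_from q a (d (Suc q) x)"
        unfolding L_from_def using d_\<delta>_last[OF x] a by auto
      ultimately show ?thesis by (simp add: d.add d.sum w_def)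
    qed
    have "eqR q (\<Sum>j\<in>{a..q}. d j (L_from (Suc q) a x)) (\<Sum>j\<in>{a..q}. L_from q a (d j x))"
      by (intro eqR_sum 1) auto
    then have "eqR q ((\<Sum>j\<in>{a..q}. d j (L_from (Suc q) a x)) + d (Suc q) (L_from (Suc q) a x))
        ((\<Sum>j\<in>{a..q}. L_from q a (d j x)) + (L_from q a (d (Suc q) x) + w))"
      unfolding 3 by (intro eqR_add) auto
    then show ?thesis unfolding Ya a_def[symmetric] using a(2) by (simp add: add.assoc)
  qed
  have J: "(\<Sum>j<Suc q - i. L_from q (Suc q - i) (d j x)) + (\<Sum>j\<in>{Suc q - i..Suc q}. L_from q (Suc q - i) (d j x)) =
      L_from q (Suc q - i) (b (Suc q) x)" for i
  proof -
    have eq: "{..Suc q} = {..<Suc q - i} \<union> {Suc q - i..Suc q}" by auto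
    show ?thesis
      unfolding b_def by (simp only: L.sum eq nat.simps if_False) (rule sum.union_disjoint[symmetric], auto)
  qed
  have "eqR q (face_sum (Suc q) (F (Suc q) x))
      (\<Sum>i\<le>q. (t ^^ i) ((\<Sum>j<Suc q - i. L_from q (Suc q - i) (d j x)) +
        ((\<Sum>j\<in>{Suc q - i..Suc q}. L_from q (Suc q - i) (d j x)) + w)))"
    unfolding eq by (rule eqR_sum, rule eqR_t, rule eqR_add) (simp add: low, rule high, simp)
  also have "(\<Sum>i\<le>q. (t ^^ i) ((\<Sum>j<Suc q - i. L_from q (Suc q - i) (d j x)) +
        ((\<Sum>j\<in>{Suc q - i..Suc q}. L_from q (Suc q - i) (d j x)) + w))) =
      (\<Sum>i\<le>q. (t ^^ i) (L_from q (Suc q - i) (b (Suc q) x))) + N q w"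
    unfolding add.assoc[symmetric] J by (simp only: tpow.add sum.distrib N_def)
  also have "(\<Sum>i\<le>q. (t ^^ i) (L_from q (Suc q - i) (b (Suc q) x))) = F q (b (Suc q) x)"
  proof -
    have "{..q} = insert 0 {1..q}" by auto
    then show ?thesis by (simp add: F_def L_from_def[of q "Suc q"])
  qed
  also have "N q w = - N q (e (Suc q) x)"
    by (simp add: w_def e_def N.minus)
  finally show ?thesis by simp
qed

text \<open>A telescoping sum: the terms of \<open>F\<close> and \<open>t F\<close> with the same
  power of \<open>t\<close> differ by a single derivation. The lower end is an empty sum, and at the
  upper end \<open>t^(p + 1)\<close> is the identity.\<close>

lemma F_diff_t_F:
  assumes x: "x \<in> W p"
  shows "F p x - t (F p x) = (\<Sum>r\<in>{1..p}. (t ^^ r) (\<delta> (Suc p - r) x)) - L_from p 1 x"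
proof -
  define a where "a r = (t ^^ r) (L_from p (Suc (Suc p) - r) x)" for r
  have "(t ^^ r) (L_from p (Suc p - r) x) = (t ^^ r) (\<delta> (Suc p - r) x) + a r" if "r \<in> {1..p}" for r
  proof -
    have "L_from p (Suc p - r) x = \<delta> (Suc p - r) x + L_from p (Suc (Suc p - r)) x"
      unfolding L_from_def using that by (intro sum.atLeast_Suc_atMost) auto
    then show ?thesis using that by (simp add: a_def tpow.add Suc_diff_le)
  qed
  then have "F p x = (\<Sum>r\<in>{1..p}. (t ^^ r) (\<delta> (Suc p - r) x)) + (\<Sum>r\<in>{1..p}. a r)"
    by (simp add: F_def sum.distrib)
  moreover have "t (F p x) = (\<Sum>r\<in>{1..p}. a (Suc r))"
    by (simp add: F_def t.sum a_def)
  moreover have "(\<Sum>r\<in>{1..p}. a r) - (\<Sum>r\<in>{1..p}. a (Suc r)) = a 1 - a (Suc p)"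
    by (induction p) (simp_all add: algebra_simps)
  moreover have "a 1 = 0" by (simp add: a_def L_from_def t.zero)
  moreover have "a (Suc p) = L_from p 1 x"
    using t_cycle[OF L_from_W[OF x]] by (simp add: a_def)
  ultimately show ?thesis by simp
qed

text \<open>In \<open>s N x\<close> the last face multiplies the last factor onto the inserted 1, so
  \<open>e\<close> amounts to differentiating the last factor of \<open>N x\<close> and rotating it
  to the front. By \<open>t N = N\<close> this is the derivation in slot 0 of
  \<open>N x\<close>.\<close>

lemma e_B:
  assumes x: "x \<in> W p"
  shows "e (Suc p) (B p x) = \<delta> 0 x + (\<Sum>r\<in>{1..p}. (t ^^ r) (\<delta> (Suc p - r) x))"
proof -
  note NW = N_W[OF x]
  have "e (Suc p) (B p x) = t (\<delta> p (N p x))"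
    by (simp add: e_def B_def \<delta>_Suc_s[OF NW] d_last_s[OF \<delta>_W[OF NW]])
  also have "\<dots> = \<delta> 0 (N p x)"
    using \<delta>_0_t[OF NW] t_N[OF x] by simp
  also have "\<dots> = (\<Sum>r\<le>p. \<delta> 0 ((t ^^ r) x))"
    by (simp add: N_def \<delta>.sum)
  also have "{..p} = insert 0 {1..p}" by auto
  also have "(\<Sum>r\<in>insert 0 {1..p}. \<delta> 0 ((t ^^ r) x)) = \<delta> 0 x + (\<Sum>r\<in>{1..p}. \<delta> 0 ((t ^^ r) x))"
    by simp
  also have "(\<Sum>r\<in>{1..p}. \<delta> 0 ((t ^^ r) x)) = (\<Sum>r\<in>{1..p}. (t ^^ r) (\<delta> (Suc p - r) x))"
  proof (rule sum.cong[OF refl])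
    fix r assume r: "r \<in> {1..p}"
    then obtain m where m: "r = Suc m" by (cases r) auto
    show "\<delta> 0 ((t ^^ r) x) = (t ^^ r) (\<delta> (Suc p - r) x)"
      using \<delta>_0_t[OF tpow_W[OF x], of m] \<delta>_tpow[OF x, of m p] r unfolding m by simp
  qed
  finally show ?thesis .
qed

text \<open>Applying \<open>b s = 1 - s b' - t\<close> to \<open>F x\<close> produces
  \<open>F - t F\<close>, which cancels the rotated derivations of \<open>e B\<close> and completes
  \<open>\<delta> 0\<close> to \<open>L\<close>. What is left over is \<open>s\<close> applied to
  the defect in \<open>b' F = F b - N e\<close>, a relation.\<close>

theorem cartan:
  assumes x: "x \<in> W (Suc q)"
  shows "eqR (Suc q) (e (Suc (Suc q)) (B (Suc q) x) + B q (e (Suc q) x) +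
           (b (Suc (Suc q)) (E (Suc q) x) + E q (b (Suc q) x))) (L (Suc q) x)"
proof -
  let ?p = "Suc q"
  have L: "L ?p x = \<delta> 0 x + L_from ?p 1 x"
    unfolding L_from_def by (simp add: sum.atLeast_Suc_atMost)
  define y where "y = (\<Sum>r\<in>{1..?p}. (t ^^ r) (\<delta> (Suc ?p - r) x))"
  have bE: "b (Suc ?p) (E ?p x) = - (F ?p x - s (face_sum ?p (F ?p x)) - t (F ?p x))"
    unfolding E_def b.minus b_s[OF F_W[OF x]] ..
  have y: "y = F ?p x - t (F ?p x) + L_from ?p 1 x"
    unfolding F_diff_t_F[OF x] y_def by simp
  have "E q (b ?p x) = - s (F q (b ?p x))" by (simp add: E_def)
  then have "e (Suc ?p) (B ?p x) + B q (e ?p x) + (b (Suc ?p) (E ?p x) + E q (b ?p x)) =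
      \<delta> 0 x + L_from ?p 1 x + (s (face_sum ?p (F ?p x)) - s (F q (b ?p x) - N q (e ?p x)))"
    unfolding e_B[OF x] y_def[symmetric] bE y by (simp add: B_def s.diff)
  moreover have "eqR ?p (s (face_sum ?p (F ?p x)) - s (F q (b ?p x) - N q (e ?p x))) 0"
    using eqR_s[OF face_sum_F[OF x]] by (simp add: eqR_def)
  ultimately show ?thesis
    unfolding L using eqR_add[OF eqR_refl] by fastforce
qed

lemma cartan_0:
  assumes x: "x \<in> W 0"
  shows "e (Suc 0) (B 0 x) = L 0 x"
  unfolding e_B[OF x] by (simp add: L_from_def)

text \<open>Contraction with a family \<open>f\<close> of operators on slots fails to anticommute
  with \<open>b\<close> only through the face that merges the last two factors; the right-hand side
  is the Leibniz defect of \<open>f\<close> at that face. It serves for \<open>\<delta>\<close> as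
  well as for its square.\<close>

lemma b_contraction:
  assumes x: "x \<in> W (Suc (Suc p))"
    and f_less: "\<And>k. k \<le> p \<Longrightarrow> d k (f (Suc (Suc p)) x) = f (Suc p) (d k x)"
    and f_last: "d (Suc (Suc p)) (f (Suc p) x) = f (Suc p) (d (Suc (Suc p)) x)"
    and f_W: "f (Suc (Suc p)) x \<in> W (Suc (Suc p))" "f (Suc p) x \<in> W (Suc (Suc p))"
    and f_additive: "additive (f (Suc p))"
  shows "b (Suc p) (- d (Suc (Suc p)) (f (Suc (Suc p)) x)) + (- d (Suc p) (f (Suc p) (b (Suc (Suc p)) x))) =
    d (Suc p) (d (Suc p) (f (Suc (Suc p)) x) + d (Suc p) (f (Suc p) x) - f (Suc p) (d (Suc p) x))"
proof -
  interpret f: additive "f (Suc p)" by (rule f_additive)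
  let ?n = "Suc p"
  have "b ?n (- d (Suc ?n) (f (Suc ?n) x)) = (\<Sum>k\<le>?n. - d k (d (Suc ?n) (f (Suc ?n) x)))"
    by (simp add: b_def sum_negf d.minus)
  also have "\<dots> = (\<Sum>k\<le>?n. d ?n (d k (f (Suc ?n) x)))"
    using d_d[OF f_W(1)] by (intro sum.cong) auto
  also have "\<dots> = (\<Sum>k\<le>p. d ?n (f ?n (d k x))) + d ?n (d ?n (f (Suc ?n) x))"
    using f_less by simp
  finally have 1: "b ?n (- d (Suc ?n) (f (Suc ?n) x)) = \<dots>" .
  have "d ?n (f ?n (b (Suc ?n) x)) =
      (\<Sum>k\<le>p. d ?n (f ?n (d k x))) + d ?n (f ?n (d ?n x)) + d ?n (f ?n (d (Suc ?n) x))"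
    by (simp add: b_def f.sum f.add d.sum d.add)
  also have "d ?n (f ?n (d (Suc ?n) x)) = - d ?n (d ?n (f ?n x))"
    unfolding f_last[symmetric] using d_d[OF f_W(2), of ?n ?n] by simp
  finally show ?thesis unfolding 1 by (simp add: d.add d.diff)
qed

lemma e_b:
  assumes x: "x \<in> W (Suc (Suc p))"
  shows "eqR p (b (Suc p) (e (Suc (Suc p)) x)) (- e (Suc p) (b (Suc (Suc p)) x))"
proof -
  have "b (Suc p) (e (Suc (Suc p)) x) + e (Suc p) (b (Suc (Suc p)) x) =
      d (Suc p) (d (Suc p) (\<delta> (Suc p) x) + d (Suc p) (\<delta> (Suc (Suc p)) x) - \<delta> (Suc p) (d (Suc p) x))"
    using b_contraction[OF x, of \<delta>] d_\<delta>_greater[OF x, of _ "Suc p"] d_\<delta>_last[OF x, of "Suc p"]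
      \<delta>_W[OF x] additive_\<delta> by (simp add: e_def add.commute)
  moreover have "\<dots> \<in> R p" by (intro d_R derivation x) auto
  ultimately show ?thesis by (simp add: eqR_def)
qed

definition e2 :: "nat \<Rightarrow> 'v \<Rightarrow> 'v" where
  "e2 p x = (if p = 0 then 0 else - d p (\<delta> p (\<delta> p x)))"

sublocale e2: additive "e2 p" for p by unfold_locales (simp add: e2_def d.add \<delta>.add)

lemma e2_W: "x \<in> W (Suc p) \<Longrightarrow> e2 (Suc p) x \<in> W p"
  unfolding e2_def by (auto intro: W_minus d_W \<delta>_W)

lemma e2_R: "x \<in> R (Suc p) \<Longrightarrow> e2 (Suc p) x \<in> R p"
  unfolding e2_def by (auto intro!: R_minus d_R \<delta>_R)

text \<open>Since \<open>D\<^sup>2(ab) = D\<^sup>2(a) b + 2 D(a) D(b) + a D\<^sup>2(b)\<close>, contraction with \<open>D\<^sup>2\<close> is a null homotopy of \<open>2 e\<^sub>D\<^sup>2\<close>.\<close>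

lemma e_e:
  assumes x: "x \<in> W (Suc (Suc p))"
  shows "eqR p (e (Suc p) (e (Suc (Suc p)) x) + e (Suc p) (e (Suc (Suc p)) x))
    (b (Suc p) (e2 (Suc (Suc p)) x) + e2 (Suc p) (b (Suc (Suc p)) x))"
proof -
  let ?n = "Suc p"
  define f where "f j y = \<delta> j (\<delta> j y)" for j y
  have f: "additive (f j)" for j by unfold_locales (simp add: f_def \<delta>.add)
  let ?u = "\<delta> ?n x" and ?v = "\<delta> (Suc ?n) x"
  have uW: "?u \<in> W (Suc ?n)" "?v \<in> W (Suc ?n)" using \<delta>_W[OF x] by auto
  define r where "r y = d ?n (\<delta> ?n y) + d ?n (\<delta> (Suc ?n) y) - \<delta> ?n (d ?n y)" for y
  have r: "r y \<in> R ?n" if "y \<in> W (Suc ?n)" for y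
    unfolding r_def by (rule derivation[OF that]) simp
  \<comment> \<open>The Leibniz rule is used for \<open>x\<close> and then for both first
    derivatives \<open>?u\<close> and \<open>?v\<close>. The mixed derivative appears twice, which
    is the origin of the factor 2; the defects are collected in \<open>r\<close>.\<close>
  have "\<delta> ?n (\<delta> ?n (d ?n x)) = \<delta> ?n (d ?n ?u) + \<delta> ?n (d ?n ?v) - \<delta> ?n (r x)"
    by (simp add: r_def \<delta>.add \<delta>.diff)
  also have "\<delta> ?n (d ?n ?u) = d ?n (\<delta> ?n ?u) + d ?n (\<delta> (Suc ?n) ?u) - r ?u"
    by (simp add: r_def)
  also have "\<delta> ?n (d ?n ?v) = d ?n (\<delta> ?n ?v) + d ?n (\<delta> (Suc ?n) ?v) - r ?v"
    by (simp add: r_def)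
  also have "\<delta> (Suc ?n) ?u = \<delta> ?n ?v"
    by (rule \<delta>_\<delta>[OF x]) auto
  finally have ff: "f ?n (d ?n x) = d ?n (f ?n x) + d ?n (\<delta> ?n ?v) - r ?u
      + (d ?n (\<delta> ?n ?v) + d ?n (f (Suc ?n) x) - r ?v) - \<delta> ?n (r x)"
    by (simp add: f_def)
  have "b ?n (e2 (Suc ?n) x) + e2 ?n (b (Suc ?n) x) =
      d ?n (d ?n (f (Suc ?n) x) + d ?n (f ?n x) - f ?n (d ?n x))"
    using b_contraction[OF x, of f] d_\<delta>_greater[OF x, of _ "Suc p"]
      d_\<delta>_greater[OF \<delta>_W[OF x], of _ "Suc p"] d_\<delta>_last[OF x, of "Suc p"]
      d_\<delta>_last[OF \<delta>_W[OF x], of "Suc p"] \<delta>_W[OF \<delta>_W[OF x]] f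
    by (simp add: e2_def f_def)
  also have "\<dots> = d ?n (r ?u + r ?v + \<delta> ?n (r x)) - (d ?n (d ?n (\<delta> ?n ?v)) + d ?n (d ?n (\<delta> ?n ?v)))"
    unfolding ff by (simp add: d.add d.diff)
  \<comment> \<open>Multiplying the last two factors and then their product onto \<open>a_0\<close>
    is, up to sign, multiplying them onto \<open>a_0\<close> one after the other, which is what
    applying \<open>e\<close> twice does.\<close>
  also have "d ?n (d ?n (\<delta> ?n ?v)) = - e ?n (e (Suc ?n) x)"
  proof -
    have "d ?n (d ?n (\<delta> ?n ?v)) = - d ?n (d (Suc ?n) (\<delta> ?n ?v))"
      using d_d[OF \<delta>_W[OF uW(2)], of ?n ?n ?n] by simp
    also have "d (Suc ?n) (\<delta> ?n ?v) = \<delta> ?n (d (Suc ?n) ?v)"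
      by (rule d_\<delta>_last[OF uW(2)]) auto
    finally show ?thesis by (simp add: e_def d.minus \<delta>.minus)
  qed
  finally have "b ?n (e2 (Suc ?n) x) + e2 ?n (b (Suc ?n) x) -
      (e ?n (e (Suc ?n) x) + e ?n (e (Suc ?n) x)) = d ?n (r ?u + r ?v + \<delta> ?n (r x))"
    by simp
  moreover have "d ?n (r ?u + r ?v + \<delta> ?n (r x)) \<in> R p"
    by (intro d_R R_add r uW \<delta>_R x) auto
  ultimately show ?thesis by - (rule eqR_sym, simp only: eqR_def)
qed

end

section \<open>Weights in homology\<close>

text \<open>This collects what the weight argument sees of the words. \<open>Q\<close> is
  instantiated with the multilinearity relations for \<open>e\<close>, and with the degenerate words
  added for \<open>B\<close>. \<open>H p m\<close> is only a set of generators of weight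
  \<open>m\<close>, and they are eigenvectors of \<open>L\<close> modulo \<open>Q\<close>, not on
  the nose.\<close>

locale mixed_cartan = subquotients scale
  for scale :: "'k::field_char_0 \<Rightarrow> 'v::ab_group_add \<Rightarrow> 'v" (infixr \<open>*s\<close> 75) +
  fixes W Q :: "nat \<Rightarrow> 'v set" and b e B :: "'v \<Rightarrow> 'v" and E L :: "nat \<Rightarrow> 'v \<Rightarrow> 'v"
    and H :: "nat \<Rightarrow> nat \<Rightarrow> 'v set" and one :: "nat \<Rightarrow> 'v"
  assumes lin: "Vector_Spaces.linear scale scale b" "Vector_Spaces.linear scale scale e"
      "Vector_Spaces.linear scale scale B" "Vector_Spaces.linear scale scale (L p)"
    and sub_W: "subspace (W p)" and sub_Q: "subspace (Q p)" and Q_W: "Q p \<subseteq> W p"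
    and b_W: "x \<in> W (Suc p) \<Longrightarrow> b x \<in> W p" and b_0: "x \<in> W 0 \<Longrightarrow> b x = 0"
    and e_W: "x \<in> W (Suc p) \<Longrightarrow> e x \<in> W p" and e_0: "x \<in> W 0 \<Longrightarrow> e x = 0"
    and B_W: "x \<in> W p \<Longrightarrow> B x \<in> W (Suc p)" and E_W: "x \<in> W p \<Longrightarrow> E p x \<in> W (Suc p)"
    and b_Q: "x \<in> Q (Suc p) \<Longrightarrow> b x \<in> Q p" and e_Q: "x \<in> Q (Suc p) \<Longrightarrow> e x \<in> Q p"
    and B_Q: "x \<in> Q p \<Longrightarrow> B x \<in> Q (Suc p)" and E_Q: "x \<in> Q p \<Longrightarrow> E p x \<in> Q (Suc p)"
    and L_Q: "x \<in> Q p \<Longrightarrow> L p x \<in> Q p"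
    and b_b: "x \<in> W (Suc (Suc p)) \<Longrightarrow> b (b x) \<in> Q p"
    and e_b: "x \<in> W (Suc (Suc p)) \<Longrightarrow> b (e x) + e (b x) \<in> Q p"
    and B_b: "x \<in> W p \<Longrightarrow> b (B x) + B (b x) \<in> Q p"
    and cartan_0: "x \<in> W 0 \<Longrightarrow> e (B x) - L 0 x \<in> Q 0"
    and cartan: "x \<in> W (Suc p) \<Longrightarrow>
      e (B x) + B (e x) + (b (E (Suc p) x) + E p (b x)) - L (Suc p) x \<in> Q (Suc p)"
    and weights: "W p \<subseteq> span ((\<Union>m. H p m) \<union> Q p)"
    and L_H: "x \<in> H p m \<Longrightarrow> L p x - of_nat m *s x \<in> Q p"
    and H_0: "x \<in> H p 0 \<Longrightarrow> \<exists>c. x - c *s one p \<in> Q p"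
begin

sublocale b: Vector_Spaces.linear scale scale b by (rule lin)
sublocale e: Vector_Spaces.linear scale scale e by (rule lin)
sublocale B: Vector_Spaces.linear scale scale B by (rule lin)
sublocale L: Vector_Spaces.linear scale scale "L p" for p by (rule lin)

section \<open>Cycles, boundaries and the induced operators\<close>

definition Z :: "nat \<Rightarrow> 'v set" where "Z p = {x \<in> W p. b x \<in> Q (p - 1)}"
definition Bd :: "nat \<Rightarrow> 'v set" where "Bd p = {b y + k |y k. y \<in> W (Suc p) \<and> k \<in> Q p}"

lemma sub_Bd: "subspace (Bd p)"
  unfolding Bd_def by (intro subspace_boundaries lin sub_W sub_Q)

lemma Q_Bd: "x \<in> Q p \<Longrightarrow> x \<in> Bd p"
  unfolding Bd_def using b.zero subspace_0[OF sub_W] by force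

lemma b_Bd: "y \<in> W (Suc p) \<Longrightarrow> b y \<in> Bd p"
  unfolding Bd_def using subspace_0[OF sub_Q] by force

lemma minus_Q: "x + y \<in> Q p \<Longrightarrow> y \<in> Q p \<Longrightarrow> x \<in> Q p"
  using subspace_diff[OF sub_Q] by (metis add_diff_cancel_right')

lemma minus_Bd: "x + y \<in> Bd p \<Longrightarrow> y \<in> Bd p \<Longrightarrow> x \<in> Bd p"
  using subspace_diff[OF sub_Bd] by (metis add_diff_cancel_right')

lemma e_Z:
  assumes "x \<in> Z (Suc p)" shows "e x \<in> Z p"
proof (cases p)
  case 0
  then show ?thesis
    using assms e_W b_0 subspace_0[OF sub_Q] by (auto simp: Z_def)
next
  case (Suc q)
  then have x: "x \<in> W (Suc (Suc q))" "b x \<in> Q (Suc q)" using assms by (auto simp: Z_def)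
  show ?thesis unfolding Z_def Suc using e_W[OF x(1)] minus_Q[OF e_b[OF x(1)] e_Q[OF x(2)]] by simp
qed

lemma e_Bd:
  assumes "x \<in> Bd (Suc p)" shows "e x \<in> Bd p"
proof -
  obtain y k where x: "x = b y + k" "y \<in> W (Suc (Suc p))" "k \<in> Q (Suc p)"
    using assms by (auto simp: Bd_def)
  have "e (b y) \<in> Bd p"
    using minus_Bd[OF _ b_Bd[OF e_W[OF x(2)]]] Q_Bd[OF e_b[OF x(2)]] by (metis add.commute)
  then show ?thesis using x(1) Q_Bd[OF e_Q[OF x(3)]] subspace_add[OF sub_Bd] by (simp add: e.add)
qed

lemma B_Z:
  assumes "x \<in> Z p" shows "B x \<in> Z (Suc p)"
proof -
  have x: "x \<in> W p" "b x \<in> Q (p - 1)" using assms by (auto simp: Z_def)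
  have "B (b x) \<in> Q p"
    using x b_0 B_Q[of "b x" "p - 1"] subspace_0[OF sub_Q] by (cases p) (auto simp: B.zero)
  then show ?thesis using x B_W[OF x(1)] minus_Q[OF B_b[OF x(1)]] by (simp add: Z_def)
qed

lemma B_Bd:
  assumes "x \<in> Bd p" shows "B x \<in> Bd (Suc p)"
proof -
  obtain y k where x: "x = b y + k" "y \<in> W (Suc p)" "k \<in> Q p"
    using assms by (auto simp: Bd_def)
  have "B (b y) \<in> Bd (Suc p)"
    using minus_Bd[OF _ b_Bd[OF B_W[OF x(2)]]] Q_Bd[OF B_b[OF x(2)]] by (metis add.commute)
  then show ?thesis using x(1) Q_Bd[OF B_Q[OF x(3)]] subspace_add[OF sub_Bd] by (simp add: B.add)
qed

primrec kill_weights :: "nat \<Rightarrow> nat \<Rightarrow> 'v \<Rightarrow> 'v" where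
  "kill_weights p 0 x = x"
| "kill_weights p (Suc M) x =
     kill_weights p M x - (1 / of_nat (Suc M)) *s L p (kill_weights p M x)"

lemma linear_kill_weights: "Vector_Spaces.linear scale scale (kill_weights p M)"
  by unfold_locales (induction M; simp add: L.add L.scale algebra_simps)+

sublocale kill: Vector_Spaces.linear scale scale "kill_weights p M" for p M
  by (rule linear_kill_weights)

lemma kill_weights_Q: "x \<in> Q p \<Longrightarrow> kill_weights p M x \<in> Q p"
  by (induction M) (auto intro!: subspace_diff[OF sub_Q] subspace_scale[OF sub_Q] L_Q)

text \<open>Modulo \<open>Q\<close>, the factor \<open>1 - L/i\<close> acts on weight
  \<open>m\<close> as the scalar \<open>1 - m/i\<close>. The product is zero as soon as
  \<open>M \<ge> m > 0\<close>, and it is 1 for \<open>m = 0\<close>.\<close>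

lemma kill_weights_H:
  assumes x: "x \<in> H p m"
  shows "kill_weights p M x - (\<Prod>i\<in>{1..M}. 1 - of_nat m / of_nat i) *s x \<in> Q p"
proof (induction M)
  case 0
  then show ?case using subspace_0[OF sub_Q] by simp
next
  case (Suc M)
  let ?c = "\<Prod>i\<in>{1..M}. 1 - of_nat m / of_nat i" and ?n = "1 / of_nat (Suc M)"
  define r where "r = kill_weights p M x - ?c *s x"
  define r' where "r' = L p x - of_nat m *s x"
  have r: "r \<in> Q p" "r' \<in> Q p" using Suc L_H[OF x] by (auto simp: r_def r'_def)
  have k: "kill_weights p M x = ?c *s x + r" "L p x = of_nat m *s x + r'"
    by (auto simp: r_def r'_def)
  have "kill_weights p (Suc M) x - (?c * (1 - of_nat m / of_nat (Suc M))) *s x =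
      r - ?n *s (?c *s r' + L p r)"
    unfolding kill_weights.simps k L.add L.scale by (simp add: algebra_simps)
  also have "\<dots> \<in> Q p"
    by (intro subspace_diff[OF sub_Q] subspace_scale[OF sub_Q] subspace_add[OF sub_Q] r L_Q)
  finally show ?case by (simp add: mult.commute)
qed

text \<open>
  The operator \<open>(1 - L/1) (1 - L/2) \<dots> (1 - L/M)\<close> kills the weights \<open>1, \<dots>, M\<close>, and it is the identity
  modulo every \<open>K\<close> that contains \<open>L S\<close>.
\<close>

lemma weight_zero_generates:
  assumes S: "S \<subseteq> W p" and K: "subspace K" "K \<subseteq> S" "Q p \<subseteq> K" and LS: "\<And>x. x \<in> S \<Longrightarrow> L p x \<in> K"
    and sub_S: "subspace S" and x: "x \<in> S"
  shows "\<exists>c. x - c *s one p \<in> K"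
proof -
  \<comment> \<open>All large \<open>M\<close> are required instead of a single one: generators of
    different weights need different bounds, and sums need a common value of
    \<open>M\<close>.\<close>
  define G where "G = {x. \<exists>M0. \<forall>M\<ge>M0. \<exists>c. kill_weights p M x - c *s one p \<in> Q p}"
  have "subspace G"
  proof (rule subspaceI)
    show "0 \<in> G" unfolding G_def using subspace_0[OF sub_Q]
      by (auto simp: kill.zero intro!: exI[of _ 0])
    fix x y assume "x \<in> G" "y \<in> G"
    then obtain M0 M1 where M: "\<forall>M\<ge>M0. \<exists>c. kill_weights p M x - c *s one p \<in> Q p"
      "\<forall>M\<ge>M1. \<exists>c. kill_weights p M y - c *s one p \<in> Q p" by (auto simp: G_def)
    have "\<exists>c. kill_weights p M (x + y) - c *s one p \<in> Q p" if "M \<ge> max M0 M1" for M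
    proof -
      obtain c c' where c: "kill_weights p M x - c *s one p \<in> Q p"
        "kill_weights p M y - c' *s one p \<in> Q p" using M \<open>M \<ge> max M0 M1\<close> by fastforce
      have "kill_weights p M (x + y) - (c + c') *s one p =
          (kill_weights p M x - c *s one p) + (kill_weights p M y - c' *s one p)"
        by (simp add: kill.add algebra_simps)
      then show ?thesis using subspace_add[OF sub_Q c] by metis
    qed
    then show "x + y \<in> G" unfolding G_def by blast
  next
    fix a x assume "x \<in> G"
    then obtain M0 where M: "\<forall>M\<ge>M0. \<exists>c. kill_weights p M x - c *s one p \<in> Q p" by (auto simp: G_def)
    have "\<exists>c. kill_weights p M (a *s x) - c *s one p \<in> Q p" if "M \<ge> M0" for M
    proof -
      obtain c where c: "kill_weights p M x - c *s one p \<in> Q p" using M \<open>M \<ge> M0\<close> by blast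
      have "kill_weights p M (a *s x) - (a * c) *s one p = a *s (kill_weights p M x - c *s one p)"
        by (simp add: kill.scale algebra_simps)
      then show ?thesis using subspace_scale[OF sub_Q c] by metis
    qed
    then show "a *s x \<in> G" by (auto simp: G_def)
  qed
  moreover have "Q p \<subseteq> G"
    unfolding G_def using kill_weights_Q by (auto intro!: exI[of _ 0])
  moreover have "H p m \<subseteq> G" for m
  proof
    fix y assume y: "y \<in> H p m"
    have "\<exists>c. kill_weights p M y - c *s one p \<in> Q p" if M: "M \<ge> m" for M
    proof (cases "m = 0")
      case True
      obtain c where c: "y - c *s one p \<in> Q p" using H_0 y True by blast
      have "kill_weights p M y - y \<in> Q p" using kill_weights_H[OF y, of M] True by simp
      from subspace_add[OF sub_Q this c] show ?thesis by auto
    next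
      case False
      then have zero: "(\<Prod>i\<in>{1..M}. 1 - of_nat m / of_nat i :: 'k) = 0"
        using M by (intro prod_zero) (auto intro!: bexI[of _ m])
      have "kill_weights p M y - 0 *s one p \<in> Q p"
        using kill_weights_H[OF y, of M, unfolded zero] by simp
      then show ?thesis by blast
    qed
    then show "y \<in> G" by (auto simp: G_def)
  qed
  ultimately have "W p \<subseteq> G"
    using weights span_minimal[of "(\<Union>m. H p m) \<union> Q p" G] by blast
  then obtain M c where c: "kill_weights p M x - c *s one p \<in> Q p"
    using x S unfolding G_def by blast
  have "kill_weights p M x \<in> S \<and> kill_weights p M x - x \<in> K" for M
  proof (induction M)
    case 0
    then show ?case using x subspace_0[OF K(1)] by simp
  next
    case (Suc M)
    then have "(1 / of_nat (Suc M)) *s L p (kill_weights p M x) \<in> K" (is "?u \<in> K")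
      using LS subspace_scale[OF K(1)] by blast
    moreover have "kill_weights p (Suc M) x = kill_weights p M x - ?u"
      "kill_weights p (Suc M) x - x = (kill_weights p M x - x) - ?u" by auto
    ultimately show ?case using Suc K(2) subspace_diff[OF K(1)] subspace_diff[OF sub_S] by (metis subsetD)
  qed
  then have "(kill_weights p M x - c *s one p) - (kill_weights p M x - x) \<in> K"
    using c K subspace_diff[OF K(1)] by blast
  then show ?thesis by auto
qed

section \<open>Kernels and images of \<open>H(e)\<close> and \<open>H(B)\<close>, pulled back to
  words\<close>

definition S_hi :: "nat \<Rightarrow> 'v set" where "S_hi p = {x \<in> Z p. e x \<in> Bd (p - 1)}"
definition K_hi :: "nat \<Rightarrow> 'v set" where "K_hi p = {e y + k |y k. y \<in> Z (Suc p) \<and> k \<in> Bd p}"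
definition S_dR :: "nat \<Rightarrow> 'v set" where "S_dR p = {x \<in> Z p. B x \<in> Bd (Suc p)}"
definition K_dR :: "nat \<Rightarrow> 'v set" where
  "K_dR p = {B y + k |y k. y \<in> (if p = 0 then {0} else Z (p - 1)) \<and> k \<in> Bd p}"

lemma sub_Z: "subspace (Z p)"
  unfolding Z_def by (intro subspace_cycles lin sub_W sub_Q)

lemma sub_S_hi: "subspace (S_hi p)" and sub_K_hi: "subspace (K_hi p)"
  and sub_S_dR: "subspace (S_dR p)" and sub_K_dR: "subspace (K_dR p)"
proof -
  show "subspace (S_hi p)" "subspace (K_hi p)" "subspace (S_dR p)"
    unfolding S_hi_def K_hi_def S_dR_def
    by (intro subspace_cycles subspace_boundaries lin sub_Z sub_Bd)+
  have "subspace (if p = 0 then {0} else Z (p - 1))" by (simp add: sub_Z subspace_single_0)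
  then show "subspace (K_dR p)"
    unfolding K_dR_def by (intro subspace_boundaries lin sub_Bd)
qed

lemma Bd_K_hi: "x \<in> Bd p \<Longrightarrow> x \<in> K_hi p"
  unfolding K_hi_def using e.zero subspace_0[OF sub_Z] by force

lemma Bd_K_dR: "x \<in> Bd p \<Longrightarrow> x \<in> K_dR p"
  unfolding K_dR_def using B.zero subspace_0[OF sub_Z] by (force split: if_splits)

text \<open>For a cycle, \<open>b x\<close> is a relation and so is \<open>E (b x)\<close>, while
  \<open>b (E x)\<close> is a boundary; the homotopy terms vanish in homology. In degree 0 there are
  none, and \<open>e x = 0\<close>.\<close>

lemma cartan_Bd:
  assumes "x \<in> Z p"
  shows "\<exists>r\<in>Bd p. L p x = e (B x) + B (e x) + r"
proof (cases p)
  case 0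
  then have x: "x \<in> W 0" using assms by (simp add: Z_def)
  have "L 0 x = e (B x) + B (e x) + - (e (B x) - L 0 x)" using e_0[OF x] by (simp add: B.zero)
  then show ?thesis unfolding 0 using Q_Bd subspace_neg[OF sub_Bd] cartan_0[OF x] by blast
next
  case (Suc q)
  then have x: "x \<in> W (Suc q)" "b x \<in> Q q" using assms by (auto simp: Z_def)
  define r where "r = b (E (Suc q) x) + E q (b x) - (e (B x) + B (e x) + (b (E (Suc q) x) + E q (b x)) - L (Suc q) x)"
  have "r \<in> Bd (Suc q)"
    unfolding r_def using cartan[OF x(1)] E_Q[OF x(2)] E_W[OF x(1)]
    by (intro subspace_diff[OF sub_Bd] subspace_add[OF sub_Bd] b_Bd Q_Bd)
  moreover have "L p x = e (B x) + B (e x) + r" unfolding Suc r_def by simp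
  ultimately show ?thesis unfolding Suc by blast
qed

text \<open>If \<open>H(e)\<close> kills the class of \<open>x\<close>, then \<open>B (e x)\<close>
  is a boundary and only \<open>e (B x)\<close> is left of the Cartan formula, which is in the image
  of \<open>H(e)\<close> because \<open>B x\<close> is a cycle. For \<open>H(B)\<close> the two
  terms exchange their parts.\<close>

lemma L_S_hi:
  assumes "x \<in> S_hi p" shows "L p x \<in> K_hi p"
proof -
  have x: "x \<in> Z p" "e x \<in> Bd (p - 1)" using assms by (auto simp: S_hi_def)
  obtain r where r: "r \<in> Bd p" "L p x = e (B x) + B (e x) + r" using cartan_Bd[OF x(1)] by blast
  have "B (e x) \<in> Bd p"
    using x B_Bd[of "e x" "p - 1"] e_0 subspace_0[OF sub_Bd] by (cases p) (auto simp: B.zero Z_def)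
  moreover have "e (B x) \<in> K_hi p"
    unfolding K_hi_def using B_Z[OF x(1)] subspace_0[OF sub_Bd] by force
  ultimately show ?thesis
    unfolding r(2) using r(1) by (intro subspace_add[OF sub_K_hi]) (auto intro: Bd_K_hi)
qed

lemma L_S_dR:
  assumes "x \<in> S_dR p" shows "L p x \<in> K_dR p"
proof -
  have x: "x \<in> Z p" "B x \<in> Bd (Suc p)" using assms by (auto simp: S_dR_def)
  obtain r where r: "r \<in> Bd p" "L p x = e (B x) + B (e x) + r" using cartan_Bd[OF x(1)] by blast
  have "B (e x) \<in> K_dR p"
  proof (cases p)
    case 0
    then show ?thesis using x(1) e_0 subspace_0[OF sub_K_dR] by (simp add: Z_def B.zero)
  next
    case (Suc q)
    then show ?thesis
      unfolding K_dR_def using x(1) e_Z subspace_0[OF sub_Bd] by force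
  qed
  then show ?thesis
    unfolding r(2) using r(1) e_Bd[OF x(2)] by (intro subspace_add[OF sub_K_dR]) (auto intro: Bd_K_dR)
qed

text \<open>The inclusion \<open>K_hi p \<subseteq> S_hi p\<close> expresses that
  \<open>H(e)\<close> squares to zero. The locale does not contain this; it comes later with the
  presentation of the homology module.\<close>

lemma S_hi_generated:
  assumes "K_hi p \<subseteq> S_hi p" and x: "x \<in> S_hi p"
  shows "\<exists>c. x - c *s one p \<in> K_hi p"
  by (rule weight_zero_generates[OF _ sub_K_hi assms(1) _ L_S_hi sub_S_hi x])
    (auto simp: S_hi_def Z_def intro: Bd_K_hi Q_Bd)

lemma S_dR_generated:
  assumes "K_dR p \<subseteq> S_dR p" and x: "x \<in> S_dR p"
  shows "\<exists>c. x - c *s one p \<in> K_dR p"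
  by (rule weight_zero_generates[OF _ sub_K_dR assms(1) _ L_S_dR sub_S_dR x])
    (auto simp: S_dR_def Z_def intro: Bd_K_dR Q_Bd)

end

section \<open>Operators on words\<close>

global_interpretation words: subquotients words_scale ..

abbreviation lin :: "(('k::field, 'a) words \<Rightarrow> ('k, 'b) words) \<Rightarrow> bool" where
  "lin \<equiv> Vector_Spaces.linear words_scale words_scale"

lemma words_scale_single [simp]: "words_scale c (Poly_Mapping.single l a) = Poly_Mapping.single l (c * a)"
  by (rule poly_mapping_eqI) (simp add: lookup_words_scale lookup_single when_def)

lemma words_extend_superset:
  assumes "finite A" "Poly_Mapping.keys x \<subseteq> A"
  shows "words_extend f x = (\<Sum>l\<in>A. words_scale (Poly_Mapping.lookup x l) (f l))"
  unfolding words_extend_def using assms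
  by (intro sum.mono_neutral_left) (auto simp: in_keys_iff)

lemma linear_words_extend: "lin (words_extend f)"
proof unfold_locales
  fix x y :: "('a, 'b) words" and c
  let ?A = "Poly_Mapping.keys x \<union> Poly_Mapping.keys y"
  have "words_extend f (x + y) = (\<Sum>l\<in>?A. words_scale (Poly_Mapping.lookup (x + y) l) (f l))"
    using keys_add[of x y] by (intro words_extend_superset) auto
  also have "\<dots> = (\<Sum>l\<in>?A. words_scale (Poly_Mapping.lookup x l) (f l)) +
      (\<Sum>l\<in>?A. words_scale (Poly_Mapping.lookup y l) (f l))"
    by (simp add: lookup_add words.scale_left_distrib sum.distrib)
  also have "\<dots> = words_extend f x + words_extend f y"
    using words_extend_superset[of ?A x f] words_extend_superset[of ?A y f] by simp
  finally show "words_extend f (x + y) = words_extend f x + words_extend f y" .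
  have "Poly_Mapping.keys (words_scale c x) \<subseteq> Poly_Mapping.keys x"
    by (auto simp: in_keys_iff lookup_words_scale)
  then have "words_extend f (words_scale c x) =
      (\<Sum>l\<in>Poly_Mapping.keys x. words_scale (Poly_Mapping.lookup (words_scale c x) l) (f l))"
    by (intro words_extend_superset) auto
  then show "words_extend f (words_scale c x) = words_scale c (words_extend f x)"
    by (simp add: words_extend_def lookup_words_scale words.scale_sum_right)
qed

lemma words_extend_single [simp]:
  "words_extend f (Poly_Mapping.single l a) = words_scale a (f l)"
  using words_extend_superset[of "{l}" "Poly_Mapping.single l a" f] by simp

definition word_space :: "nat \<Rightarrow> ('k::field, 'a) words set" where
  "word_space p = {x. \<forall>l\<in>Poly_Mapping.keys x. length l = Suc p}"

lemma carrier_words_module: "carrier (words_module p) = word_space p"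
  by (simp add: words_module_def word_space_def)

lemma subspace_word_space: "words.subspace (word_space p)"
  unfolding words.subspace_def word_space_def
  by (auto simp: in_keys_iff lookup_words_scale lookup_add)

lemma single_word_space: "length l = Suc p \<Longrightarrow> Poly_Mapping.single l a \<in> word_space p"
  by (auto simp: word_space_def)

lemma linear_in_subspace:
  assumes f: "lin f" and U: "words.subspace U"
    and x: "x \<in> word_space p"
    and single: "\<And>l. length l = Suc p \<Longrightarrow> f (Poly_Mapping.single l 1) \<in> U"
  shows "f x \<in> U"
proof -
  interpret f: Vector_Spaces.linear words_scale words_scale f by fact
  have "x = (\<Sum>l\<in>Poly_Mapping.keys x. words_scale (Poly_Mapping.lookup x l) (Poly_Mapping.single l 1))"
    by (rule poly_mapping_eqI)
      (auto simp: lookup_sum lookup_single when_def in_keys_iff sum.delta')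
  then have "f x = (\<Sum>l\<in>Poly_Mapping.keys x. words_scale (Poly_Mapping.lookup x l) (f (Poly_Mapping.single l 1)))"
    by (metis (no_types, lifting) f.scale f.sum sum.cong)
  also have "\<dots> \<in> U"
    using x single by (intro words.subspace_sum[OF U] words.subspace_scale[OF U]) (auto simp: word_space_def)
  finally show ?thesis .
qed

lemma linear_eq:
  assumes f: "lin f"
    and g: "lin g"
    and x: "x \<in> word_space p"
    and single: "\<And>l. length l = Suc p \<Longrightarrow> f (Poly_Mapping.single l 1) = g (Poly_Mapping.single l 1)"
  shows "f x = g x"
proof -
  interpret vector_space_pair words_scale words_scale ..
  have "f x - g x \<in> {0}"
    using linear_in_subspace[OF linear_compose_sub[OF f g] words.subspace_single_0 x] single by simp
  then show ?thesis by simp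
qed

lemma words_span_image:
  assumes "lin f" "words.subspace U" "f ` S \<subseteq> U" "x \<in> words.span S"
  shows "f x \<in> U"
proof -
  interpret f: Vector_Spaces.linear words_scale words_scale f by fact
  have "f x \<in> words.span (f ` S)" using assms(4) f.span_image by blast
  then show ?thesis using words.span_minimal[OF assms(3,2)] by blast
qed

definition word_op :: "('a list \<Rightarrow> 'k::field) \<Rightarrow> ('a list \<Rightarrow> 'a list) \<Rightarrow> ('k, 'a) words \<Rightarrow> ('k, 'a) words" where
  "word_op c g = words_extend (\<lambda>l. Poly_Mapping.single (g l) (c l))"

lemma linear_word_op: "lin (word_op c g)"
  unfolding word_op_def by (rule linear_words_extend)

lemma word_op_single [simp]:
  "word_op c g (Poly_Mapping.single l a) = Poly_Mapping.single (g l) (a * c l)"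
  by (simp add: word_op_def)

lemma word_op_word_space:
  assumes "x \<in> word_space p" "\<And>l. length l = Suc p \<Longrightarrow> length (g l) = Suc q"
  shows "word_op c g x \<in> word_space q"
  by (rule linear_in_subspace[OF linear_word_op subspace_word_space assms(1)])
    (simp add: single_word_space assms(2))

section \<open>Rotating and merging lists\<close>

definition rot :: "'a list \<Rightarrow> 'a list" where
  "rot l = map (\<lambda>i. if i = 0 then l ! (length l - 1) else l ! (i - 1)) [0..<length l]"

text \<open>Every \<open>k\<close> with \<open>Suc k \<ge> length l\<close> acts as the last face,
  multiplying the last entry onto the first. The description by entries reduces each simplicial
  identity to a case distinction on indices.\<close>

definition merge :: "nat \<Rightarrow> 'a::times list \<Rightarrow> 'a list" where
  "merge k l = map (\<lambda>i. if Suc k < length l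
       then (if i < k then l ! i else if i = k then l ! k * l ! Suc k else l ! Suc i)
       else (if i = 0 then l ! (length l - 1) * l ! 0 else l ! i)) [0..<length l - 1]"

lemma length_rot [simp]: "length (rot l) = length l"
  by (simp add: rot_def)

lemma length_merge [simp]: "length (merge k l) = length l - 1"
  by (simp add: merge_def)

lemma nth_rot: "i < length l \<Longrightarrow> rot l ! i = (if i = 0 then l ! (length l - 1) else l ! (i - 1))"
  by (simp add: rot_def)

lemma nth_merge: "i < length l - 1 \<Longrightarrow> merge k l ! i = (if Suc k < length l
       then (if i < k then l ! i else if i = k then l ! k * l ! Suc k else l ! Suc i)
       else (if i = 0 then l ! (length l - 1) * l ! 0 else l ! i))"
  by (simp add: merge_def)

lemma rot_append: "rot (us @ x # vs) = (if vs = [] then x # us else last vs # us @ x # butlast vs)"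
  by (rule nth_equalityI) (auto simp: nth_rot nth_append nth_Cons' last_conv_nth nth_butlast)

lemma merge_0: "merge 0 (x # y # l) = (x * y) # l"
  by (rule nth_equalityI) (auto simp: nth_merge nth_Cons')

lemma rot_rotate1: "rot (rotate1 l) = l"
  by (cases l; rule nth_equalityI) (auto simp: nth_rot nth_append nth_Cons')

lemma funpow_rot_rotate: "(rot ^^ n) (rotate n l) = l"
proof (induction n)
  case (Suc n)
  have "(rot ^^ Suc n) (rotate (Suc n) l) = (rot ^^ n) (rot (rotate1 (rotate n l)))"
    by (simp add: funpow_swap1)
  then show ?case using Suc by (simp add: rot_rotate1)
qed simp

lemma rot_cycle: "(rot ^^ length l) l = l"
  using funpow_rot_rotate[of "length l" l] by simp

definition word_t :: "('k::field, 'a) words \<Rightarrow> ('k, 'a) words" where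
  "word_t = word_op (\<lambda>l. (-1) ^ (length l - 1)) rot"

definition word_s :: "('k::field, 'a::one) words \<Rightarrow> ('k, 'a) words" where
  "word_s = word_op (\<lambda>_. 1) (Cons 1)"

definition word_d :: "nat \<Rightarrow> ('k::field, 'a::times) words \<Rightarrow> ('k, 'a) words" where
  "word_d k = word_op (\<lambda>_. (-1) ^ k) (merge k)"

definition word_\<delta> :: "('a \<Rightarrow> 'a) \<Rightarrow> nat \<Rightarrow> ('k::field, 'a) words \<Rightarrow> ('k, 'a) words" where
  "word_\<delta> D j = word_op (\<lambda>_. 1) (\<lambda>l. l[j := D (l ! j)])"

lemmas word_ops_defs = word_t_def word_s_def word_d_def word_\<delta>_def

lemma linear_word_ops:
  shows lin_t: "lin word_t" and lin_s: "lin word_s" and lin_d: "lin (word_d k)"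
    and lin_\<delta>: "lin (word_\<delta> D j)"
  unfolding word_ops_defs by (rule linear_word_op)+

lemma linear_additive: "Vector_Spaces.linear words_scale words_scale f \<Longrightarrow> additive f"
  by (metis additive.intro Vector_Spaces.linear.axioms(3) module_hom.add)

lemma word_ops_single [simp]:
  fixes l :: "'a list" and l' :: "'b::one list" and l'' :: "'c::times list"
  shows "word_t (Poly_Mapping.single l a) = Poly_Mapping.single (rot l) (a * (-1) ^ (length l - 1))"
  "word_s (Poly_Mapping.single l' a) = Poly_Mapping.single (1 # l') a"
  "word_d k (Poly_Mapping.single l'' a) = Poly_Mapping.single (merge k l'') (a * (-1) ^ k)"
  "word_\<delta> D j (Poly_Mapping.single l a) = Poly_Mapping.single (l[j := D (l ! j)]) a"
  unfolding word_ops_defs by simp_all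

lemma lin_comp: "lin f \<Longrightarrow> lin g \<Longrightarrow> lin (\<lambda>x. f (g x))"
  using Vector_Spaces.linear_compose[of words_scale words_scale g words_scale f] by (simp add: comp_def)

lemma lin_minus: "lin f \<Longrightarrow> lin (\<lambda>x. - f x)"
proof -
  assume "lin f"
  then interpret f: Vector_Spaces.linear words_scale words_scale f .
  show ?thesis by unfold_locales (simp_all add: f.add f.scale words.scale_minus_right)
qed

lemma lin_add: "lin f \<Longrightarrow> lin g \<Longrightarrow> lin (\<lambda>x. f x + g x)"
  and lin_diff: "lin f \<Longrightarrow> lin g \<Longrightarrow> lin (\<lambda>x. f x - g x)"
proof -
  assume "lin f" "lin g"
  then interpret f: Vector_Spaces.linear words_scale words_scale f + g: Vector_Spaces.linear words_scale words_scale g .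
  show "lin (\<lambda>x. f x + g x)" "lin (\<lambda>x. f x - g x)"
    by (unfold_locales; simp add: f.add f.scale g.add g.scale words.scale_right_distrib words.scale_right_diff_distrib)+
qed

lemma lin_id: "lin (\<lambda>x. x)"
  by unfold_locales simp_all

lemma merge_Suc_rot:
  "length l = Suc (Suc p) \<Longrightarrow> k \<le> p \<Longrightarrow> merge (Suc k) (rot l) = rot (merge k l)"
  by (rule nth_equalityI) (auto simp: nth_merge nth_rot not_less le_Suc_eq)

lemma merge_0_rot: "length l = Suc (Suc p) \<Longrightarrow> merge 0 (rot l) = merge (Suc p) l"
  by (rule nth_equalityI) (auto simp: nth_merge nth_rot)

lemma rot_update_Suc:
  "length l = Suc p \<Longrightarrow> j < p \<Longrightarrow> (rot l)[Suc j := y] = rot (l[j := y])"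
  by (rule nth_equalityI) (auto simp: nth_rot nth_list_update)

lemma rot_update_0: "length l = Suc p \<Longrightarrow> (rot l)[0 := y] = rot (l[p := y])"
  by (rule nth_equalityI) (auto simp: nth_rot nth_list_update)

lemma merge_update_less:
  "length l = Suc (Suc p) \<Longrightarrow> j < k \<Longrightarrow> k \<le> p \<Longrightarrow> merge k (l[j := y]) = (merge k l)[j := y]"
  by (rule nth_equalityI) (auto simp: nth_merge nth_list_update)

lemma merge_update_greater:
  "length l = Suc (Suc p) \<Longrightarrow> k < j \<Longrightarrow> j \<le> p \<Longrightarrow> merge k (l[Suc j := y]) = (merge k l)[j := y]"
  by (rule nth_equalityI) (auto simp: nth_merge nth_list_update)

lemma merge_update_last:
  "length l = Suc (Suc p) \<Longrightarrow> 0 < j \<Longrightarrow> j \<le> p \<Longrightarrow>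
    merge (Suc p) (l[j := y]) = (merge (Suc p) l)[j := y]"
  by (rule nth_equalityI) (auto simp: nth_merge nth_list_update)

lemma merge_merge:
  fixes l :: "'a::semigroup_mult list"
  assumes "length l = Suc (Suc (Suc p))" "i \<le> j" "j \<le> Suc p"
  shows "merge i (merge (Suc j) l) = merge j (merge i l)"
  using assms
  by (intro nth_equalityI)
    (auto simp: nth_merge mult.assoc not_less le_Suc_eq, metis le_antisym less_Suc_eq_le)

lemma merge_Suc_Cons:
  "length l = Suc (Suc p) \<Longrightarrow> k \<le> p \<Longrightarrow> merge (Suc k) (x # l) = x # merge k l"
  by (rule nth_equalityI) (auto simp: nth_merge nth_Cons')

lemma merge_0_Cons_one: "length l = Suc p \<Longrightarrow> merge 0 (1 # l) = (l :: 'a::monoid_mult list)"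
  by (rule nth_equalityI) (auto simp: nth_merge nth_Cons')

lemma merge_last_Cons_one: "length l = Suc p \<Longrightarrow> merge (Suc p) (1 # l) = rot (l :: 'a::monoid_mult list)"
  by (rule nth_equalityI) (auto simp: nth_merge nth_rot nth_Cons')

lemma lin_sum: "(\<And>i. i \<in> I \<Longrightarrow> lin (f i)) \<Longrightarrow> lin (\<lambda>x. \<Sum>i\<in>I. f i x)"
proof -
  interpret vector_space_pair words_scale words_scale ..
  show "(\<And>i. i \<in> I \<Longrightarrow> lin (f i)) \<Longrightarrow> lin (\<lambda>x. \<Sum>i\<in>I. f i x)"
    by (rule linear_compose_sum) blast
qed

lemma merge_take_drop:
  "Suc k < length l \<Longrightarrow> merge k l = take k l @ (l ! k * l ! Suc k) # drop (k + 2) l"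
  by (rule nth_equalityI) (auto simp: nth_merge nth_append nth_Cons' min_def)

lemma merge_last:
  "length l = Suc (Suc p) \<Longrightarrow> merge (Suc p) l = (l ! Suc p * l ! 0) # tl (butlast l)"
  by (rule nth_equalityI) (auto simp: nth_merge nth_Cons' nth_tl nth_butlast)

lemma length_funpow_rot [simp]: "length ((rot ^^ i) l) = length l"
  by (induction i) auto

lemma set_rot [simp]: "set (rot l) = set l"
proof -
  have "l = rotate1 (rot l)"
    by (cases l rule: rev_cases) (auto simp: rot_append rot_def[of "[]"])
  then show ?thesis by (metis set_rotate1)
qed

lemma set_funpow_rot [simp]: "set ((rot ^^ i) l) = set l"
  by (induction i) auto

lemma funpow_rot:
  assumes "i \<le> length l"
  shows "(rot ^^ i) l = drop (length l - i) l @ take (length l - i) l"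
proof -
  have "rotate i (rotate (length l - i) l) = l" using assms by (simp add: rotate_rotate)
  then have "(rot ^^ i) l = rotate (length l - i) l" using funpow_rot_rotate[of i "rotate (length l - i) l"] by simp
  also have "\<dots> = drop (length l - i) l @ take (length l - i) l"
    by (cases "i = 0 \<or> l = []") (auto simp: rotate_drop_take)
  finally show ?thesis .
qed

lemma Cons_one_degenerate:
  assumes "length l = Suc (Suc p)" "0 < q" "q < length l" "l ! q = 1"
  shows "Poly_Mapping.single l 1 \<in> degenerate_words (Suc p)"
proof -
  obtain a l' where l: "l = a # l'" using assms by (cases l) auto
  then have q: "q - 1 < length l'" "l' ! (q - 1) = 1" using assms by (auto simp: nth_Cons')
  have "l = a # take (q - 1) l' @ 1 # drop (Suc (q - 1)) l'"
    unfolding l using id_take_nth_drop[OF q(1)] q(2) by simp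
  then show ?thesis
    unfolding degenerate_words_def using assms(1) q(1) l
    by (intro CollectI exI[of _ a] exI[of _ "take (q - 1) l'"] exI[of _ "drop (Suc (q - 1)) l'"]) auto
qed

lemma single_sum: "Poly_Mapping.single l (\<Sum>i\<in>I. f i) = (\<Sum>i\<in>I. Poly_Mapping.single l (f i))"
  by (induction I rule: infinite_finite_induct) (simp_all add: single_add)

section \<open>The weight derivation\<close>

context graded_algebra
begin

abbreviation comp :: "'a \<Rightarrow> nat \<Rightarrow> 'a" where "comp \<equiv> hom_components \<A>"
abbreviation D :: "'a \<Rightarrow> 'a" where "D \<equiv> weight_derivation scale \<A>"

lemma comp_props:
  shows comp_component: "comp x m \<in> \<A> m" and finite_comp: "finite {m. comp x m \<noteq> 0}"
    and sum_comp: "x = (\<Sum>m | comp x m \<noteq> 0. comp x m)"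
  using theI'[OF direct_sum[of x]] unfolding hom_components_def by blast+

lemma comp_sum:
  assumes "finite I" "{m. comp x m \<noteq> 0} \<subseteq> I"
  shows "x = (\<Sum>m\<in>I. comp x m)"
  by (subst sum_comp, rule sum.mono_neutral_left) (use assms in auto)

lemma comp_eqI:
  assumes "\<And>m. a m \<in> \<A> m" "finite I" "\<And>m. m \<notin> I \<Longrightarrow> a m = 0" "x = (\<Sum>m\<in>I. a m)"
  shows "comp x = a"
proof -
  have fin: "{m. a m \<noteq> 0} \<subseteq> I" "finite {m. a m \<noteq> 0}" using assms(2,3) by (auto intro: finite_subset)
  moreover have "x = (\<Sum>m | a m \<noteq> 0. a m)"
    unfolding assms(4) by (rule sum.mono_neutral_right) (use fin assms(2) in auto)
  ultimately show ?thesis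
    unfolding hom_components_def using the1_equality[OF direct_sum] assms(1) by blast
qed

lemma comp_homogeneous:
  assumes "x \<in> \<A> m"
  shows "comp x n = (if n = m then x else 0)"
proof -
  have "comp x = (\<lambda>n. if n = m then x else 0)"
    by (rule comp_eqI[where I = "{m}"]) (use assms subspace_0[OF subspace_component] in auto)
  then show ?thesis by simp
qed

lemma comp_add: "comp (x + y) m = comp x m + comp y m"
proof -
  let ?I = "{m. comp x m \<noteq> 0} \<union> {m. comp y m \<noteq> 0}"
  have "x + y = (\<Sum>m\<in>?I. comp x m) + (\<Sum>m\<in>?I. comp y m)"
    using comp_sum[of ?I x] comp_sum[of ?I y] finite_comp by simp
  then have "comp (x + y) = (\<lambda>m. comp x m + comp y m)"
    by (intro comp_eqI[where I = ?I])
      (auto simp: finite_comp sum.distrib intro: subspace_add[OF subspace_component] comp_component)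
  then show ?thesis by simp
qed

lemma comp_scale: "comp (c *s x) m = c *s comp x m"
proof -
  have "c *s x = (\<Sum>m | comp x m \<noteq> 0. c *s comp x m)"
    unfolding scale_sum_right[symmetric] sum_comp[symmetric] ..
  then have "comp (c *s x) = (\<lambda>m. c *s comp x m)"
    by (intro comp_eqI[where I = "{m. comp x m \<noteq> 0}"])
      (auto simp: finite_comp intro: subspace_scale[OF subspace_component] comp_component)
  then show ?thesis by simp
qed

lemma D_superset:
  assumes "finite I" "{m. comp x m \<noteq> 0} \<subseteq> I"
  shows "D x = (\<Sum>m\<in>I. of_nat m *s comp x m)"
  unfolding weight_derivation_def
  by (rule sum.mono_neutral_left) (use assms in auto)

lemma D_add: "D (x + y) = D x + D y"
proof -
  let ?I = "{m. comp x m \<noteq> 0} \<union> {m. comp y m \<noteq> 0} \<union> {m. comp (x + y) m \<noteq> 0}"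
  have "finite ?I" by (simp add: finite_comp)
  then show ?thesis
    using D_superset[of ?I x] D_superset[of ?I y] D_superset[of ?I "x + y"]
    by (simp add: comp_add scale_right_distrib sum.distrib Un_assoc subset_iff)
qed

lemma D_scale: "D (c *s x) = c *s D x"
proof -
  have "D (c *s x) = (\<Sum>m | comp x m \<noteq> 0. of_nat m *s comp (c *s x) m)"
    by (rule D_superset) (auto simp: finite_comp comp_scale)
  then show ?thesis
    by (simp add: weight_derivation_def comp_scale scale_sum_right mult.commute)
qed

lemma D_sum: "D (sum f I) = (\<Sum>i\<in>I. D (f i))"
proof -
  have "D 0 = 0" using D_scale[of 0 0] by simp
  then show ?thesis by (induction I rule: infinite_finite_induct) (simp_all add: D_add)
qed

lemma D_mult: "D (x * y) = D x * y + x * D y"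
proof -
  let ?I = "{m. comp x m \<noteq> 0}" and ?J = "{m. comp y m \<noteq> 0}"
  have xy: "x * y = (\<Sum>i\<in>?I. \<Sum>j\<in>?J. comp x i * comp y j)"
    by (subst (1) sum_comp[of x], subst (1) sum_comp[of y]) (simp add: sum_product)
  have D: "D (comp x i * comp y j) = D (comp x i) * comp y j + comp x i * D (comp y j)" for i j
    using weight_derivation_homogeneous[OF comp_component, of x i]
      weight_derivation_homogeneous[OF comp_component, of y j]
      weight_derivation_homogeneous[OF mult_component[OF comp_component comp_component], of x i y j]
    by (simp add: scale_mult_left scale_mult_right scale_left_distrib)
  have Dx: "D z = (\<Sum>i | comp z i \<noteq> 0. D (comp z i))" for z
    unfolding weight_derivation_def[of _ _ z]
    by (rule sum.cong[OF refl]) (rule weight_derivation_homogeneous[OF comp_component, symmetric])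
  have "D (x * y) = (\<Sum>i\<in>?I. \<Sum>j\<in>?J. D (comp x i) * comp y j) + (\<Sum>i\<in>?I. \<Sum>j\<in>?J. comp x i * D (comp y j))"
    unfolding xy by (simp add: D_sum D sum.distrib)
  also have "\<dots> = D x * y + x * D y"
    unfolding sum_product[symmetric] Dx[symmetric] sum_comp[symmetric] ..
  finally show ?thesis .
qed

lemma D_one: "D 1 = 0"
  using weight_derivation_homogeneous[OF one_component] by simp

section \<open>The multilinearity relations and the word operators\<close>

abbreviation R :: "nat \<Rightarrow> ('k, 'a) words set" where "R \<equiv> hoch_relations scale"

lemma subspace_R: "words.subspace (R p)"
  unfolding hoch_relations_def by (rule words.subspace_span)

lemma R_word_space: "R p \<subseteq> word_space p"
  unfolding hoch_relations_def
proof (rule words.span_minimal[OF _ subspace_word_space], rule subsetI)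
  fix x assume "x \<in> multilinear_relators scale p"
  then show "x \<in> word_space p"
  proof cases
    case (add_relator us vs x y)
    then show ?thesis
      unfolding add_relator(1) by (intro words.subspace_diff[OF subspace_word_space]
        words.subspace_add[OF subspace_word_space] single_word_space) auto
  next
    case (scale_relator us vs c x)
    then show ?thesis
      unfolding scale_relator(1) by (intro words.subspace_diff[OF subspace_word_space]
        words.subspace_scale[OF subspace_word_space] single_word_space) auto
  qed
qed

text \<open>If each slot is carried to one slot by a linear map \<open>\<phi>\<close>, and the other
  entries do not depend on the entry of that slot, then relators go to multiples of relators. The
  coefficient has to be constant because a relator involves several words of the same
  length.\<close>

lemma word_op_R:
  assumes c: "\<And>l. length l = Suc p \<Longrightarrow> c l = cc"
    and g: "\<And>us vs. length us + length vs = p \<Longrightarrow>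
      \<exists>us' vs' \<phi>. length us' + length vs' = q \<and> (\<forall>x y. \<phi> (x + y) = \<phi> x + \<phi> y) \<and>
        (\<forall>a x. \<phi> (a *s x) = a *s \<phi> x) \<and> (\<forall>x. g (us @ x # vs) = us' @ \<phi> x # vs')"
    and x: "x \<in> R p"
  shows "word_op c g x \<in> R q"
proof -
  interpret f: Vector_Spaces.linear words_scale words_scale "word_op c g" by (rule linear_word_op)
  have "word_op c g ` multilinear_relators scale p \<subseteq> R q"
  proof clarify
    fix r assume "r \<in> multilinear_relators scale p"
    then show "word_op c g r \<in> R q"
    proof cases
      case (add_relator us vs x y)
      obtain us' vs' \<phi> where g': "length us' + length vs' = q" "\<And>x y. \<phi> (x + y) = \<phi> x + \<phi> y"
        "\<And>x. g (us @ x # vs) = us' @ \<phi> x # vs'" using g[OF add_relator(2)] by blast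
      let ?r = "Poly_Mapping.single (us' @ (\<phi> x + \<phi> y) # vs') 1 -
        (Poly_Mapping.single (us' @ \<phi> x # vs') 1 + Poly_Mapping.single (us' @ \<phi> y # vs') (1 :: 'k))"
      have "word_op c g r = words_scale cc ?r"
        using add_relator by (simp add: f.diff f.add c g' words.scale_right_diff_distrib words.scale_right_distrib)
      moreover have "?r \<in> multilinear_relators scale q"
        by (rule multilinear_relators.add_relator[OF g'(1)])
      ultimately show ?thesis
        unfolding hoch_relations_def by (metis words.span_base words.span_scale)
    next
      case (scale_relator us vs a x)
      obtain us' vs' \<phi> where g': "length us' + length vs' = q" "\<And>a x. \<phi> (a *s x) = a *s \<phi> x"
        "\<And>x. g (us @ x # vs) = us' @ \<phi> x # vs'" using g[OF scale_relator(2)] by blast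
      let ?r = "Poly_Mapping.single (us' @ (a *s \<phi> x) # vs') 1 -
        words_scale a (Poly_Mapping.single (us' @ \<phi> x # vs') (1 :: 'k))"
      have "word_op c g r = words_scale cc ?r"
        using scale_relator by (simp add: f.diff f.scale c g' words.scale_right_diff_distrib mult.commute)
      moreover have "?r \<in> multilinear_relators scale q"
        by (rule multilinear_relators.scale_relator[OF g'(1)])
      ultimately show ?thesis
        unfolding hoch_relations_def by (metis words.span_base words.span_scale)
    qed
  qed
  then show ?thesis
    using words_span_image[OF linear_word_op subspace_R] x unfolding hoch_relations_def by blast
qed

lemma word_t_R: "x \<in> R p \<Longrightarrow> word_t x \<in> R p"
  unfolding word_t_def
proof (rule word_op_R[where cc = "(-1) ^ p"])
  fix us vs :: "'a list" assume len: "length us + length vs = p"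
  show "\<exists>us' vs' \<phi>. length us' + length vs' = p \<and> (\<forall>x y. \<phi> (x + y) = \<phi> x + \<phi> y) \<and>
      (\<forall>a x. \<phi> (a *s x) = a *s \<phi> x) \<and> (\<forall>x. rot (us @ x # vs) = us' @ \<phi> x # vs')"
  proof (cases "vs = []")
    case True
    then show ?thesis
      using len by (intro exI[of _ "[]"] exI[of _ us] exI[of _ "\<lambda>x. x"]) (simp add: rot_append)
  next
    case False
    then have "Suc (length us) + length (butlast vs) = p" using len by (cases vs) auto
    then show ?thesis
      using False by (intro exI[of _ "last vs # us"] exI[of _ "butlast vs"] exI[of _ "\<lambda>x. x"])
        (simp add: rot_append)
  qed
qed auto

lemma word_s_R: "x \<in> R p \<Longrightarrow> word_s x \<in> R (Suc p)"
  unfolding word_s_def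
proof (rule word_op_R[where cc = 1])
  fix us vs :: "'a list" assume len: "length us + length vs = p"
  show "\<exists>us' vs' \<phi>. length us' + length vs' = Suc p \<and> (\<forall>x y. \<phi> (x + y) = \<phi> x + \<phi> y) \<and>
      (\<forall>a x. \<phi> (a *s x) = a *s \<phi> x) \<and> (\<forall>x. 1 # us @ x # vs = us' @ \<phi> x # vs')"
    using len by (intro exI[of _ "1 # us"] exI[of _ vs] exI[of _ "\<lambda>x. x"]) simp
qed auto

lemma word_d_0_R: "x \<in> R (Suc p) \<Longrightarrow> word_d 0 x \<in> R p"
  unfolding word_d_def
proof (rule word_op_R[where cc = 1])
  fix us vs :: "'a list" assume len: "length us + length vs = Suc p"
  show "\<exists>us' vs' \<phi>. length us' + length vs' = p \<and> (\<forall>x y. \<phi> (x + y) = \<phi> x + \<phi> y) \<and>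
      (\<forall>a x. \<phi> (a *s x) = a *s \<phi> x) \<and> (\<forall>x. merge 0 (us @ x # vs) = us' @ \<phi> x # vs')"
  proof (cases us)
    case Nil
    then obtain v vs' where "vs = v # vs'" using len by (cases vs) auto
    then show ?thesis
      using Nil len by (intro exI[of _ "[]"] exI[of _ vs'] exI[of _ "\<lambda>x. x * v"])
        (simp add: merge_0 distrib_right scale_mult_left)
  next
    case (Cons u us1)
    show ?thesis
    proof (cases us1)
      case Nil
      then show ?thesis
        using Cons len by (intro exI[of _ "[]"] exI[of _ vs] exI[of _ "\<lambda>x. u * x"])
          (simp add: merge_0 distrib_left scale_mult_right)
    next
      case (Cons w us2)
      then show ?thesis
        using \<open>us = u # us1\<close> len
        by (intro exI[of _ "(u * w) # us2"] exI[of _ vs] exI[of _ "\<lambda>x. x"]) (simp add: merge_0)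
    qed
  qed
qed auto

lemma word_\<delta>_0_R: "x \<in> R p \<Longrightarrow> word_\<delta> D 0 x \<in> R p"
  unfolding word_\<delta>_def
proof (rule word_op_R[where cc = 1])
  fix us vs :: "'a list" assume len: "length us + length vs = p"
  show "\<exists>us' vs' \<phi>. length us' + length vs' = p \<and> (\<forall>x y. \<phi> (x + y) = \<phi> x + \<phi> y) \<and>
      (\<forall>a x. \<phi> (a *s x) = a *s \<phi> x) \<and>
      (\<forall>x. (us @ x # vs)[0 := D ((us @ x # vs) ! 0)] = us' @ \<phi> x # vs')"
  proof (cases us)
    case Nil
    then show ?thesis
      using len by (intro exI[of _ "[]"] exI[of _ vs] exI[of _ D]) (simp add: D_add D_scale)
  next
    case (Cons u us')
    then show ?thesis
      using len by (intro exI[of _ "D u # us'"] exI[of _ vs] exI[of _ "\<lambda>x. x"]) simp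
  qed
qed auto

lemma funpow_word_t_single:
  "(word_t ^^ r) (Poly_Mapping.single l a) = Poly_Mapping.single ((rot ^^ r) l) (a * (-1) ^ (r * (length l - 1)))"
proof (induction r)
  case (Suc r)
  have "length ((rot ^^ r) l) = length l" by (induction r) auto
  then show ?case using Suc by (simp add: power_add mult_ac)
qed simp

lemma linear_funpow:
  fixes f :: "('c::field, 'd) words \<Rightarrow> ('c, 'd) words"
  assumes "lin f"
  shows "lin (f ^^ r)"
proof -
  interpret f: Vector_Spaces.linear words_scale words_scale f by fact
  have "(f ^^ r) (x + y) = (f ^^ r) x + (f ^^ r) y" for x y
    by (induction r) (simp_all add: f.add)
  moreover have "(f ^^ r) (words_scale c x) = words_scale c ((f ^^ r) x)" for c x
    by (induction r) (simp_all add: f.scale)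
  ultimately show ?thesis by unfold_locales
qed

text \<open>The three words agree outside slot \<open>k\<close>, and by
  \<open>D (x y) = D x y + x D y\<close> the expression is the negative of an additivity
  relator.\<close>

lemma derivation_relation:
  assumes l: "length l = Suc (Suc p)" and k: "k \<le> p"
  shows "Poly_Mapping.single (merge k (l[k := D (l ! k)])) 1 +
      Poly_Mapping.single (merge k (l[Suc k := D (l ! Suc k)])) 1 -
      Poly_Mapping.single ((merge k l)[k := D (merge k l ! k)]) (1 :: 'k) \<in> R p"
proof -
  define us vs where "us = take k l" and "vs = drop (Suc (Suc k)) l"
  let ?x = "D (l ! k) * l ! Suc k" and ?y = "l ! k * D (l ! Suc k)"
  have "merge k (l[k := D (l ! k)]) = us @ ?x # vs"
    "merge k (l[Suc k := D (l ! Suc k)]) = us @ ?y # vs"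
    "(merge k l)[k := D (merge k l ! k)] = us @ (?x + ?y) # vs"
    unfolding us_def vs_def using l k
    by (auto intro!: nth_equalityI simp: nth_merge nth_append nth_Cons' nth_list_update min_def D_mult)
  moreover have "Poly_Mapping.single (us @ (?x + ?y) # vs) 1 -
      (Poly_Mapping.single (us @ ?x # vs) 1 + Poly_Mapping.single (us @ ?y # vs) (1 :: 'k)) \<in> R p"
    unfolding hoch_relations_def
    by (rule words.span_base, rule multilinear_relators.add_relator) (use l k in \<open>auto simp: us_def vs_def\<close>)
  ultimately show ?thesis
    using words.subspace_neg[OF subspace_R] by fastforce
qed

section \<open>The Hochschild operators\<close>

text \<open>The operator identities are compared on single words, where they become identities of
  lists. With the signs built into \<open>word_t\<close> and \<open>word_d\<close>, rotation and
  faces commute without further signs.\<close>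

sublocale cyc: cyclic_derivation word_space R word_t word_s word_d "word_\<delta> D"
proof
  fix p j k :: nat and x y :: "('k, 'a) words"
  note WS = subspace_word_space and RS = subspace_R
  show "word_t (x + y) = word_t x + word_t y" "word_s (x + y) = word_s x + word_s y"
    "word_d k (x + y) = word_d k x + word_d k y" "word_\<delta> D j (x + y) = word_\<delta> D j x + word_\<delta> D j y"
    by (rule additive.add[OF linear_additive] linear_word_ops)+
  show "(0 :: ('k, 'a) words) \<in> word_space p" by (rule words.subspace_0[OF WS])
  show "0 \<in> R p" by (rule words.subspace_0[OF RS])
  show "x \<in> word_space p \<Longrightarrow> y \<in> word_space p \<Longrightarrow> x + y \<in> word_space p" by (rule words.subspace_add[OF WS])
  show "x \<in> word_space p \<Longrightarrow> - x \<in> word_space p" by (rule words.subspace_neg[OF WS])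
  show "x \<in> R p \<Longrightarrow> y \<in> R p \<Longrightarrow> x + y \<in> R p" by (rule words.subspace_add[OF RS])
  show "x \<in> R p \<Longrightarrow> - x \<in> R p" by (rule words.subspace_neg[OF RS])
  show "R p \<subseteq> word_space p" by (rule R_word_space)
  show "word_t x \<in> word_space p" if "x \<in> word_space p"
    unfolding word_t_def by (rule word_op_word_space[OF that]) simp
  show "word_s x \<in> word_space (Suc p)" if "x \<in> word_space p"
    unfolding word_s_def by (rule word_op_word_space[OF that]) simp
  show "word_d k x \<in> word_space p" if "x \<in> word_space (Suc p)"
    unfolding word_d_def by (rule word_op_word_space[OF that]) simp
  show "word_\<delta> D j x \<in> word_space p" if "x \<in> word_space p"
    unfolding word_\<delta>_def by (rule word_op_word_space[OF that]) simp
  show "x \<in> R p \<Longrightarrow> word_t x \<in> R p" by (rule word_t_R)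
  show "x \<in> R p \<Longrightarrow> word_s x \<in> R (Suc p)" by (rule word_s_R)
  show "x \<in> R (Suc p) \<Longrightarrow> word_d 0 x \<in> R p" by (rule word_d_0_R)
  show "x \<in> R p \<Longrightarrow> word_\<delta> D 0 x \<in> R p" by (rule word_\<delta>_0_R)
  show "word_d (Suc k) (word_t x) = word_t (word_d k x)" if "x \<in> word_space (Suc p)" "k \<le> p"
    by (rule linear_eq[OF lin_comp[OF lin_d lin_t] lin_comp[OF lin_t lin_d] that(1)])
      (simp add: merge_Suc_rot[OF _ that(2)] mult.commute)
  show "word_d 0 (word_t x) = word_d (Suc p) x" if "x \<in> word_space (Suc p)"
    by (rule linear_eq[OF lin_comp[OF lin_d lin_t] lin_d that]) (simp add: merge_0_rot)
  show "(word_t ^^ Suc p) x = x" if "x \<in> word_space p"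
  proof (rule linear_eq[OF linear_funpow[OF lin_t] lin_id that])
    fix l :: "'a list" assume l: "length l = Suc p"
    have "even (Suc p * p)" by simp
    then have "(-1 :: 'k) ^ (Suc p * (length l - 1)) = 1" unfolding l by (simp only: diff_Suc_1 neg_one_even_power)
    then show "(word_t ^^ Suc p) (Poly_Mapping.single l 1) = Poly_Mapping.single l (1 :: 'k)"
      unfolding funpow_word_t_single using rot_cycle[of l] unfolding l by (simp only: mult_1)
  qed
  show "word_\<delta> D (Suc j) (word_t x) = word_t (word_\<delta> D j x)" if "x \<in> word_space p" "j < p"
    by (rule linear_eq[OF lin_comp[OF lin_\<delta> lin_t] lin_comp[OF lin_t lin_\<delta>] that(1)])
      (use that(2) in \<open>simp add: nth_rot rot_update_Suc\<close>)
  show "word_\<delta> D 0 (word_t x) = word_t (word_\<delta> D p x)" if "x \<in> word_space p"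
    by (rule linear_eq[OF lin_comp[OF lin_\<delta> lin_t] lin_comp[OF lin_t lin_\<delta>] that(1)])
      (simp add: nth_rot rot_update_0)
  show "word_\<delta> D k (word_\<delta> D j x) = word_\<delta> D j (word_\<delta> D k x)" if "x \<in> word_space p" "k \<le> p" "j \<le> p"
    by (cases "k = j", simp, rule linear_eq[OF lin_comp[OF lin_\<delta> lin_\<delta>] lin_comp[OF lin_\<delta> lin_\<delta>] that(1)])
      (simp add: list_update_swap)
  show "word_d k (word_\<delta> D j x) = word_\<delta> D j (word_d k x)" if "x \<in> word_space (Suc p)" "j < k" "k \<le> p"
    by (rule linear_eq[OF lin_comp[OF lin_d lin_\<delta>] lin_comp[OF lin_\<delta> lin_d] that(1)])
      (use that in \<open>simp add: merge_update_less nth_merge\<close>)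
  show "word_d k (word_\<delta> D (Suc j) x) = word_\<delta> D j (word_d k x)" if "x \<in> word_space (Suc p)" "k < j" "j \<le> p"
    by (rule linear_eq[OF lin_comp[OF lin_d lin_\<delta>] lin_comp[OF lin_\<delta> lin_d] that(1)])
      (use that in \<open>simp add: merge_update_greater nth_merge\<close>)
  show "word_d (Suc p) (word_\<delta> D j x) = word_\<delta> D j (word_d (Suc p) x)"
    if "x \<in> word_space (Suc p)" "0 < j" "j \<le> p"
    by (rule linear_eq[OF lin_comp[OF lin_d lin_\<delta>] lin_comp[OF lin_\<delta> lin_d] that(1)])
      (use that in \<open>simp add: merge_update_last nth_merge\<close>)
  show "word_d k (word_\<delta> D k x) + word_d k (word_\<delta> D (Suc k) x) - word_\<delta> D k (word_d k x) \<in> R p"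
    if "x \<in> word_space (Suc p)" "k \<le> p"
  proof (rule linear_in_subspace[OF lin_diff[OF lin_add[OF lin_comp[OF lin_d lin_\<delta>] lin_comp[OF lin_d lin_\<delta>]] lin_comp[OF lin_\<delta> lin_d]] RS that(1)])
    fix l :: "'a list" assume l: "length l = Suc (Suc p)"
    have "word_d k (word_\<delta> D k (Poly_Mapping.single l 1)) + word_d k (word_\<delta> D (Suc k) (Poly_Mapping.single l 1)) -
        word_\<delta> D k (word_d k (Poly_Mapping.single l (1 :: 'k))) =
      words_scale ((-1) ^ k) (Poly_Mapping.single (merge k (l[k := D (l ! k)])) 1 +
      Poly_Mapping.single (merge k (l[Suc k := D (l ! Suc k)])) 1 -
      Poly_Mapping.single ((merge k l)[k := D (merge k l ! k)]) 1)"
      by (simp add: words.scale_right_distrib words.scale_right_diff_distrib)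
    then show "word_d k (word_\<delta> D k (Poly_Mapping.single l 1)) + word_d k (word_\<delta> D (Suc k) (Poly_Mapping.single l 1)) -
        word_\<delta> D k (word_d k (Poly_Mapping.single l (1 :: 'k))) \<in> R p"
      using words.subspace_scale[OF RS derivation_relation[OF l that(2)]] by simp
  qed
  show "word_d j (word_d (Suc k) x) = - word_d k (word_d j x)"
    if "x \<in> word_space (Suc (Suc p))" "j \<le> k" "k \<le> Suc p"
    by (rule linear_eq[OF lin_comp[OF lin_d lin_d] lin_minus[OF lin_comp[OF lin_d lin_d]] that(1)])
      (simp add: merge_merge[OF _ that(2,3)] single_uminus[symmetric] mult.commute)
  show "word_d 0 (word_s x) = x" if "x \<in> word_space p"
    by (rule linear_eq[OF lin_comp[OF lin_d lin_s] lin_id that]) (simp add: merge_0_Cons_one)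
  show "word_d (Suc k) (word_s x) = - word_s (word_d k x)" if "x \<in> word_space (Suc p)" "k \<le> p"
    by (rule linear_eq[OF lin_comp[OF lin_d lin_s] lin_minus[OF lin_comp[OF lin_s lin_d]] that(1)])
      (use that(2) in \<open>simp add: merge_Suc_Cons single_uminus[symmetric]\<close>)
  show "word_d (Suc p) (word_s x) = - word_t x" if "x \<in> word_space p"
    by (rule linear_eq[OF lin_comp[OF lin_d lin_s] lin_minus[OF lin_t] that])
      (simp add: merge_last_Cons_one single_uminus[symmetric])
  show "word_\<delta> D (Suc j) (word_s x) = word_s (word_\<delta> D j x)" if "x \<in> word_space p" "j \<le> p"
    by (rule linear_eq[OF lin_comp[OF lin_\<delta> lin_s] lin_comp[OF lin_s lin_\<delta>] that(1)]) simp
qed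

abbreviation bw :: "('k, 'a) words \<Rightarrow> ('k, 'a) words" where "bw \<equiv> words_extend b_word"
abbreviation ew :: "('k, 'a) words \<Rightarrow> ('k, 'a) words" where "ew \<equiv> words_extend (eD_word D)"
abbreviation Bw :: "('k, 'a) words \<Rightarrow> ('k, 'a) words" where "Bw \<equiv> words_extend B_word"

lemma lin_cyc:
  shows lin_b: "lin (cyc.b p)" and lin_e: "lin (cyc.e p)" and lin_B: "lin (cyc.B p)"
    and lin_L: "lin (cyc.L_from p i)" and lin_E: "lin (cyc.E p)"
proof -
  have zero: "lin (\<lambda>x. 0)" by unfold_locales simp_all
  show "lin (cyc.b p)"
    using zero lin_sum[of "{..p}" word_d, OF lin_d] by (cases "p = 0") (simp_all add: cyc.b_def[abs_def])
  show "lin (cyc.e p)"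
    using zero lin_minus[OF lin_comp[OF lin_d[of p] lin_\<delta>[of D p]]] by (cases "p = 0") (simp_all add: cyc.e_def[abs_def])
  show L: "lin (cyc.L_from p i)" for i
    unfolding cyc.L_from_def[abs_def] by (rule lin_sum) (rule lin_\<delta>)
  show "lin (cyc.B p)"
    unfolding cyc.B_def[abs_def] cyc.N_def by (rule lin_comp[OF lin_s lin_sum]) (rule linear_funpow[OF lin_t])
  show "lin (cyc.E p)"
    unfolding cyc.E_def[abs_def] cyc.F_def
    by (rule lin_minus, rule lin_comp[OF lin_s lin_sum]) (rule lin_comp[OF linear_funpow[OF lin_t] L])
qed

text \<open>\<open>b_word\<close> reads the degree off the length of a word, whereas
  \<open>cyc.b\<close> takes it as an index; this and the next two lemmas pass between the two
  styles on words of one fixed length.\<close>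

lemma bw_eq: "x \<in> word_space p \<Longrightarrow> bw x = cyc.b p x"
proof (rule linear_eq[OF linear_words_extend lin_b])
  fix l :: "'a list" assume l: "length l = Suc p"
  show "bw (Poly_Mapping.single l 1) = cyc.b p (Poly_Mapping.single l 1)"
  proof (cases p)
    case 0
    then show ?thesis using l by (simp add: cyc.b_def b_word_def)
  next
    case (Suc q)
    have "b_word l = (\<Sum>k<Suc q. Poly_Mapping.single (merge k l) ((-1) ^ k)) +
        Poly_Mapping.single (merge (Suc q) l) ((-1 :: 'k) ^ Suc q)"
      unfolding b_word_def Let_def using l
      by (simp add: Suc merge_take_drop merge_last del: sum.lessThan_Suc)
    then show ?thesis by (simp add: Suc cyc.b_def lessThan_Suc_atMost)
  qed
qed

lemma ew_eq: "x \<in> word_space p \<Longrightarrow> ew x = cyc.e p x"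
proof (rule linear_eq[OF linear_words_extend lin_e])
  fix l :: "'a list" assume l: "length l = Suc p"
  show "ew (Poly_Mapping.single l 1) = cyc.e p (Poly_Mapping.single l 1)"
  proof (cases p)
    case 0
    then show ?thesis using l by (simp add: cyc.e_def eD_word_def)
  next
    case (Suc q)
    have "butlast (l[Suc q := y]) = butlast l" for y
      using l Suc by (intro nth_equalityI) (auto simp: nth_butlast)
    then show ?thesis
      using l by (simp add: Suc cyc.e_def eD_word_def merge_last single_uminus[symmetric])
  qed
qed

lemma Bw_eq: "x \<in> word_space p \<Longrightarrow> Bw x = cyc.B p x"
proof (rule linear_eq[OF linear_words_extend lin_B])
  fix l :: "'a list" assume l: "length l = Suc p"
  have "cyc.B p (Poly_Mapping.single l 1) =
      (\<Sum>i\<le>p. Poly_Mapping.single (1 # (rot ^^ i) l) ((-1) ^ (i * p)))"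
    unfolding cyc.B_def cyc.N_def cyc.s.sum funpow_word_t_single by (simp add: l)
  also have "\<dots> = B_word l"
    unfolding B_word_def Let_def using l by (intro sum.cong) (auto simp: funpow_rot mult.commute)
  finally show "Bw (Poly_Mapping.single l 1) = cyc.B p (Poly_Mapping.single l 1)" by simp
qed

section \<open>The normalized complex\<close>

abbreviation R' :: "nat \<Rightarrow> ('k, 'a) words set" where "R' \<equiv> normalized_relations scale"

lemma subspace_R': "words.subspace (R' p)"
  unfolding normalized_relations_def by (rule words.subspace_span)

lemma R_R': "x \<in> R p \<Longrightarrow> x \<in> R' p"
  unfolding hoch_relations_def normalized_relations_def using words.span_mono[of _ "_ \<union> _"] by blast

lemma R'_0: "R' 0 = R 0"
  unfolding hoch_relations_def normalized_relations_def by (simp add: degenerate_words_def)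

lemma degenerate_R':
  assumes "length l = Suc p" "0 < q" "q < length l" "l ! q = 1"
  shows "Poly_Mapping.single l a \<in> R' p"
proof -
  obtain p' where p: "p = Suc p'" using assms by (cases p) auto
  have "Poly_Mapping.single l 1 \<in> R' p"
    unfolding normalized_relations_def p
    by (intro words.span_base UnI2 Cons_one_degenerate[OF _ assms(2-4)]) (use assms(1) p in simp)
  from words.subspace_scale[OF subspace_R' this, of a] show ?thesis by simp
qed

lemma Cons_one_R':
  assumes "length l = Suc p" "1 \<in> set l"
  shows "Poly_Mapping.single (1 # l) a \<in> R' (Suc p)"
proof -
  obtain q where "q < length l" "l ! q = 1" using assms(2) by (auto simp: in_set_conv_nth)
  then show ?thesis using assms(1) by (intro degenerate_R'[of _ _ "Suc q"]) auto
qed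

lemma R'_word_space: "R' p \<subseteq> word_space p"
proof -
  have "multilinear_relators scale p \<subseteq> word_space p"
    using R_word_space[of p] words.span_superset unfolding hoch_relations_def by blast
  moreover have "degenerate_words p \<subseteq> word_space p"
    by (auto simp: degenerate_words_def single_word_space)
  ultimately show ?thesis
    unfolding normalized_relations_def by (intro words.span_minimal subspace_word_space) auto
qed

text \<open>The scaling relator with scalar 0 and entry 0 is the word itself.\<close>

lemma zero_entry_R:
  assumes "length l = Suc p" "q < length l" "l ! q = 0"
  shows "Poly_Mapping.single l a \<in> R p"
proof -
  have "l = take q l @ (0 *s 0) # drop (Suc q) l" using id_take_nth_drop[OF assms(2)] assms(3) by simp
  moreover have "Poly_Mapping.single (take q l @ (0 *s 0) # drop (Suc q) l) 1 -
      words_scale 0 (Poly_Mapping.single (take q l @ 0 # drop (Suc q) l) 1) \<in> R p"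
    unfolding hoch_relations_def using assms
    by (intro words.span_base multilinear_relators.scale_relator) auto
  ultimately have "Poly_Mapping.single l 1 \<in> R p" by simp
  from words.subspace_scale[OF subspace_R this, of a] show ?thesis by simp
qed

lemma lin_R':
  assumes f: "lin f" and R: "\<And>x. x \<in> R p \<Longrightarrow> f x \<in> R q"
    and deg: "\<And>l i. length l = Suc p \<Longrightarrow> 0 < i \<Longrightarrow> i \<le> p \<Longrightarrow> l ! i = 1 \<Longrightarrow> f (Poly_Mapping.single l 1) \<in> R' q"
    and x: "x \<in> R' p"
  shows "f x \<in> R' q"
proof (rule words_span_image[OF f subspace_R' _ x[unfolded normalized_relations_def]])
  have "f x \<in> R' q" if "x \<in> multilinear_relators scale p" for x
    using that R_R' R words.span_base unfolding hoch_relations_def by blast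
  moreover have "f x \<in> R' q" if deg_x: "x \<in> degenerate_words p" for x
  proof -
    obtain a us vs where x: "x = Poly_Mapping.single (a # us @ 1 # vs) 1" "Suc (length us + length vs) = p"
      using deg_x by (auto simp: degenerate_words_def)
    then show ?thesis using deg[of "a # us @ 1 # vs" "Suc (length us)"] by (auto simp: nth_append)
  qed
  ultimately show "f ` (multilinear_relators scale p \<union> degenerate_words p) \<subseteq> R' q" by blast
qed

text \<open>Because \<open>D 1 = 0\<close>, differentiating the degenerate slot creates a zero
  entry, hence a multilinearity relation; differentiating any other slot leaves the 1 in
  place.\<close>

lemma \<delta>_degenerate:
  assumes l: "length l = Suc p" "0 < i" "i \<le> p" "l ! i = 1"
  shows "j = i \<Longrightarrow> word_\<delta> D j (Poly_Mapping.single l a) \<in> R p"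
    and "j \<noteq> i \<Longrightarrow> l[j := y] ! i = 1"
  using l by (auto simp: D_one intro!: zero_entry_R[of _ _ i])

text \<open>The 1 in slot \<open>i\<close> is absorbed by the faces \<open>i - 1\<close> and
  \<open>i\<close>, which give the same word with opposite signs. Every other face leaves a 1
  outside slot 0.\<close>

lemma b_R': "x \<in> R' (Suc p) \<Longrightarrow> cyc.b (Suc p) x \<in> R' p"
proof (rule lin_R'[OF lin_b cyc.b_R])
  fix l :: "'a list" and i
  assume l: "length l = Suc (Suc p)" "0 < i" "i \<le> Suc p" "l ! i = 1"
  let ?m = "\<lambda>k. Poly_Mapping.single (merge k l) ((-1 :: 'k) ^ k)"
  have eq: "merge (i - 1) l = merge i l"
    using l by (intro nth_equalityI) (auto simp: nth_merge nth_eq_iff_index_eq not_less le_Suc_eq dest: le_antisym)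
  have "{..Suc p} = insert (i - 1) (insert i ({..Suc p} - {i - 1, i}))" using l by auto
  then have "cyc.b (Suc p) (Poly_Mapping.single l 1) = (\<Sum>k\<in>insert (i - 1) (insert i ({..Suc p} - {i - 1, i})). ?m k)"
    by (simp add: cyc.b_def del: sum.atMost_Suc)
  also have "\<dots> = ?m (i - 1) + (?m i + (\<Sum>k\<in>{..Suc p} - {i - 1, i}. ?m k))"
    using l by (subst sum.insert; (subst sum.insert)?; auto)
  also have "?m (i - 1) + (?m i + (\<Sum>k\<in>{..Suc p} - {i - 1, i}. ?m k)) = (\<Sum>k\<in>{..Suc p} - {i - 1, i}. ?m k)"
    unfolding eq add.assoc[symmetric] single_add[symmetric] using l(2) by (cases i) auto
  also have "\<dots> \<in> R' p"
  proof (rule words.subspace_sum[OF subspace_R'])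
    fix k assume k: "k \<in> {..Suc p} - {i - 1, i}"
    show "?m k \<in> R' p"
    proof (cases "k < i")
      case True
      then show ?thesis using k l by (intro degenerate_R'[of _ _ "i - 1"]) (auto simp: nth_merge)
    next
      case False
      then show ?thesis using k l by (intro degenerate_R'[of _ _ i]) (auto simp: nth_merge)
    qed
  qed
  finally show "cyc.b (Suc p) (Poly_Mapping.single l 1) \<in> R' p" .
qed

lemma e_R': "x \<in> R' (Suc p) \<Longrightarrow> cyc.e (Suc p) x \<in> R' p"
proof (rule lin_R'[OF lin_e cyc.e_R])
  fix l :: "'a list" and i
  assume l: "length l = Suc (Suc p)" "0 < i" "i \<le> Suc p" "l ! i = 1"
  show "cyc.e (Suc p) (Poly_Mapping.single l 1) \<in> R' p"
  proof (cases "i = Suc p")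
    case True
    then have "word_d (Suc p) (word_\<delta> D (Suc p) (Poly_Mapping.single l (1 :: 'k))) \<in> R p"
      using \<delta>_degenerate(1)[OF l, of "Suc p"] by (intro cyc.d_R) auto
    then show ?thesis
      unfolding cyc.e_def using words.subspace_neg[OF subspace_R'] R_R' by simp
  next
    case False
    then have "word_d (Suc p) (word_\<delta> D (Suc p) (Poly_Mapping.single l (1 :: 'k))) \<in> R' p"
      using l unfolding word_ops_single by (intro degenerate_R'[of _ _ i]) (auto simp: nth_merge)
    then show ?thesis
      unfolding cyc.e_def using words.subspace_neg[OF subspace_R'] by simp
  qed
qed

text \<open>The new 1 in front pushes every old 1 out of slot 0, even one that started there.
  Therefore \<open>B\<close> is degenerate on all words beginning with 1, in particular on the
  values of \<open>B\<close>.\<close>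

lemma B_one_in_set:
  assumes "length l = Suc p" "1 \<in> set l"
  shows "cyc.B p (Poly_Mapping.single l a) \<in> R' (Suc p)"
  unfolding cyc.B_def cyc.N_def cyc.s.sum funpow_word_t_single word_ops_single
  using assms by (intro words.subspace_sum[OF subspace_R'] Cons_one_R') auto

lemma B_R': "x \<in> R' p \<Longrightarrow> cyc.B p x \<in> R' (Suc p)"
proof (rule lin_R'[OF lin_B cyc.B_R])
  fix l :: "'a list" and i
  assume l: "length l = Suc p" "0 < i" "i \<le> p" "l ! i = 1"
  then have "1 \<in> set l" by (metis in_set_conv_nth less_Suc_eq_le)
  then show "cyc.B p (Poly_Mapping.single l 1) \<in> R' (Suc p)" by (rule B_one_in_set[OF l(1)])
qed

lemma B_B:
  assumes "x \<in> word_space p"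
  shows "cyc.B (Suc p) (cyc.B p x) \<in> R' (Suc (Suc p))"
proof (rule linear_in_subspace[OF lin_comp[OF lin_B lin_B] subspace_R' assms])
  fix l :: "'a list" assume l: "length l = Suc p"
  have "cyc.B p (Poly_Mapping.single l 1) = (\<Sum>i\<le>p. Poly_Mapping.single (1 # (rot ^^ i) l) (1 * (-1) ^ (i * (length l - 1))))"
    unfolding cyc.B_def cyc.N_def cyc.s.sum funpow_word_t_single word_ops_single ..
  then show "cyc.B (Suc p) (cyc.B p (Poly_Mapping.single l 1)) \<in> R' (Suc (Suc p))"
    using l by (auto simp: cyc.B.sum intro!: words.subspace_sum[OF subspace_R'] B_one_in_set)
qed

lemma E_R': "x \<in> R' p \<Longrightarrow> cyc.E p x \<in> R' (Suc p)"
proof (rule lin_R'[OF lin_E cyc.E_R])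
  fix l :: "'a list" and i
  assume l: "length l = Suc p" "0 < i" "i \<le> p" "l ! i = 1"
  have "word_s ((word_t ^^ r) (word_\<delta> D j (Poly_Mapping.single l (1 :: 'k)))) \<in> R' (Suc p)" for r j
  proof (cases "j = i")
    case True
    then show ?thesis
      using \<delta>_degenerate(1)[OF l True] by (intro R_R' cyc.s_R cyc.tpow_R)
  next
    case False
    have "1 \<in> set (l[j := D (l ! j)])"
      using \<delta>_degenerate(2)[OF l False] l by (metis in_set_conv_nth length_list_update less_Suc_eq_le)
    then show ?thesis
      unfolding word_ops_single funpow_word_t_single using l by (intro Cons_one_R') auto
  qed
  then show "cyc.E p (Poly_Mapping.single l 1) \<in> R' (Suc p)"
    unfolding cyc.E_def cyc.F_def cyc.L_from_def cyc.s.sum cyc.tpow.sum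
    by (intro words.subspace_neg[OF subspace_R'] words.subspace_sum[OF subspace_R'])
qed

lemma L_R': "x \<in> R' p \<Longrightarrow> cyc.L p x \<in> R' p"
proof (rule lin_R'[OF lin_L cyc.L_from_R])
  fix l :: "'a list" and i
  assume l: "length l = Suc p" "0 < i" "i \<le> p" "l ! i = 1"
  have "word_\<delta> D j (Poly_Mapping.single l (1 :: 'k)) \<in> R' p" for j
  proof (cases "j = i")
    case True
    show ?thesis by (rule R_R'[OF \<delta>_degenerate(1)[OF l True]])
  next
    case False
    show ?thesis
      unfolding word_ops_single using \<delta>_degenerate(2)[OF l False] l by (intro degenerate_R'[of _ _ i]) auto
  qed
  then show "cyc.L p (Poly_Mapping.single l 1) \<in> R' p"
    unfolding cyc.L_from_def by (intro words.subspace_sum[OF subspace_R'])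
qed

section \<open>Homogeneous words\<close>

text \<open>The list \<open>w\<close> of weights is existentially quantified because 0 is
  homogeneous of every weight; a word with a zero entry lies in several of these sets.\<close>

definition hom_words :: "nat \<Rightarrow> nat \<Rightarrow> ('k, 'a) words set" where
  "hom_words p m = {Poly_Mapping.single l 1 |l w.
     length l = Suc p \<and> list_all2 (\<lambda>x n. x \<in> \<A> n) l w \<and> sum_list w = m}"

lemma add_R:
  assumes "length us + length vs = p"
  shows "Poly_Mapping.single (us @ (x + y) # vs) 1 -
    (Poly_Mapping.single (us @ x # vs) 1 + Poly_Mapping.single (us @ y # vs) 1) \<in> R p"
  unfolding hoch_relations_def by (intro words.span_base multilinear_relators.add_relator assms)

lemma scale_R:
  assumes "length us + length vs = p"
  shows "Poly_Mapping.single (us @ (c *s x) # vs) 1 - Poly_Mapping.single (us @ x # vs) c \<in> R p"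
  using words.span_base[OF multilinear_relators.scale_relator[OF assms, of scale c x]]
  unfolding hoch_relations_def by simp

lemma sum_R:
  assumes "length us + length vs = p" "finite I"
  shows "Poly_Mapping.single (us @ (\<Sum>i\<in>I. f i) # vs) 1 - (\<Sum>i\<in>I. Poly_Mapping.single (us @ f i # vs) 1) \<in> R p"
  using assms(2)
proof (induction I)
  case empty
  then show ?case using assms(1) by (simp add: zero_entry_R[of _ _ "length us"])
next
  case (insert i I)
  show ?case
    using words.subspace_add[OF subspace_R add_R[OF assms(1), of "f i" "sum f I"] insert(3)] insert(1,2)
    by (simp add: algebra_simps)
qed

text \<open>The entries are replaced by their components from left to right; \<open>us\<close> is
  the part that is already homogeneous.\<close>

lemma word_in_span:
  assumes "list_all2 (\<lambda>x n. x \<in> \<A> n) us w" "length us + length vs = Suc p"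
  shows "Poly_Mapping.single (us @ vs) 1 \<in> words.span ((\<Union>m. hom_words p m) \<union> R p)"
  using assms
proof (induction vs arbitrary: us w)
  case Nil
  then have "Poly_Mapping.single us 1 \<in> hom_words p (sum_list w)" by (auto simp: hom_words_def)
  then show ?case by (intro words.span_base) auto
next
  case (Cons x vs)
  let ?I = "{m. comp x m \<noteq> 0}" and ?S = "words.span ((\<Union>m. hom_words p m) \<union> R p)"
  have "Poly_Mapping.single ((us @ [comp x m]) @ vs) 1 \<in> ?S" for m
    by (rule Cons.IH[of _ "w @ [m]"])
      (use Cons.prems comp_component in \<open>auto intro: list_all2_appendI\<close>)
  then have "(\<Sum>m\<in>?I. Poly_Mapping.single (us @ comp x m # vs) 1) \<in> ?S"
    by (intro words.span_sum) simp
  moreover have "Poly_Mapping.single (us @ (\<Sum>m\<in>?I. comp x m) # vs) 1 -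
      (\<Sum>m\<in>?I. Poly_Mapping.single (us @ comp x m # vs) 1) \<in> ?S"
    using Cons.prems by (intro words.span_base UnI2 sum_R finite_comp) auto
  ultimately have "Poly_Mapping.single (us @ (\<Sum>m\<in>?I. comp x m) # vs) 1 \<in> ?S"
    using words.span_add by fastforce
  then show ?case unfolding sum_comp[symmetric] .
qed

lemma word_space_span: "word_space p \<subseteq> words.span ((\<Union>m. hom_words p m) \<union> R p)"
proof
  fix x :: "('k, 'a) words" assume x: "x \<in> word_space p"
  show "x \<in> words.span ((\<Union>m. hom_words p m) \<union> R p)"
    by (rule linear_in_subspace[OF lin_id words.subspace_span x])
      (use word_in_span[of "[]" "[]"] in auto)
qed

text \<open>The derivation in slot \<open>j\<close> multiplies that entry by its weight
  \<open>w ! j\<close>; moving this scalar out of the slot costs a scaling relation, and the weights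
  add up to \<open>m\<close>.\<close>

lemma L_hom_words:
  assumes "x \<in> hom_words p m"
  shows "cyc.L p x - words_scale (of_nat m) x \<in> R p"
proof -
  obtain l w where x: "x = Poly_Mapping.single l 1" and l: "length l = Suc p"
    and w: "list_all2 (\<lambda>x n. x \<in> \<A> n) l w" "sum_list w = m"
    using assms by (auto simp: hom_words_def)
  have len: "length w = Suc p" using w l by (auto dest: list_all2_lengthD)
  have D: "D (l ! j) = of_nat (w ! j) *s l ! j" if "j \<le> p" for j
    using weight_derivation_homogeneous list_all2_nthD[OF w(1), of j] l that by auto
  have "words_scale (of_nat m) x = (\<Sum>j\<in>{0..p}. Poly_Mapping.single l (of_nat (w ! j)))"
    unfolding w(2)[symmetric] x
    by (simp add: sum_list_sum_nth len atLeastLessThanSuc_atLeastAtMost single_sum)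
  then have "cyc.L p x - words_scale (of_nat m) x =
      (\<Sum>j\<in>{0..p}. Poly_Mapping.single (l[j := D (l ! j)]) 1 - Poly_Mapping.single l (of_nat (w ! j)))"
    by (simp add: cyc.L_from_def x sum_subtractf)
  also have "\<dots> \<in> R p"
  proof (rule words.subspace_sum[OF subspace_R])
    fix j assume j: "j \<in> {0..p}"
    have "l[j := D (l ! j)] = take j l @ (of_nat (w ! j) *s l ! j) # drop (Suc j) l"
      using j l D by (simp add: upd_conv_take_nth_drop)
    moreover have "l = take j l @ l ! j # drop (Suc j) l"
      using j l by (simp add: id_take_nth_drop[symmetric])
    ultimately show "Poly_Mapping.single (l[j := D (l ! j)]) 1 - Poly_Mapping.single l (of_nat (w ! j)) \<in> R p"
      using scale_R[of "take j l" "drop (Suc j) l" p "of_nat (w ! j)" "l ! j"] j l by simp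
  qed
  finally show ?thesis .
qed

definition one_word :: "nat \<Rightarrow> ('k, 'a) words" where
  "one_word p = Poly_Mapping.single (replicate (Suc p) 1) 1"

lemma one_word_space: "one_word p \<in> word_space p"
  by (simp add: one_word_def single_word_space)

lemma one_word_R': "p > 0 \<Longrightarrow> one_word p \<in> R' p"
  unfolding one_word_def by (rule degenerate_R'[of _ _ 1]) auto

text \<open>All faces of a word of ones give the same shorter word, so only the alternating sum of
  the signs matters.\<close>

lemma bw_one_word: "bw (one_word (Suc p)) = (if even p then 0 else one_word p)"
proof -
  have merge: "merge k (replicate (Suc (Suc p)) 1) = (replicate (Suc p) 1 :: 'a list)" for k
    by (rule nth_equalityI) (auto simp: nth_merge simp del: replicate_Suc)
  have "(\<Sum>k\<le>n. (-1 :: 'k) ^ k) = (if even n then 1 else 0)" for n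
    by (induction n) auto
  from this[of "Suc p"] show ?thesis
    unfolding bw_eq[OF one_word_space]
    by (simp add: one_word_def cyc.b_def merge single_sum[symmetric] del: replicate_Suc sum.atMost_Suc)
qed

end

section \<open>The augmentation\<close>

locale connected_graded_algebra_char_0 = connected_graded_algebra scale \<A>
  for scale :: "'k::field_char_0 \<Rightarrow> 'a::ring_1 \<Rightarrow> 'a" (infixr \<open>*s\<close> 75) and \<A>
begin

lemma scalar_word:
  assumes "\<And>x. x \<in> set vs \<Longrightarrow> x \<in> \<A> 0" "length us + length vs = Suc p"
  shows "\<exists>c. Poly_Mapping.single (us @ vs) 1 -
    words_scale c (Poly_Mapping.single (us @ replicate (length vs) 1) 1) \<in> R p"
  using assms
proof (induction vs arbitrary: us)
  case Nil
  show ?case using words.subspace_0[OF subspace_R] by (intro exI[of _ 1]) simp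
next
  case (Cons x vs)
  obtain c where x: "x = c *s 1" using Cons.prems(1)[of x] connected by auto
  obtain a where a: "Poly_Mapping.single ((us @ [1]) @ vs) 1 -
      words_scale a (Poly_Mapping.single ((us @ [1]) @ replicate (length vs) 1) 1) \<in> R p"
    using Cons.IH[of "us @ [1]"] Cons.prems by auto
  have "Poly_Mapping.single (us @ x # vs) 1 - Poly_Mapping.single (us @ 1 # vs) c \<in> R p"
    unfolding x using Cons.prems by (intro scale_R) simp
  from words.subspace_add[OF subspace_R this words.subspace_scale[OF subspace_R a, of c]]
  have "Poly_Mapping.single (us @ x # vs) 1 -
    words_scale (c * a) (Poly_Mapping.single (us @ replicate (length (x # vs)) 1) 1) \<in> R p"
    by (simp add: words.scale_right_diff_distrib)
  then show ?case by blast
qed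

text \<open>Weights are natural numbers, so total weight 0 puts every entry into
  \<open>\<A> 0\<close>, where connectedness makes it a scalar that can be moved out of its
  slot.\<close>

lemma hom_words_0:
  assumes "x \<in> hom_words p 0"
  shows "\<exists>c. x - words_scale c (one_word p) \<in> R p"
proof -
  obtain l w where x: "x = Poly_Mapping.single l 1" and l: "length l = Suc p"
    and w: "list_all2 (\<lambda>x n. x \<in> \<A> n) l w" "sum_list w = 0"
    using assms by (auto simp: hom_words_def)
  have "y \<in> \<A> 0" if y: "y \<in> set l" for y
  proof -
    obtain i where i: "i < length l" "y = l ! i" using y by (auto simp: in_set_conv_nth)
    moreover have "w ! i = 0" using w i by (auto dest: list_all2_lengthD)
    ultimately show ?thesis using list_all2_nthD[OF w(1), of i] by simp
  qed
  from scalar_word[of l "[]" p, OF this] show ?thesis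
    using l by (simp add: x one_word_def)
qed

text \<open>The description is unique because \<open>1 \<noteq> 0\<close> in a
  \<open>ring_1\<close>, so \<open>c *s 1\<close> determines \<open>c\<close>.\<close>

definition augmentation :: "'a \<Rightarrow> 'k" where "augmentation x = (THE c. comp x 0 = c *s 1)"

lemma augmentation: "comp x 0 = augmentation x *s 1"
proof -
  obtain c where "comp x 0 = c *s 1" using comp_component[of x 0] connected by auto
  then show ?thesis
    unfolding augmentation_def by (rule theI) (use \<open>comp x 0 = c *s 1\<close> scale_cancel_right in auto)
qed

lemma augmentation_eqI: "comp x 0 = c *s 1 \<Longrightarrow> augmentation x = c"
  using augmentation[of x] by (simp add: scale_cancel_right)

lemma augmentation_add: "augmentation (x + y) = augmentation x + augmentation y"
  by (rule augmentation_eqI) (unfold comp_add, simp add: augmentation scale_left_distrib)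

lemma augmentation_scale: "augmentation (c *s x) = c * augmentation x"
  by (rule augmentation_eqI) (unfold comp_scale, simp add: augmentation)

lemma augmentation_one: "augmentation 1 = 1"
  by (rule augmentation_eqI) (simp add: comp_homogeneous[OF one_component])

lemma augmentation_sum: "augmentation (sum f I) = (\<Sum>i\<in>I. augmentation (f i))"
proof -
  have "augmentation 0 = 0" using augmentation_scale[of 0 0] by simp
  then show ?thesis by (induction I rule: infinite_finite_induct) (simp_all add: augmentation_add)
qed

lemma augmentation_homogeneous: "x \<in> \<A> m \<Longrightarrow> m > 0 \<Longrightarrow> augmentation x = 0"
  by (rule augmentation_eqI) (simp add: comp_homogeneous)

lemma augmentation_comp: "augmentation (comp x m) = (if m = 0 then augmentation x else 0)"
proof (cases "m = 0")
  case True
  have "comp (comp x 0) 0 = comp x 0" by (simp add: comp_homogeneous[OF comp_component])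
  then have "augmentation (comp x 0) = augmentation x"
    by (intro augmentation_eqI) (simp only: augmentation)
  then show ?thesis using True by simp
qed (simp add: augmentation_homogeneous[OF comp_component])

text \<open>Weights add up, so only the product of the two components of weight 0 contributes, and
  these are scalars.\<close>

lemma augmentation_mult: "augmentation (x * y) = augmentation x * augmentation y"
proof -
  let ?I = "insert 0 {m. comp x m \<noteq> 0}" and ?J = "insert 0 {m. comp y m \<noteq> 0}"
  have fin: "finite ?I" "finite ?J" using finite_comp by auto
  have xy: "x * y = (\<Sum>i\<in>?I. \<Sum>j\<in>?J. comp x i * comp y j)"
    by (subst (1) comp_sum[OF fin(1)], blast, subst (1) comp_sum[OF fin(2)], blast) (rule sum_product)
  have "augmentation (comp x i * comp y j) = augmentation (comp x i) * augmentation (comp y j)" for i j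
  proof (cases "i + j = 0")
    case True
    then have "comp x i * comp y j = (augmentation x * augmentation y) *s 1"
      by (simp add: augmentation scale_mult_left scale_mult_right)
    then show ?thesis using True by (simp add: augmentation_scale augmentation_one augmentation_comp)
  next
    case False
    then show ?thesis
      using augmentation_homogeneous[OF mult_component[OF comp_component comp_component], of i j x y]
      by (auto simp: augmentation_comp)
  qed
  then have "augmentation (x * y) = (\<Sum>i\<in>?I. augmentation (comp x i)) * (\<Sum>j\<in>?J. augmentation (comp y j))"
    unfolding xy augmentation_sum sum_product by simp
  also have "\<dots> = augmentation x * augmentation y"
    unfolding augmentation_sum[symmetric] by (subst (1 2) comp_sum[symmetric]) (use fin in auto)
  finally show ?thesis .
qed

lemma augmentation_D: "augmentation (D x) = 0"
proof -
  have "augmentation (D x) = (\<Sum>m | comp x m \<noteq> 0. of_nat m * augmentation (comp x m))"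
    unfolding weight_derivation_def augmentation_sum augmentation_scale ..
  also have "\<dots> = 0" by (rule sum.neutral) (auto simp: augmentation_comp)
  finally show ?thesis .
qed

text \<open>The empty word spans a copy of \<open>k\<close>, so that the functional is again an operator on words.\<close>

definition aug :: "('k, 'a) words \<Rightarrow> ('k, 'a) words" where
  "aug = words_extend (\<lambda>l. Poly_Mapping.single [] (prod_list (map augmentation l)))"

lemma lin_aug: "lin aug"
  unfolding aug_def by (rule linear_words_extend)

lemma aug_single: "aug (Poly_Mapping.single l a) = Poly_Mapping.single [] (a * prod_list (map augmentation l))"
  by (simp add: aug_def)

lemma aug_one_word: "aug (one_word p) = Poly_Mapping.single [] 1"
proof -
  have "prod_list (map augmentation (replicate n 1)) = 1" for n
    by (induction n) (simp_all add: augmentation_one)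
  then show ?thesis unfolding one_word_def aug_single by (simp add: augmentation_one)
qed

lemma aug_R: "x \<in> R p \<Longrightarrow> aug x = 0"
proof -
  interpret aug: Vector_Spaces.linear words_scale words_scale aug by (rule lin_aug)
  have "aug ` multilinear_relators scale p \<subseteq> {0}"
  proof clarify
    fix r :: "('k, 'a) words" assume "r \<in> multilinear_relators scale p"
    then show "aug r = 0"
      by cases (simp_all add: aug.diff aug.add aug.scale aug_single augmentation_add augmentation_scale
          distrib_left distrib_right single_add single_diff mult_ac)
  qed
  then show "x \<in> R p \<Longrightarrow> aug x = 0"
    using words_span_image[OF lin_aug words.subspace_single_0] unfolding hoch_relations_def by blast
qed

text \<open>The boundary of \<open>[u, v]\<close> is \<open>[u v] - [v u]\<close>, and the
  augmentation is multiplicative with values in a commutative field. Hence \<open>aug\<close>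
  descends to Hochschild homology in degree 0.\<close>

lemma aug_b:
  assumes "x \<in> word_space (Suc 0)"
  shows "aug (bw x) = 0"
proof -
  have "aug (bw x) \<in> {0}"
  proof (rule linear_in_subspace[OF lin_comp[OF lin_aug linear_words_extend] words.subspace_single_0 assms])
    fix l :: "'a list" assume "length l = Suc (Suc 0)"
    then obtain u v where "l = [u, v]" by (auto simp: length_Suc_conv)
    then show "aug (bw (Poly_Mapping.single l 1)) \<in> {0}"
      using additive.add[OF linear_additive[OF lin_aug]]
      by (simp add: b_word_def aug_single augmentation_mult single_add[symmetric])
  qed
  then show ?thesis by simp
qed

text \<open>\<open>D v\<close> has no component of weight 0, so the factor it contributes has
  augmentation 0. Hence \<open>aug\<close> descends further to the quotient by the image of
  \<open>e\<close>.\<close>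

lemma aug_e:
  assumes "x \<in> word_space (Suc 0)"
  shows "aug (ew x) = 0"
proof -
  have "aug (ew x) \<in> {0}"
  proof (rule linear_in_subspace[OF lin_comp[OF lin_aug linear_words_extend] words.subspace_single_0 assms])
    fix l :: "'a list" assume "length l = Suc (Suc 0)"
    then obtain u v where "l = [u, v]" by (auto simp: length_Suc_conv)
    then show "aug (ew (Poly_Mapping.single l 1)) \<in> {0}"
      by (simp add: eD_word_def aug_single augmentation_mult augmentation_D)
  qed
  then show ?thesis by simp
qed

text \<open>Only the stability of \<open>Q\<close> under the operators has to be supplied for each
  complex. The inclusion \<open>R p \<subseteq> Q p\<close> carries over every identity known modulo
  multilinearity.\<close>

lemma mixed_cartan_words:
  fixes Q :: "nat \<Rightarrow> ('k, 'a) words set"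
  assumes "\<And>p. words.subspace (Q p)" "\<And>p. Q p \<subseteq> word_space p" "\<And>p. R p \<subseteq> Q p"
    and "\<And>p x. x \<in> Q (Suc p) \<Longrightarrow> cyc.b (Suc p) x \<in> Q p" "\<And>p x. x \<in> Q (Suc p) \<Longrightarrow> cyc.e (Suc p) x \<in> Q p"
    and "\<And>p x. x \<in> Q p \<Longrightarrow> cyc.B p x \<in> Q (Suc p)" "\<And>p x. x \<in> Q p \<Longrightarrow> cyc.E p x \<in> Q (Suc p)"
    and "\<And>p x. x \<in> Q p \<Longrightarrow> cyc.L p x \<in> Q p"
  shows "mixed_cartan words_scale word_space Q bw ew Bw cyc.E cyc.L hom_words one_word"
proof (rule mixed_cartan.intro, goal_cases)
  case 1
  show ?case ..
next
  case 2
  show ?case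
  proof (rule mixed_cartan_axioms.intro)
    note Q_W = subsetD[OF assms(2)] and R_Q = subsetD[OF assms(3)]
    have W_0: "0 \<in> word_space n" for n by (rule words.subspace_0[OF subspace_word_space])
    fix p m :: nat and x :: "('k, 'a) words"
      interpret Bw: additive Bw by (rule linear_additive[OF linear_words_extend])
    show "lin bw" "lin ew" "lin Bw" by (rule linear_words_extend)+
    show "lin (cyc.L p)" by (rule lin_L)
    show "words.subspace (word_space p :: ('k, 'a) words set)" by (rule subspace_word_space)
    show "words.subspace (Q p)" "Q p \<subseteq> word_space p" by (rule assms)+
    show bW: "bw x \<in> word_space p" if "x \<in> word_space (Suc p)" for x p
      using cyc.b_W[OF that] that by (simp add: bw_eq)
    show b0: "bw x = 0" if "x \<in> word_space 0" for x using that by (simp add: bw_eq cyc.b_def)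
    show eW: "ew x \<in> word_space p" if "x \<in> word_space (Suc p)" for x p
      using cyc.e_W[OF that] that by (simp add: ew_eq)
    show e0: "ew x = 0" if "x \<in> word_space 0" for x using that by (simp add: ew_eq cyc.e_def)
    show BW: "Bw x \<in> word_space (Suc p)" if "x \<in> word_space p" for x p
      using cyc.B_W[OF that] that by (simp add: Bw_eq)
    show EW: "cyc.E p x \<in> word_space (Suc p)" if "x \<in> word_space p" for x p by (rule cyc.E_W[OF that])
    show "bw x \<in> Q p" if "x \<in> Q (Suc p)" using assms(4)[OF that] Q_W[OF that] by (simp add: bw_eq)
    show "ew x \<in> Q p" if "x \<in> Q (Suc p)" using assms(5)[OF that] Q_W[OF that] by (simp add: ew_eq)
    show "Bw x \<in> Q (Suc p)" if "x \<in> Q p" using assms(6)[OF that] Q_W[OF that] by (simp add: Bw_eq)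
    show "x \<in> Q p \<Longrightarrow> cyc.E p x \<in> Q (Suc p)" "x \<in> Q p \<Longrightarrow> cyc.L p x \<in> Q p" by (rule assms, assumption)+
    show "bw (bw x) \<in> Q p" if "x \<in> word_space (Suc (Suc p))"
      using cyc.b_b[OF that] bW[OF that] that words.subspace_0[OF assms(1)] by (simp add: bw_eq)
    show "bw (ew x) + ew (bw x) \<in> Q p" if "x \<in> word_space (Suc (Suc p))"
      using cyc.e_b[OF that] bW[OF that] eW[OF that] that R_Q by (simp add: bw_eq ew_eq cyc.eqR_def)
    show "bw (Bw x) + Bw (bw x) \<in> Q p" if x: "x \<in> word_space p"
    proof (cases p)
      case 0
      then show ?thesis
        using x cyc.b_B_0[of x] BW[OF x] b0 words.subspace_0[OF assms(1)] by (simp add: bw_eq Bw_eq Bw.zero cyc.b_def W_0 cyc.B.zero)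
    next
      case (Suc q)
      then show ?thesis
        using x cyc.b_B[of x q] BW[OF x] bW[of x q] words.subspace_0[OF assms(1)] by (simp add: bw_eq Bw_eq)
    qed
    show "ew (Bw x) - cyc.L 0 x \<in> Q 0" if "x \<in> word_space 0"
      using cyc.cartan_0[OF that] BW[OF that] that words.subspace_0[OF assms(1)] by (simp add: ew_eq Bw_eq)
    show "ew (Bw x) + Bw (ew x) + (bw (cyc.E (Suc p) x) + cyc.E p (bw x)) - cyc.L (Suc p) x \<in> Q (Suc p)"
      if "x \<in> word_space (Suc p)"
      using cyc.cartan[OF that] BW[OF that] bW[OF that] eW[OF that] EW[OF that] that R_Q
      by (simp add: bw_eq ew_eq Bw_eq cyc.eqR_def)
    show "word_space p \<subseteq> words.span ((\<Union>m. hom_words p m) \<union> Q p)"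
      using word_space_span[of p] words.span_mono[of "(\<Union>m. hom_words p m) \<union> R p" "(\<Union>m. hom_words p m) \<union> Q p"]
        assms(3)[of p] by blast
    show "x \<in> hom_words p m \<Longrightarrow> cyc.L p x - words_scale (of_nat m) x \<in> Q p"
      using L_hom_words R_Q by blast
    show "x \<in> hom_words p 0 \<Longrightarrow> \<exists>c. x - words_scale c (one_word p) \<in> Q p"
      using hom_words_0 R_Q by blast
  qed
qed

sublocale hi: mixed_cartan words_scale word_space R bw ew Bw cyc.E cyc.L hom_words one_word
  by (rule mixed_cartan_words)
    (auto intro: subspace_R subsetD[OF R_word_space] cyc.b_R cyc.e_R cyc.B_R cyc.E_R cyc.L_from_R)

sublocale dR: mixed_cartan words_scale word_space R' bw ew Bw cyc.E cyc.L hom_words one_word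
  by (rule mixed_cartan_words)
    (auto intro: subspace_R' subsetD[OF R'_word_space] R_R' b_R' e_R' B_R' E_R' L_R')

end

section \<open>The iterated subquotients\<close>

text \<open>The chain modules and their induced maps are built here for an arbitrary
  \<open>Q\<close>, in exactly the form to which the definitions of both homology theories
  unfold.\<close>

locale word_mixed_cartan = mixed_cartan words_scale word_space Q b e B E L H one
  for Q :: "nat \<Rightarrow> ('k::field_char_0, 'a::ring_1) words set" and b e B E L H one
begin

abbreviation chains :: "nat \<Rightarrow> ('k, ('k, 'a) words set) module" where
  "chains p \<equiv> quotient_module (words_module p) (Q p)"
abbreviation to_chains :: "nat \<Rightarrow> ('k, 'a) words \<Rightarrow> ('k, 'a) words set" where
  "to_chains p x \<equiv> Q p +>\<^bsub>words_module p\<^esub> x"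
abbreviation chains_b :: "nat \<Rightarrow> ('k, 'a) words set \<Rightarrow> ('k, 'a) words set" where
  "chains_b p \<equiv> quotient_map (words_module (p - 1)) (Q (p - 1)) b"
abbreviation bds :: "nat \<Rightarrow> ('k, 'a) words set set" where
  "bds \<equiv> boundaries chains chains_b"
abbreviation to_homology :: "nat \<Rightarrow> ('k, 'a) words \<Rightarrow> ('k, 'a) words set set" where
  "to_homology p x \<equiv> bds p +>\<^bsub>chains p\<^esub> to_chains p x"

lemma presents_words: "words.presents (words_module p) (word_space p :: ('k, 'a) words set) {0} (\<lambda>x. x)"
  unfolding words.presents_def
  using words.subspace_0[OF sub_W] words.subspace_single_0 sub_W
  by (simp add: carrier_words_module) (simp add: words_module_def)

lemma presents_chains: "words.presents (chains p) (word_space p) (Q p) (to_chains p)"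
proof -
  have "(words_module p)\<lparr>carrier := word_space p :: ('k, 'a) words set\<rparr> = words_module p"
    by (simp add: words_module_def word_space_def)
  then show ?thesis
    using words.presents_quotient[OF presents_words[of p] sub_Q[of p] _ Q_W sub_W subset_refl]
      words.subspace_0[OF sub_Q] by simp
qed

lemma quotient_map_chains:
  assumes "lin f" "\<And>x. x \<in> word_space p \<Longrightarrow> f x \<in> word_space q" "\<And>x. x \<in> Q p \<Longrightarrow> f x \<in> Q q"
    and "x \<in> word_space p"
  shows "quotient_map (words_module q) (Q q) f (to_chains p x) = to_chains q (f x)"
proof -
  have 0: "{0} \<subseteq> Q n" for n using words.subspace_0[OF sub_Q] by simp
  show ?thesis
    using words.quotient_map_eq[OF presents_words sub_Q 0 Q_W sub_W subset_refl presents_words sub_Q 0 Q_W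
        _ assms(2,3) additive.diff[OF linear_additive[OF assms(1)]] assms(4), where f = f]
    by simp
qed

lemma
  shows bds_eq: "bds p = to_chains p ` Bd p"
    and presents_hh: "words.presents (homology chains chains_b p) (Z p) (Bd p) (to_homology p)"
  unfolding Z_def Bd_def
  by (rule words.presents_homology[OF presents_chains lin(1)];
      use quotient_map_chains[OF lin(1) b_W b_Q] b_W b_0 b_Q b_b words.subspace_0[OF sub_Q] in simp)+

lemma quotient_map_homology:
  assumes "lin f" "\<And>x. x \<in> word_space p \<Longrightarrow> f x \<in> word_space q" "\<And>x. x \<in> Q p \<Longrightarrow> f x \<in> Q q"
    and "\<And>x. x \<in> Bd p \<Longrightarrow> f x \<in> Bd q" and x: "x \<in> Z p"
  shows "quotient_map (chains q) (bds q) (quotient_map (words_module q) (Q q) f) (to_homology p x) =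
    to_homology q (f x)"
proof -
  note Z = words.presentsD(3)[OF presents_hh]
  have Q: "Q n \<subseteq> Bd n" and ZW: "Z n \<subseteq> word_space n" for n using Q_Bd by (auto simp: Z_def)
  then have BW: "Bd n \<subseteq> word_space n" for n using Z by blast
  show ?thesis
    unfolding bds_eq
  proof (rule words.quotient_map_eq[OF presents_chains sub_Bd Q Z sub_Z ZW presents_chains sub_Bd Q BW])
    fix y assume y: "y \<in> Z p"
    then have yW: "y \<in> word_space p" using ZW by blast
    show "quotient_map (words_module q) (Q q) f (to_chains p y) = to_chains q (f y)"
      by (rule quotient_map_chains[OF assms(1) _ _ yW]) (fact assms)+
    show "f y \<in> word_space q" by (rule assms(2)[OF yW])
  qed (use assms(4) x additive.diff[OF linear_additive[OF assms(1)]] in auto)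
qed

text \<open>The hypothesis concerns cycles and asks only for a boundary, since \<open>e\<close>
  squares to zero in homology and not on chains. The analogous hypothesis for \<open>B\<close> below
  is the stronger one that holds on words.\<close>

lemma presents_higher:
  assumes e_e: "\<And>p x. x \<in> Z (Suc (Suc p)) \<Longrightarrow> e (e x) \<in> Bd p"
  shows "\<exists>\<rho>. words.presents (homology (homology chains chains_b)
      (\<lambda>p. quotient_map (chains (p - 1)) (bds (p - 1)) (quotient_map (words_module (p - 1)) (Q (p - 1)) e)) p)
      (S_hi p) (K_hi p) \<rho>"
  unfolding S_hi_def K_hi_def
proof (rule exI, rule words.presents_homology(2)[OF presents_hh lin(2)])
  show "quotient_map (chains (Suc p - 1)) (bds (Suc p - 1)) (quotient_map (words_module (Suc p - 1)) (Q (Suc p - 1)) e)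
      (to_homology (Suc p) x) = to_homology p (e x)" if "x \<in> Z (Suc p)" for p x
    using quotient_map_homology[OF lin(2) e_W e_Q e_Bd that] by simp
  show "e x \<in> Bd 0" if "x \<in> Z 0" for x
    using that e_0 words.subspace_0[OF sub_Bd] by (simp add: Z_def)
qed (rule e_Z e_Bd e_e, assumption)+

lemma presents_deRham:
  assumes B_B: "\<And>p x. x \<in> word_space p \<Longrightarrow> B (B x) \<in> Q (Suc (Suc p))"
  shows "\<exists>\<rho>. words.presents (cohomology (homology chains chains_b)
      (\<lambda>p. quotient_map (chains (Suc p)) (bds (Suc p)) (quotient_map (words_module (Suc p)) (Q (Suc p)) B)) p)
      (S_dR p) (K_dR p) \<rho>"
  unfolding S_dR_def K_dR_def
proof (rule exI, rule words.presents_cohomology[OF presents_hh lin(3)])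
  show "quotient_map (chains (Suc p)) (bds (Suc p)) (quotient_map (words_module (Suc p)) (Q (Suc p)) B)
      (to_homology p x) = to_homology (Suc p) (B x)" if "x \<in> Z p" for p x
    by (rule quotient_map_homology[OF lin(3) B_W B_Q B_Bd that])
  show "B (B x) \<in> Bd (Suc (Suc p))" if "x \<in> Z p" for p x
    using that by (intro Q_Bd B_B) (simp add: Z_def)
qed (rule B_Z B_Bd, assumption)+

end

context connected_graded_algebra_char_0
begin

sublocale hi: word_mixed_cartan R bw ew Bw cyc.E cyc.L hom_words one_word ..
sublocale dR: word_mixed_cartan R' bw ew Bw cyc.E cyc.L hom_words one_word ..

section \<open>Presentations of the two theories and their values\<close>

lemma presents_HH_hi: "\<exists>\<rho>. words.presents (HH_hi scale \<A> p) (hi.S_hi p) (hi.K_hi p) \<rho>"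
proof -
  have "ew (ew x) \<in> hi.Bd p" if x: "x \<in> hi.Z (Suc (Suc p))" for p x
  proof -
    have xW: "x \<in> word_space (Suc (Suc p))" and bx: "bw x \<in> R (Suc p)" using x by (auto simp: hi.Z_def)
    let ?e = "cyc.e2 (Suc (Suc p)) x"
    have eW: "ew x \<in> word_space (Suc p)" by (rule hi.e_W[OF xW])
    have e2W: "?e \<in> word_space (Suc p)" by (rule cyc.e2_W[OF xW])
    \<comment> \<open>On a cycle the null homotopy by \<open>cyc.e2\<close> has two harmless terms:
      the first is a boundary, and the second is a relation because \<open>bw x\<close> is
      one.\<close>
    have "cyc.eqR p (ew (ew x) + ew (ew x)) (bw ?e + cyc.e2 (Suc p) (bw x))"
      using cyc.e_e[OF xW] by (simp add: ew_eq[OF xW, symmetric] bw_eq[OF xW, symmetric] ew_eq[OF eW, symmetric]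
          bw_eq[OF e2W, symmetric])
    then have "ew (ew x) + ew (ew x) - (bw ?e + cyc.e2 (Suc p) (bw x)) \<in> hi.Bd p"
      unfolding cyc.eqR_def by (rule hi.Q_Bd)
    from words.subspace_add[OF hi.sub_Bd this words.subspace_add[OF hi.sub_Bd hi.b_Bd[OF e2W]
        hi.Q_Bd[OF cyc.e2_R[OF bx]]]]
    have "ew (ew x) + ew (ew x) \<in> hi.Bd p" by simp
    moreover have "ew (ew x) = words_scale (1 / 2) (ew (ew x) + ew (ew x))"
      by (simp add: words.scale_left_distrib[symmetric] words.scale_right_distrib)
    ultimately show ?thesis using words.subspace_scale[OF hi.sub_Bd] by metis
  qed
  from hi.presents_higher[OF this, of p] show ?thesis
    unfolding HH_hi_def HH_def[abs_def] H_eD_def[abs_def] eD_chain_def[abs_def] hoch_b_def[abs_def] hoch_chains_def[abs_def] .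
qed

lemma presents_H_dR: "\<exists>\<rho>. words.presents (H_dR scale p) (dR.S_dR p) (dR.K_dR p) \<rho>"
proof -
  have "Bw (Bw x) \<in> R' (Suc (Suc p))" if "x \<in> word_space p" for p x
    using B_B[OF that] Bw_eq[OF that] Bw_eq[OF hi.B_W[OF that]] by simp
  from dR.presents_deRham[OF this, of p] show ?thesis
    unfolding H_dR_def HH_normalized_def[abs_def] H_B_def[abs_def] connes_B_chain_def[abs_def]
      normalized_b_def[abs_def] normalized_chains_def[abs_def] .
qed

lemma iso_zero_module:
  assumes "words.presents M S K \<rho>" "S \<subseteq> K"
  shows "M \<cong>\<^sub>k zero_module" "zero_module \<cong>\<^sub>k M"
proof -
  have "words.presents zero_module S K (\<lambda>_. ())"
    using words.presentsD(1-3)[OF assms(1)] assms(2) words.subspace_0 words.subspace_diff[of S]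
    unfolding words.presents_def zero_module_def by (auto simp: image_def)
  then show "M \<cong>\<^sub>k zero_module" "zero_module \<cong>\<^sub>k M"
    using words.presents_linear_iso assms(1) by blast+
qed

text \<open>\<open>h\<close> reads off the coefficient of a class with respect to
  \<open>one_word p\<close>. It is constant on classes as \<open>aug\<close> vanishes on
  \<open>K\<close>, separates them as \<open>one_word p\<close> generates \<open>S\<close> modulo
  \<open>K\<close>, and is onto as \<open>aug\<close> takes the value 1 there.\<close>

lemma iso_ground_field:
  assumes M: "words.presents M S K \<rho>" and gen: "\<And>x. x \<in> S \<Longrightarrow> \<exists>c. x - words_scale c (one_word p) \<in> K"
    and one: "one_word p \<in> S" and K: "\<And>x. x \<in> K \<Longrightarrow> aug x = 0"
  shows "M \<cong>\<^sub>k ground_field" "ground_field \<cong>\<^sub>k M"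
proof -
  interpret aug: Vector_Spaces.linear words_scale words_scale aug by (rule lin_aug)
  note D = words.presentsD[OF M]
  define h where "h x = Poly_Mapping.lookup (aug x) []" for x
  have h_diff: "h (x - y) = h x - h y" for x y by (simp add: h_def aug.diff lookup_minus)
  have h_one: "h (words_scale c (one_word p)) = c" for c
    by (simp add: h_def aug.scale aug_one_word lookup_words_scale)
  have "h x = h y \<longleftrightarrow> x - y \<in> K" if xy: "x \<in> S" "y \<in> S" for x y
  proof
    assume "h x = h y"
    obtain c where c: "x - y - words_scale c (one_word p) \<in> K"
      using gen[OF words.subspace_diff[OF D(1) xy]] by blast
    have "h (x - y - words_scale c (one_word p)) = 0" unfolding h_def K[OF c] by simp
    then have "c = 0" using \<open>h x = h y\<close> unfolding h_diff h_one by simp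
    then show "x - y \<in> K" using c by simp
  next
    assume "x - y \<in> K"
    then have "h (x - y) = 0" unfolding h_def using K by simp
    then show "h x = h y" unfolding h_diff by simp
  qed
  moreover have "h ` S = UNIV"
  proof -
    have "c \<in> h ` S" for c
      using h_one[of c] words.subspace_scale[OF D(1) one, of c] by (metis imageI)
    then show ?thesis by blast
  qed
  ultimately have "words.presents ground_field S K h"
    unfolding words.presents_def ground_field_def using D(1-3)
    by (auto simp: h_def aug.add aug.scale aug.zero lookup_add lookup_words_scale)
  then show "M \<cong>\<^sub>k ground_field" "ground_field \<cong>\<^sub>k M"
    using words.presents_linear_iso M by blast+
qed

lemma aug_Bd:
  assumes Q: "Q 0 = R 0" and x: "x \<in> {bw y + k |y k. y \<in> word_space (Suc 0) \<and> k \<in> Q 0}"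
  shows "aug x = 0"
proof -
  interpret aug: Vector_Spaces.linear words_scale words_scale aug by (rule lin_aug)
  obtain y k where "x = bw y + k" "y \<in> word_space (Suc 0)" "k \<in> R 0" using x Q by auto
  then show ?thesis using aug_b aug_R by (simp add: aug.add)
qed

text \<open>Both directions are recorded, since \<open>H_dR\<close> is compared with
  \<open>HH_hi\<close> by transitivity through \<open>ground_field\<close>.\<close>

lemma HH_hi_0: "HH_hi scale \<A> 0 \<cong>\<^sub>k ground_field" "ground_field \<cong>\<^sub>k HH_hi scale \<A> 0"
proof -
  interpret aug: Vector_Spaces.linear words_scale words_scale aug by (rule lin_aug)
  obtain \<rho> where \<rho>: "words.presents (HH_hi scale \<A> 0) (hi.S_hi 0) (hi.K_hi 0) \<rho>"
    using presents_HH_hi by blast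
  have one: "one_word 0 \<in> hi.S_hi 0"
    using one_word_space[of 0] hi.b_0[OF one_word_space] hi.e_0[OF one_word_space]
      words.subspace_0[OF subspace_R] words.subspace_0[OF hi.sub_Bd] by (simp add: hi.S_hi_def hi.Z_def)
  have K: "aug x = 0" if x: "x \<in> hi.K_hi 0" for x
  proof -
    obtain y k where "x = ew y + k" "y \<in> hi.Z (Suc 0)" "k \<in> hi.Bd 0" using x by (auto simp: hi.K_hi_def)
    then show ?thesis using aug_e aug_Bd[of R k] by (auto simp: aug.add hi.Z_def hi.Bd_def)
  qed
  note gen = hi.S_hi_generated[OF words.presentsD(3)[OF \<rho>]]
  show "HH_hi scale \<A> 0 \<cong>\<^sub>k ground_field" "ground_field \<cong>\<^sub>k HH_hi scale \<A> 0"
    by (rule iso_ground_field[OF \<rho> gen one K]; assumption)+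
qed

lemma H_dR_0: "H_dR scale 0 \<cong>\<^sub>k ground_field"
proof -
  interpret aug: Vector_Spaces.linear words_scale words_scale aug by (rule lin_aug)
  obtain \<rho> where \<rho>: "words.presents (H_dR scale 0) (dR.S_dR 0) (dR.K_dR 0) \<rho>"
    using presents_H_dR by blast
  \<comment> \<open>\<open>B 1 = 1 \<otimes> 1\<close> is degenerate, so the unit is closed.\<close>
  have "Bw (one_word 0) \<in> R' (Suc 0)"
    unfolding Bw_eq[OF one_word_space] unfolding one_word_def by (rule B_one_in_set) auto
  then have one: "one_word 0 \<in> dR.S_dR 0"
    using one_word_space[of 0] hi.b_0[OF one_word_space] words.subspace_0[OF subspace_R']
    by (simp add: dR.S_dR_def dR.Z_def dR.Q_Bd)
  \<comment> \<open>Nothing but \<open>Bd 0\<close> is divided out in degree 0, and there are no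
    degenerate words of that degree.\<close>
  have K: "aug x = 0" if "x \<in> dR.K_dR 0" for x
    using that aug_Bd[of R' x] R'_0 by (auto simp: dR.K_dR_def dR.Bd_def hi.B.zero)
  show ?thesis
    by (rule iso_ground_field(1)[OF \<rho> dR.S_dR_generated[OF words.presentsD(3)[OF \<rho>]] one K])
qed

text \<open>The word of ones has weight 0 and escapes the homotopy. For odd \<open>p\<close> it is
  \<open>b\<close> of the next word of ones. For even \<open>p\<close> it is sent by
  \<open>b\<close> to the preceding one, which \<open>aug\<close> shows not to be a relation, so
  only its zero multiple is a cycle.\<close>

lemma HH_hi_pos:
  assumes "p > 0"
  shows "HH_hi scale \<A> p \<cong>\<^sub>k zero_module" "zero_module \<cong>\<^sub>k HH_hi scale \<A> p"
proof -
  interpret aug: Vector_Spaces.linear words_scale words_scale aug by (rule lin_aug)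
  obtain \<rho> where \<rho>: "words.presents (HH_hi scale \<A> p) (hi.S_hi p) (hi.K_hi p) \<rho>"
    using presents_HH_hi by blast
  note D = words.presentsD[OF \<rho>]
  have "hi.S_hi p \<subseteq> hi.K_hi p"
  proof
    fix x assume x: "x \<in> hi.S_hi p"
    obtain c where c: "x - words_scale c (one_word p) \<in> hi.K_hi p"
      using hi.S_hi_generated[OF D(3) x] by blast
    have "words_scale c (one_word p) \<in> hi.K_hi p"
    proof (cases "even p")
      case True
      then obtain q where p: "p = Suc q" "odd q" using assms by (cases p) auto
      \<comment> \<open>The multiple of \<open>one_word p\<close> is a difference of two elements of
        \<open>S_hi p\<close>, hence itself a cycle; this is what forces
        \<open>c = 0\<close>.\<close>
      have "x - (x - words_scale c (one_word p)) \<in> hi.S_hi p"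
        by (rule words.subspace_diff[OF D(1) x subsetD[OF D(3) c]])
      then have "bw (words_scale c (one_word p)) \<in> R (p - 1)"
        unfolding hi.S_hi_def hi.Z_def by simp
      moreover have "bw (words_scale c (one_word p)) = words_scale c (one_word q)"
        unfolding hi.b.scale p(1) bw_one_word using p(2) by simp
      ultimately have "words_scale c (one_word q) \<in> R q"
        unfolding p(1) diff_Suc_1 by (simp only:)
      then have "aug (words_scale c (one_word q)) = 0" by (rule aug_R)
      then have "words_scale c (Poly_Mapping.single ([] :: 'a list) (1 :: 'k)) = 0"
        unfolding aug.scale aug_one_word .
      then have "c = 0" by (metis lookup_single_eq lookup_words_scale lookup_zero mult.right_neutral)
      then show ?thesis using words.subspace_0[OF D(2)] by simp
    next
      case False
      then have "one_word p \<in> hi.K_hi p"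
        using bw_one_word[of p] hi.b_Bd[OF one_word_space] hi.Bd_K_hi by metis
      then show ?thesis by (rule words.subspace_scale[OF D(2)])
    qed
    from words.subspace_add[OF D(2) c this] show "x \<in> hi.K_hi p" by simp
  qed
  from iso_zero_module[OF \<rho> this] show "HH_hi scale \<A> p \<cong>\<^sub>k zero_module" "zero_module \<cong>\<^sub>k HH_hi scale \<A> p" .
qed

lemma H_dR_pos:
  assumes "p > 0"
  shows "H_dR scale p \<cong>\<^sub>k zero_module"
proof -
  obtain \<rho> where \<rho>: "words.presents (H_dR scale p) (dR.S_dR p) (dR.K_dR p) \<rho>"
    using presents_H_dR by blast
  note D = words.presentsD[OF \<rho>]
  have one: "one_word p \<in> dR.K_dR p"
    by (rule dR.Bd_K_dR[OF dR.Q_Bd[OF one_word_R'[OF assms]]])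
  have "dR.S_dR p \<subseteq> dR.K_dR p"
  proof
    fix x assume "x \<in> dR.S_dR p"
    then obtain c where "x - words_scale c (one_word p) \<in> dR.K_dR p"
      using dR.S_dR_generated[OF D(3)] by blast
    from words.subspace_add[OF D(2) this words.subspace_scale[OF D(2) one, of c]]
    show "x \<in> dR.K_dR p" by simp
  qed
  from iso_zero_module(1)[OF \<rho> this] show ?thesis .
qed

end

theorem theorem6p3:
  fixes scale :: "'k::field_char_0 \<Rightarrow> 'a::ring_1 \<Rightarrow> 'a"
    and \<A> :: "nat \<Rightarrow> 'a set"
  assumes "connected_graded_algebra scale \<A>"
  shows "(H_dR scale 0 \<cong>\<^sub>k HH_hi scale \<A> 0 \<and> HH_hi scale \<A> 0 \<cong>\<^sub>k ground_field) \<and>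
         (\<forall>p>0. H_dR scale p \<cong>\<^sub>k HH_hi scale \<A> p \<and> HH_hi scale \<A> p \<cong>\<^sub>k zero_module)"
proof -
  interpret connected_graded_algebra_char_0 scale \<A>
    using assms by (rule connected_graded_algebra_char_0.intro)
  show ?thesis
    using linear_iso_trans[OF H_dR_0 HH_hi_0(2)] HH_hi_0(1)
      linear_iso_trans[OF H_dR_pos HH_hi_pos(2)] HH_hi_pos(1) by blast
qed

end
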